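(* Let $\mathsf f$ be an a.s. uniformly bounded additive functional on a uniformly elliptic Markov array $\mathsf X$. The following are equivalent: (i) the sequence $\mathrm{Var}(S_N)$ is bounded; (ii) $\mathsf f$ is center-tight; (iii) $\mathsf f=\nabla\mathsf a+\mathsf h$, where $\mathsf a$ is a uniformly bounded potential and $\mathsf h$ is an additive functional on $\mathsf X$ with summable variance.
   Context: Markov array. A Markov array $\mathsf X$ is given by: a strictly increasing sequence of integers $k_N\ge 1$ (row $N$ has length $k_N+1$); complete separable metric spaces $\mathfrak S_n^{(N)}$ ($1\le n\le k_N+1$), each with more than one point, with their Borel $\sigma$-algebras; transition kernels $\pi^{(N)}_{n,n+1}(x,dy)$ from $\mathfrak S_n^{(N)}$ to $\mathfrak S_{n+1}^{(N)}$ ($1\le n\le k_N$), where no $\pi^{(N)}_{n,n+1}(x,\cdot)$ is carried by a single atom; and initial Borel probability distributions $\pi^{(N)}$ on $\mathfrak S_1^{(N)}$. For each $N$ this defines a finite Markov chain $X_1^{(N)},\dots,X^{(N)}_{k_N+1}$. No joint distribution between different rows is specified; $\mathbb P,\mathbb E,\mathrm{Var}$ refer to the row under consideration. Uniform ellipticity. $\mathsf X$ is uniformly elliptic if there are $0<\epsilon_0<1$, Borel probability measures $\mu_n^{(N)}$ on $\mathfrak S_n^{(N)}$ and measurable $p_n^{(N)}:\mathfrak S_n^{(N)}\times\mathfrak S_{n+1}^{(N)}\to[0,\infty)$ such that for all $N$ and all indices $n$ for which the expressions make sense: (a) $\pi^{(N)}_{n,n+1}(x,dy)=p_n^{(N)}(x,y)\mu_{n+1}^{(N)}(dy)$;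 (b) $0\le p_n^{(N)}\le 1/\epsilon_0$; (c) $\int p_n^{(N)}(x,y)p_{n+1}^{(N)}(y,z)\mu^{(N)}_{n+1}(dy)>\epsilon_0$ for all $x\in\mathfrak S_n^{(N)}$, $z\in\mathfrak S_{n+2}^{(N)}$. Additive functional. An array $\mathsf f=\{f_n^{(N)}:1\le n\le k_N\}$ of measurable functions $f_n^{(N)}:\mathfrak S^{(N)}_n\times\mathfrak S^{(N)}_{n+1}\to\mathbb R$; $S_N=\sum_{n=1}^{k_N}f_n^{(N)}(X_n^{(N)},X_{n+1}^{(N)})$. It is a.s. uniformly bounded if there is $K$ with $|f_n^{(N)}(X_n^{(N)},X_{n+1}^{(N)})|\le K$ a.s. for all $n,N$. Addition is entrywise. Center-tightness. $\mathsf f$ is center-tight if there are constants $m_N$ such that for every $\epsilon>0$ there is $M$ with $\mathbb P[|S_N-m_N|>M]<\epsilon$ for all $N$. Gradients. A potential is an array $\mathsf a=\{a_n^{(N)}:1\le n\le k_N+1\}$ of measurable functions $a_n^{(N)}:\mathfrak S_n^{(N)}\to\mathbb R$; its gradient $\nabla\mathsf a$ is the additive functional with entries $(x,y)\mapsto a_{n+1}^{(N)}(y)-a_n^{(N)}(x)$. Summable variance. $\mathsf h$ has summable variance if it is a.s. uniformly bounded and $\sup_N\sum_{n=1}^{k_N}\mathrm{Var}[h_n^{(N)}(X_n^{(N)},X_{n+1}^{(N)})]<\infty$. *)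

theory Defs
  imports "HOL-Probability.Probability"
begin

text \<open>
  The state spaces of all rows are subsets of one type \<open>'a\<close>. As \<open>'a\<close> is arbitrary and the metric
  of every state space is its own, this loses no generality: take for \<open>'a\<close> the disjoint union of
  the given spaces. Values of the fields at indices outside a row (for example \<open>state X N n\<close>
  with \<open>n = 0\<close> or \<open>n > len X N + 1\<close>) are irrelevant and never constrained.
\<close>

record 'a array_data =
  len :: "nat \<Rightarrow> nat"
  state :: "nat \<Rightarrow> nat \<Rightarrow> 'a metric"
  kernel :: "nat \<Rightarrow> nat \<Rightarrow> 'a \<Rightarrow> 'a measure"
  init :: "nat \<Rightarrow> 'a measure"

text \<open>\<open>len X N\<close> is $k_N$, so row \<open>N\<close> has \<open>len X N + 1\<close> states;
  \<open>kernel X N n\<close> goes from the \<open>n\<close>-th to the \<open>Suc n\<close>-th state space of row \<open>N\<close>.\<close>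

definition borel_of_metric :: "'a metric \<Rightarrow> 'a measure" where
  "borel_of_metric m = sigma (mspace m) {U. openin (mtopology_of m) U}"

abbreviation points :: "'a array_data \<Rightarrow> nat \<Rightarrow> nat \<Rightarrow> 'a set" where
  "points X N n \<equiv> mspace (state X N n)"

abbreviation borel_state :: "'a array_data \<Rightarrow> nat \<Rightarrow> nat \<Rightarrow> 'a measure" where
  "borel_state X N n \<equiv> borel_of_metric (state X N n)"

definition markov_array :: "'a array_data \<Rightarrow> bool" where
  "markov_array X \<longleftrightarrow>
     strict_mono (len X) \<and>
     (\<forall>N. 1 \<le> len X N) \<and>
     (\<forall>N. \<forall>n\<in>{1..len X N + 1}.
        mcomplete_of (state X N n) \<and>
        separable_space (mtopology_of (state X N n)) \<and>
        (\<exists>x\<in>points X N n. \<exists>y\<in>points X N n. x \<noteq> y)) \<and>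
     (\<forall>N. \<forall>n\<in>{1..len X N}.
        kernel X N n \<in> measurable (borel_state X N n) (prob_algebra (borel_state X N (n + 1))) \<and>
        (\<forall>x\<in>points X N n. \<not> (\<exists>y\<in>points X N (n + 1). emeasure (kernel X N n x) {y} = 1))) \<and>
     (\<forall>N. init X N \<in> space (prob_algebra (borel_state X N 1)))"

text \<open>\<open>path_law X N n\<close> is the joint law of the first \<open>n + 1\<close> states of row \<open>N\<close>, on the
  product space with coordinates \<open>1, \<dots>, n + 1\<close>. On it the chain is the coordinate process, i.e.
  the \<open>n\<close>-th state is \<open>\<lambda>\<omega>. \<omega> n\<close>.\<close>

primrec path_law :: "'a array_data \<Rightarrow> nat \<Rightarrow> nat \<Rightarrow> (nat \<Rightarrow> 'a) measure" where
  "path_law X N 0 =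
     distr (init X N) (PiM {1..1} (borel_state X N)) (\<lambda>x. \<lambda>i\<in>{1..1}. x)"
| "path_law X N (Suc n) =
     path_law X N n \<bind> (\<lambda>\<omega>.
       distr (kernel X N (n + 1) (\<omega> (n + 1))) (PiM {1..n + 2} (borel_state X N))
         (\<lambda>y. fun_upd \<omega> (n + 2) y))"

definition row_law :: "'a array_data \<Rightarrow> nat \<Rightarrow> (nat \<Rightarrow> 'a) measure" where
  "row_law X N = path_law X N (len X N)"

definition uniformly_elliptic :: "'a array_data \<Rightarrow> bool" where
  "uniformly_elliptic X \<longleftrightarrow>
     (\<exists>(\<epsilon>\<^sub>0::real) (\<mu> :: nat \<Rightarrow> nat \<Rightarrow> 'a measure) (p :: nat \<Rightarrow> nat \<Rightarrow> 'a \<Rightarrow> 'a \<Rightarrow> real).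
        0 < \<epsilon>\<^sub>0 \<and> \<epsilon>\<^sub>0 < 1 \<and>
        (\<forall>N. \<forall>n\<in>{1..len X N + 1}. \<mu> N n \<in> space (prob_algebra (borel_state X N n))) \<and>
        (\<forall>N. \<forall>n\<in>{1..len X N}.
           case_prod (p N n) \<in> borel_measurable (borel_state X N n \<Otimes>\<^sub>M borel_state X N (n + 1)) \<and>
           (\<forall>x\<in>points X N n.
              kernel X N n x = density (\<mu> N (n + 1)) (\<lambda>y. ennreal (p N n x y))) \<and>
           (\<forall>x\<in>points X N n. \<forall>y\<in>points X N (n + 1). 0 \<le> p N n x y \<and> p N n x y \<le> 1 / \<epsilon>\<^sub>0)) \<and>
        (\<forall>N. \<forall>n. 1 \<le> n \<and> n + 1 \<le> len X N \<longrightarrow>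
           (\<forall>x\<in>points X N n. \<forall>z\<in>points X N (n + 2).
              (\<integral>y. p N n x y * p N (n + 1) y z \<partial>\<mu> N (n + 1)) > \<epsilon>\<^sub>0)))"

type_synonym 'a functional = "nat \<Rightarrow> nat \<Rightarrow> 'a \<Rightarrow> 'a \<Rightarrow> real"
type_synonym 'a potential = "nat \<Rightarrow> nat \<Rightarrow> 'a \<Rightarrow> real"

definition additive_functional :: "'a array_data \<Rightarrow> 'a functional \<Rightarrow> bool" where
  "additive_functional X f \<longleftrightarrow>
     (\<forall>N. \<forall>n\<in>{1..len X N}.
        case_prod (f N n) \<in> borel_measurable (borel_state X N n \<Otimes>\<^sub>M borel_state X N (n + 1)))"

definition row_sum :: "'a array_data \<Rightarrow> 'a functional \<Rightarrow> nat \<Rightarrow> (nat \<Rightarrow> 'a) \<Rightarrow> real" where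
  "row_sum X f N \<omega> = (\<Sum>n = 1..len X N. f N n (\<omega> n) (\<omega> (n + 1)))"

definition as_uniformly_bounded :: "'a array_data \<Rightarrow> 'a functional \<Rightarrow> bool" where
  "as_uniformly_bounded X f \<longleftrightarrow>
     (\<exists>K. \<forall>N. \<forall>n\<in>{1..len X N}. AE \<omega> in row_law X N. \<bar>f N n (\<omega> n) (\<omega> (n + 1))\<bar> \<le> K)"

definition center_tight :: "'a array_data \<Rightarrow> 'a functional \<Rightarrow> bool" where
  "center_tight X f \<longleftrightarrow>
     (\<exists>m :: nat \<Rightarrow> real. \<forall>\<epsilon>>0. \<exists>M :: real. \<forall>N.
        \<P>(\<omega> in row_law X N. \<bar>row_sum X f N \<omega> - m N\<bar> > M) < \<epsilon>)"

definition potential :: "'a array_data \<Rightarrow> 'a potential \<Rightarrow> bool" where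
  "potential X a \<longleftrightarrow>
     (\<forall>N. \<forall>n\<in>{1..len X N + 1}. a N n \<in> borel_measurable (borel_state X N n))"

definition uniformly_bounded :: "'a array_data \<Rightarrow> 'a potential \<Rightarrow> bool" where
  "uniformly_bounded X a \<longleftrightarrow>
     (\<exists>K. \<forall>N. \<forall>n\<in>{1..len X N + 1}. \<forall>x\<in>points X N n. \<bar>a N n x\<bar> \<le> K)"

definition gradient :: "'a potential \<Rightarrow> 'a functional" where
  "gradient a N n x y = a N (n + 1) y - a N n x"

definition summable_variance :: "'a array_data \<Rightarrow> 'a functional \<Rightarrow> bool" where
  "summable_variance X h \<longleftrightarrow>
     as_uniformly_bounded X h \<and>
     bdd_above (range (\<lambda>N. \<Sum>n = 1..len X N.
       prob_space.variance (row_law X N) (\<lambda>\<omega>. h N n (\<omega> n) (\<omega> (n + 1)))))"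

definition functional_eq :: "'a array_data \<Rightarrow> 'a functional \<Rightarrow> 'a functional \<Rightarrow> bool" where
  "functional_eq X f g \<longleftrightarrow>
     (\<forall>N. \<forall>n\<in>{1..len X N}. \<forall>x\<in>points X N n. \<forall>y\<in>points X N (n + 1). f N n x y = g N n x y)"

end

theory Submission
  imports Defs
begin

text \<open>
  Let \<open>b n x\<close> be the conditional expectation of the remaining sum \<open>f n + \<dots> + f k\<close> given
  \<open>X n = x\<close>. By ellipticity the two-step transition operator contracts oscillations by
  \<open>1 - \<epsilon>\<close>, so \<open>b n\<close> is bounded up to an additive constant, and \<open>f n + b (n+1) - b n\<close> is a
  sequence of bounded martingale differences \<open>D n\<close>. Hence \<open>f\<close> is always the gradient of a bounded
  potential plus \<open>D\<close> plus constants, and only \<open>V\<close>, the sum of the variances of \<open>D n\<close>, has to be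
  controlled.

  If the row sums are center-tight, so is the martingale \<open>M\<close> with differences \<open>D n\<close>. Ellipticity
  bounds the conditional variance of \<open>D n\<close> given the first \<open>n - 1\<close> states by a multiple of the
  variance of \<open>D n\<close>, which gives \<open>E M\<^sup>4 \<le> C (V\<^sup>2 + V)\<close>; by the Paley--Zygmund inequality
  tightness then bounds \<open>V\<close>. Conversely, for summable variance the same decomposition and the
  \<open>L\<^sup>2\<close> contraction of the two-step operator on mean-zero functions bound the variance of the sum
  by the sum of the variances.
\<close>

text \<open>Ellipticity gives no lower bound for a single transition: only two consecutive steps
  dominate \<epsilon> times a reference measure. Hence contraction runs in steps of two, and a
  factor known at some time decouples only from the square of a later increment, not from that of
  the next one. The first states are exceptional: the reference measure is compared with the law of
  the chain from below only from the third state on.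

  Tightness carries no moment information and is centered at arbitrary numbers. The comparison of
  moments is therefore made for \<open>M - c\<close> with arbitrary \<open>c\<close>, where the mean
  square is \<open>V + c^2\<close> by orthogonality. If \<open>V < 1\<close> there is nothing to
  prove; otherwise the linear term of the fourth-moment bound is absorbed into \<open>V^2\<close>.

  All estimates concern one row, and their constants depend on \<epsilon> and on the bound
  \<open>K\<close> of the functional, not on the row length; uniformity over the rows then comes
  from having one \<epsilon> and one \<open>K\<close> for the whole array.\<close>

section \<open>Bounded measurable functions\<close>

text \<open>The bound is required at every point, not almost everywhere, because one function is
  integrated against all the kernels \<open>\<kappa> n x\<close>, which need not have common null
  sets.\<close>

definition bounded_measurable :: "'b measure \<Rightarrow> ('b \<Rightarrow> real) \<Rightarrow> bool" where
  "bounded_measurable N u \<longleftrightarrow> u \<in> borel_measurable N \<and> (\<exists>B. \<forall>x\<in>space N. \<bar>u x\<bar> \<le> B)"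

lemma bounded_measurableI:
  "u \<in> borel_measurable N \<Longrightarrow> (\<And>x. x \<in> space N \<Longrightarrow> \<bar>u x\<bar> \<le> B) \<Longrightarrow> bounded_measurable N u"
  unfolding bounded_measurable_def by blast

lemma bounded_measurableD: "bounded_measurable N u \<Longrightarrow> u \<in> borel_measurable N"
  unfolding bounded_measurable_def by blast

lemma bounded_measurableE:
  assumes "bounded_measurable N u"
  obtains B where "0 \<le> B" "\<And>x. x \<in> space N \<Longrightarrow> \<bar>u x\<bar> \<le> B"
proof -
  from assms obtain B where B: "\<And>x. x \<in> space N \<Longrightarrow> \<bar>u x\<bar> \<le> B"
    unfolding bounded_measurable_def by blast
  show ?thesis
    by (rule that[of "\<bar>B\<bar>"]) (auto dest: B)
qed

lemma bounded_measurable_const: "bounded_measurable N (\<lambda>_. c)"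
  by (rule bounded_measurableI[where B = "\<bar>c\<bar>"]) auto

lemma bounded_measurable_add:
  assumes "bounded_measurable N u" "bounded_measurable N v"
  shows "bounded_measurable N (\<lambda>x. u x + v x)"
proof -
  obtain A B where AB: "\<And>x. x \<in> space N \<Longrightarrow> \<bar>u x\<bar> \<le> A" "\<And>x. x \<in> space N \<Longrightarrow> \<bar>v x\<bar> \<le> B"
    using assms by (metis bounded_measurableE)
  show ?thesis
  proof (rule bounded_measurableI)
    show "(\<lambda>x. u x + v x) \<in> borel_measurable N"
      using assms[THEN bounded_measurableD] by simp
    show "\<bar>u x + v x\<bar> \<le> A + B" if "x \<in> space N" for x
      using AB[OF that] by linarith
  qed
qed

lemma bounded_measurable_mult:
  assumes "bounded_measurable N u" "bounded_measurable N v"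
  shows "bounded_measurable N (\<lambda>x. u x * v x)"
proof -
  obtain A where A: "0 \<le> A" "\<And>x. x \<in> space N \<Longrightarrow> \<bar>u x\<bar> \<le> A"
    using assms(1) by (metis bounded_measurableE)
  obtain B where B: "0 \<le> B" "\<And>x. x \<in> space N \<Longrightarrow> \<bar>v x\<bar> \<le> B"
    using assms(2) by (metis bounded_measurableE)
  show ?thesis
  proof (rule bounded_measurableI)
    show "(\<lambda>x. u x * v x) \<in> borel_measurable N"
      using assms[THEN bounded_measurableD] by simp
    show "\<bar>u x * v x\<bar> \<le> A * B" if "x \<in> space N" for x
      unfolding abs_mult using A B that by (intro mult_mono) auto
  qed
qed

lemma bounded_measurable_diff:
  assumes "bounded_measurable N u" "bounded_measurable N v"
  shows "bounded_measurable N (\<lambda>x. u x - v x)"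
  using bounded_measurable_add[OF assms(1)
      bounded_measurable_mult[OF bounded_measurable_const[of N "-1"] assms(2)]] by simp

lemma bounded_measurable_power:
  assumes "bounded_measurable N u"
  shows "bounded_measurable N (\<lambda>x. u x ^ m)"
  by (induction m) (auto intro: bounded_measurable_const bounded_measurable_mult assms)

lemma bounded_measurable_sum:
  assumes "\<And>i. i \<in> I \<Longrightarrow> bounded_measurable N (u i)"
  shows "bounded_measurable N (\<lambda>x. \<Sum>i\<in>I. u i x)"
  using assms
  by (induction I rule: infinite_finite_induct)
    (auto intro: bounded_measurable_const bounded_measurable_add)

lemma bounded_measurable_compose:
  assumes "g \<in> N' \<rightarrow>\<^sub>M N" "bounded_measurable N u"
  shows "bounded_measurable N' (\<lambda>x. u (g x))"
proof -
  obtain B where "\<And>x. x \<in> space N \<Longrightarrow> \<bar>u x\<bar> \<le> B"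
    using assms(2) by (metis bounded_measurableE)
  then show ?thesis
    using assms measurable_space[OF assms(1)]
    by (intro bounded_measurableI[where B = B]) (auto dest: bounded_measurableD)
qed

lemma bounded_measurable_indicator:
  "A \<in> sets N \<Longrightarrow> bounded_measurable N (indicator A)"
  by (rule bounded_measurableI[where B = 1]) (auto simp: indicator_def)

lemmas bounded_measurable_intros =
  bounded_measurable_const bounded_measurable_add bounded_measurable_mult
  bounded_measurable_diff bounded_measurable_power bounded_measurable_sum

text \<open>Pushing \<open>Q x\<close> forward along \<open>Pair x\<close> gives a measurable family
  of measures on the product, so the parametrised integral becomes the integral of the single
  function \<open>u\<close> against that family.\<close>

lemma integral_measurable_kernel:
  fixes u :: "'b \<times> 'c \<Rightarrow> real"
  assumes u: "u \<in> borel_measurable (M \<Otimes>\<^sub>M N)" and Q: "Q \<in> M \<rightarrow>\<^sub>M subprob_algebra N"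
  shows "(\<lambda>x. \<integral>y. u (x, y) \<partial>Q x) \<in> borel_measurable M"
proof -
  have "(\<lambda>x. distr (Q x) (M \<Otimes>\<^sub>M N) (Pair x)) \<in> M \<rightarrow>\<^sub>M subprob_algebra (M \<Otimes>\<^sub>M N)"
    by (rule measurable_distr2[OF _ Q]) simp
  then have "(\<lambda>x. integral\<^sup>L (distr (Q x) (M \<Otimes>\<^sub>M N) (Pair x)) u) \<in> borel_measurable M"
    by (rule measurable_compose[OF _ integral_measurable_subprob_algebra[OF u]])
  moreover have "integral\<^sup>L (distr (Q x) (M \<Otimes>\<^sub>M N) (Pair x)) u = (\<integral>y. u (x, y) \<partial>Q x)"
    if "x \<in> space M" for x
    using sets_kernel[OF Q that] that
    by (intro integral_distr u) (simp cong: measurable_cong_sets)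
  ultimately show ?thesis
    by (simp cong: measurable_cong)
qed

lemma (in finite_measure) bounded_measurable_integrable:
  assumes "bounded_measurable M u"
  shows "integrable M u"
proof -
  obtain B where "\<And>x. x \<in> space M \<Longrightarrow> \<bar>u x\<bar> \<le> B"
    using assms by (metis bounded_measurableE)
  then show ?thesis
    by (intro integrable_const_bound[where B = B] AE_I2) (auto intro: bounded_measurableD assms)
qed

lemma (in prob_space) bounded_measurable_integral_bounds:
  assumes "bounded_measurable M u" "\<And>x. x \<in> space M \<Longrightarrow> l \<le> u x \<and> u x \<le> (c::real)"
  shows "l \<le> expectation u" "expectation u \<le> c"
  using assms
  by (auto intro!: integral_ge_const integral_le_const bounded_measurable_integrable AE_I2)

section \<open>Elliptic chains\<close>

text \<open>One row, reduced to what the estimates use. Densities no longer occur: ellipticity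
  survives as \<open>kernel_upper\<close> and \<open>kernel_lower\<close>, inequalities between
  integrals of nonnegative test functions. \<open>F n\<close> is the past up to time
  \<open>n\<close>, and \<open>markov_indicator\<close> is the defining relation of a conditional
  expectation given \<open>F n\<close>.\<close>

locale elliptic_chain = prob_space L for L :: "'w measure" +
  fixes k :: nat and F :: "nat \<Rightarrow> 'w measure" and S :: "nat \<Rightarrow> 'a measure"
    and X :: "nat \<Rightarrow> 'w \<Rightarrow> 'a" and \<kappa> :: "nat \<Rightarrow> 'a \<Rightarrow> 'a measure"
    and \<mu> :: "nat \<Rightarrow> 'a measure" and \<epsilon> :: real
  assumes k_pos: "1 \<le> k"
    and filtration: "n \<in> {1..k+1} \<Longrightarrow> subalgebra L (F n)"
    and adapted: "1 \<le> j \<Longrightarrow> j \<le> n \<Longrightarrow> n \<le> k + 1 \<Longrightarrow> X j \<in> F n \<rightarrow>\<^sub>M S j"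
    and kernel_measurable: "n \<in> {1..k} \<Longrightarrow> \<kappa> n \<in> S n \<rightarrow>\<^sub>M prob_algebra (S (Suc n))"
    and markov_indicator:
      "n \<in> {1..k} \<Longrightarrow> A \<in> sets (F n) \<Longrightarrow> bounded_measurable (S n \<Otimes>\<^sub>M S (Suc n)) \<phi> \<Longrightarrow>
        (\<integral>\<omega>. indicator A \<omega> * \<phi> (X n \<omega>, X (Suc n) \<omega>) \<partial>L)
          = (\<integral>\<omega>. indicator A \<omega> * (\<integral>y. \<phi> (X n \<omega>, y) \<partial>\<kappa> n (X n \<omega>)) \<partial>L)"
    and eps: "0 < \<epsilon>" "\<epsilon> < 1"
    and reference: "n \<in> {1..k+1} \<Longrightarrow> \<mu> n \<in> space (prob_algebra (S n))"
    and kernel_upper: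
      "n \<in> {1..k} \<Longrightarrow> bounded_measurable (S (Suc n)) u \<Longrightarrow> (\<And>y. y \<in> space (S (Suc n)) \<Longrightarrow> 0 \<le> u y) \<Longrightarrow>
        x \<in> space (S n) \<Longrightarrow> (\<integral>y. u y \<partial>\<kappa> n x) \<le> (\<integral>y. u y \<partial>\<mu> (Suc n)) / \<epsilon>"
    and kernel_lower:
      "n \<in> {1..<k} \<Longrightarrow> bounded_measurable (S (Suc (Suc n))) u \<Longrightarrow>
        (\<And>z. z \<in> space (S (Suc (Suc n))) \<Longrightarrow> 0 \<le> u z) \<Longrightarrow> x \<in> space (S n) \<Longrightarrow>
        \<epsilon> * (\<integral>z. u z \<partial>\<mu> (Suc (Suc n))) \<le> (\<integral>y. (\<integral>z. u z \<partial>\<kappa> (Suc n) y) \<partial>\<kappa> n x)"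
begin

abbreviation step :: "nat \<Rightarrow> 'w \<Rightarrow> 'a \<times> 'a" where
  "step n \<omega> \<equiv> (X n \<omega>, X (Suc n) \<omega>)"

text \<open>The conditional expectation of \<open>\<phi> (step n \<omega>)\<close> given
  \<open>X n \<omega> = x\<close>, as a genuine function of the state and not a class modulo null
  sets, so that suprema and oscillations make sense.\<close>

definition cexp :: "nat \<Rightarrow> ('a \<times> 'a \<Rightarrow> real) \<Rightarrow> 'a \<Rightarrow> real" where
  "cexp n \<phi> x = (\<integral>y. \<phi> (x, y) \<partial>\<kappa> n x)"

abbreviation bm1 :: "nat \<Rightarrow> ('a \<Rightarrow> real) \<Rightarrow> bool" where
  "bm1 n \<equiv> bounded_measurable (S n)"

abbreviation bm2 :: "nat \<Rightarrow> ('a \<times> 'a \<Rightarrow> real) \<Rightarrow> bool" where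
  "bm2 n \<equiv> bounded_measurable (S n \<Otimes>\<^sub>M S (Suc n))"

lemma bm2_fst: "bm1 n u \<Longrightarrow> bm2 n (\<lambda>z. u (fst z))"
  by (rule bounded_measurable_compose[where N = "S n"]) auto

lemma bm2_snd: "bm1 (Suc n) u \<Longrightarrow> bm2 n (\<lambda>z. u (snd z))"
  by (rule bounded_measurable_compose[where N = "S (Suc n)"]) auto

lemma X_measurable: "n \<in> {1..k+1} \<Longrightarrow> X n \<in> L \<rightarrow>\<^sub>M S n"
  using adapted[of n n] measurable_from_subalg[OF filtration] by auto

lemma X_space: "n \<in> {1..k+1} \<Longrightarrow> \<omega> \<in> space L \<Longrightarrow> X n \<omega> \<in> space (S n)"
  using X_measurable measurable_space by metis

lemma S_not_empty: "n \<in> {1..k+1} \<Longrightarrow> space (S n) \<noteq> {}"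
  using X_space not_empty by blast

lemma step_adapted: "1 \<le> j \<Longrightarrow> j < n \<Longrightarrow> n \<le> k + 1 \<Longrightarrow> step j \<in> F n \<rightarrow>\<^sub>M S j \<Otimes>\<^sub>M S (Suc j)"
  by (intro measurable_Pair adapted) auto

lemma bm_F: "n \<in> {1..k+1} \<Longrightarrow> bounded_measurable (F n) G \<Longrightarrow> bounded_measurable L G"
  using filtration[of n] measurable_from_subalg[of L "F n"]
  unfolding bounded_measurable_def subalgebra_def by metis

lemma bm_X: "n \<in> {1..k+1} \<Longrightarrow> bm1 n u \<Longrightarrow> bounded_measurable L (\<lambda>\<omega>. u (X n \<omega>))"
  by (rule bounded_measurable_compose[OF X_measurable])

lemma bm_step: "n \<in> {1..k} \<Longrightarrow> bm2 n \<phi> \<Longrightarrow> bounded_measurable L (\<lambda>\<omega>. \<phi> (step n \<omega>))"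
  by (rule bounded_measurable_compose[where N = "S n \<Otimes>\<^sub>M S (Suc n)"])
    (auto intro!: measurable_Pair X_measurable)

lemma bm_F_X: "n \<in> {1..k+1} \<Longrightarrow> bm1 n u \<Longrightarrow> bounded_measurable (F n) (\<lambda>\<omega>. u (X n \<omega>))"
  by (rule bounded_measurable_compose[OF adapted]) auto

lemma bm_F_step:
  "1 \<le> j \<Longrightarrow> j < n \<Longrightarrow> n \<le> k + 1 \<Longrightarrow> bm2 j \<phi> \<Longrightarrow> bounded_measurable (F n) (\<lambda>\<omega>. \<phi> (step j \<omega>))"
  by (rule bounded_measurable_compose[OF step_adapted])

lemma kernel_prob:
  assumes "n \<in> {1..k}" "x \<in> space (S n)"
  shows "prob_space (\<kappa> n x)" "sets (\<kappa> n x) = sets (S (Suc n))" "space (\<kappa> n x) = space (S (Suc n))"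
  using measurable_space[OF kernel_measurable[OF assms(1)] assms(2)]
  by (auto simp: space_prob_algebra dest: sets_eq_imp_space_eq)

lemma section_bounded_measurable:
  assumes n: "n \<in> {1..k}" and \<phi>: "bm2 n \<phi>" and x: "x \<in> space (S n)"
  shows "bounded_measurable (\<kappa> n x) (\<lambda>y. \<phi> (x, y))"
proof (rule bounded_measurable_compose[OF _ \<phi>])
  show "Pair x \<in> \<kappa> n x \<rightarrow>\<^sub>M S n \<Otimes>\<^sub>M S (Suc n)"
    using x measurable_cong_sets[OF kernel_prob(2)[OF n x] refl, of "S n \<Otimes>\<^sub>M S (Suc n)"] by simp
qed

lemma section_integrable:
  assumes n: "n \<in> {1..k}" and \<phi>: "bm2 n \<phi>" and x: "x \<in> space (S n)"
  shows "integrable (\<kappa> n x) (\<lambda>y. \<phi> (x, y))"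
proof -
  interpret K: prob_space "\<kappa> n x" by (rule kernel_prob[OF n x])
  show ?thesis by (rule K.bounded_measurable_integrable[OF section_bounded_measurable[OF assms]])
qed

lemma cexp_bounds:
  assumes n: "n \<in> {1..k}" and \<phi>: "bm2 n \<phi>" and x: "x \<in> space (S n)"
    and "\<And>y. y \<in> space (S (Suc n)) \<Longrightarrow> l \<le> \<phi> (x, y) \<and> \<phi> (x, y) \<le> c"
  shows "l \<le> cexp n \<phi> x" "cexp n \<phi> x \<le> c"
proof -
  interpret K: prob_space "\<kappa> n x" by (rule kernel_prob[OF n x])
  show "l \<le> cexp n \<phi> x" "cexp n \<phi> x \<le> c"
    unfolding cexp_def
    using K.bounded_measurable_integral_bounds[OF section_bounded_measurable[OF n \<phi> x], of l c]
      assms(4) kernel_prob(3)[OF n x] by auto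
qed

lemma cexp_add:
  assumes "n \<in> {1..k}" "bm2 n \<phi>" "bm2 n \<psi>" "x \<in> space (S n)"
  shows "cexp n (\<lambda>z. \<phi> z + \<psi> z) x = cexp n \<phi> x + cexp n \<psi> x"
  unfolding cexp_def using section_integrable assms by (intro Bochner_Integration.integral_add) auto

lemma cexp_diff:
  assumes "n \<in> {1..k}" "bm2 n \<phi>" "bm2 n \<psi>" "x \<in> space (S n)"
  shows "cexp n (\<lambda>z. \<phi> z - \<psi> z) x = cexp n \<phi> x - cexp n \<psi> x"
  unfolding cexp_def using section_integrable assms by (intro Bochner_Integration.integral_diff) auto

lemma cexp_fst:
  assumes "n \<in> {1..k}" "x \<in> space (S n)"
  shows "cexp n (\<lambda>z. u (fst z)) x = u x"
proof -
  interpret K: prob_space "\<kappa> n x" by (rule kernel_prob[OF assms])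
  show ?thesis unfolding cexp_def by (simp add: K.prob_space)
qed

lemma cexp_const:
  assumes "n \<in> {1..k}" "x \<in> space (S n)"
  shows "cexp n (\<lambda>_. c) x = c"
  using cexp_fst[OF assms, of "\<lambda>_. c"] .

lemma cexp_cmult: "cexp n (\<lambda>z. c * \<phi> z) x = c * cexp n \<phi> x"
  unfolding cexp_def by simp

lemma bm1_cexp:
  assumes n: "n \<in> {1..k}" and \<phi>: "bm2 n \<phi>"
  shows "bm1 n (cexp n \<phi>)"
proof -
  obtain B where B: "\<And>z. z \<in> space (S n \<Otimes>\<^sub>M S (Suc n)) \<Longrightarrow> \<bar>\<phi> z\<bar> \<le> B"
    using \<phi> by (metis bounded_measurableE)
  show ?thesis
  proof (rule bounded_measurableI[where B = B])
    show "cexp n \<phi> \<in> borel_measurable (S n)"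
      unfolding cexp_def
      using bounded_measurableD[OF \<phi>] measurable_prob_algebraD[OF kernel_measurable[OF n]]
      by (rule integral_measurable_kernel)
    show "\<bar>cexp n \<phi> x\<bar> \<le> B" if x: "x \<in> space (S n)" for x
    proof -
      have "- B \<le> \<phi> (x, y) \<and> \<phi> (x, y) \<le> B" if "y \<in> space (S (Suc n))" for y
        using B[of "(x, y)"] x that by (auto simp: space_pair_measure abs_le_iff)
      then show ?thesis
        using cexp_bounds[OF n \<phi> x, of "-B" B] by (auto simp: abs_le_iff)
    qed
  qed
qed

text \<open>By \<open>markov_indicator\<close>, \<open>cexp n \<phi> (X n \<omega>)\<close> is a
  version of the conditional expectation of \<open>\<phi> (step n \<omega>)\<close> given
  \<open>F n\<close>; a bounded factor known at time \<open>n\<close> can be pulled out of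
  it.\<close>

lemma markov:
  assumes n: "n \<in> {1..k}" and G: "bounded_measurable (F n) G" and \<phi>: "bm2 n \<phi>"
  shows "(\<integral>\<omega>. G \<omega> * \<phi> (step n \<omega>) \<partial>L) = (\<integral>\<omega>. G \<omega> * cexp n \<phi> (X n \<omega>) \<partial>L)"
proof -
  have n': "n \<in> {1..k+1}" using n by auto
  interpret C: finite_measure_subalgebra L "F n"
    using filtration[OF n'] by unfold_locales
  have b: "bounded_measurable L (\<lambda>\<omega>. \<phi> (step n \<omega>))" by (rule bm_step[OF n \<phi>])
  have p: "bounded_measurable (F n) (\<lambda>\<omega>. cexp n \<phi> (X n \<omega>))"
    by (rule bm_F_X[OF n' bm1_cexp[OF n \<phi>]])
  have G': "bounded_measurable L G" by (rule bm_F[OF n' G])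
  have ae: "AE \<omega> in L. real_cond_exp L (F n) (\<lambda>\<omega>. \<phi> (step n \<omega>)) \<omega> = cexp n \<phi> (X n \<omega>)"
  proof (rule C.real_cond_exp_charact)
    show "(\<integral>\<omega>\<in>A. \<phi> (step n \<omega>) \<partial>L) = (\<integral>\<omega>\<in>A. cexp n \<phi> (X n \<omega>) \<partial>L)" if "A \<in> sets (F n)" for A
      using markov_indicator[OF n that \<phi>] by (simp add: set_lebesgue_integral_def cexp_def)
  qed (auto intro: bounded_measurable_integrable b bm_F[OF n' p] bounded_measurableD[OF p])
  have "(\<integral>\<omega>. G \<omega> * \<phi> (step n \<omega>) \<partial>L)
      = (\<integral>\<omega>. G \<omega> * real_cond_exp L (F n) (\<lambda>\<omega>. \<phi> (step n \<omega>)) \<omega> \<partial>L)"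
    by (rule C.real_cond_exp_intg(2)[symmetric])
      (auto intro!: bounded_measurable_integrable bounded_measurable_mult G' b
        intro: bounded_measurableD[OF G] bounded_measurableD[OF b])
  also have "\<dots> = (\<integral>\<omega>. G \<omega> * cexp n \<phi> (X n \<omega>) \<partial>L)"
    using ae bounded_measurableD[OF G'] bounded_measurableD[OF bm_F[OF n' p]]
    by (intro integral_cong_AE) (auto intro: borel_measurable_cond_exp2)
  finally show ?thesis .
qed

lemma markov':
  assumes n: "n \<in> {1..k}" and \<phi>: "bm2 n \<phi>"
  shows "(\<integral>\<omega>. \<phi> (step n \<omega>) \<partial>L) = (\<integral>\<omega>. cexp n \<phi> (X n \<omega>) \<partial>L)"
  using markov[OF n bounded_measurable_const[of _ 1] \<phi>] by simp

abbreviation cexp1 :: "nat \<Rightarrow> ('a \<Rightarrow> real) \<Rightarrow> 'a \<Rightarrow> real" where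
  "cexp1 n u \<equiv> cexp n (\<lambda>z. u (snd z))"

abbreviation cexp2 :: "nat \<Rightarrow> ('a \<Rightarrow> real) \<Rightarrow> 'a \<Rightarrow> real" where
  "cexp2 n u \<equiv> cexp1 n (cexp1 (Suc n) u)"

lemma cexp_cong:
  assumes n: "n \<in> {1..k}" and x: "x \<in> space (S n)"
    and "\<And>y. y \<in> space (S (Suc n)) \<Longrightarrow> \<phi> (x, y) = \<psi> (x, y)"
  shows "cexp n \<phi> x = cexp n \<psi> x"
  unfolding cexp_def using assms(3) kernel_prob(3)[OF n x]
  by (intro Bochner_Integration.integral_cong) auto

section \<open>Comparison of transition kernels, reference measures and laws of the chain\<close>

lemma cexp2_lower:
  assumes "n \<in> {1..<k}" "bm1 (Suc (Suc n)) u" "\<And>z. z \<in> space (S (Suc (Suc n))) \<Longrightarrow> 0 \<le> u z"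
    "x \<in> space (S n)"
  shows "\<epsilon> * (\<integral>z. u z \<partial>\<mu> (Suc (Suc n))) \<le> cexp2 n u x"
  using kernel_lower[OF assms] unfolding cexp_def by simp

lemma cexp1_upper:
  assumes "n \<in> {1..k}" "bm1 (Suc n) u" "\<And>y. y \<in> space (S (Suc n)) \<Longrightarrow> 0 \<le> u y"
    "x \<in> space (S n)"
  shows "cexp1 n u x \<le> (\<integral>y. u y \<partial>\<mu> (Suc n)) / \<epsilon>"
  using kernel_upper[OF assms] unfolding cexp_def by simp

lemma bm1_cexp1: "n \<in> {1..k} \<Longrightarrow> bm1 (Suc n) u \<Longrightarrow> bm1 n (cexp1 n u)"
  by (intro bm1_cexp bm2_snd)

lemma cexp1_diff:
  assumes "n \<in> {1..k}" "bm1 (Suc n) u" "bm1 (Suc n) v" "x \<in> space (S n)"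
  shows "cexp1 n (\<lambda>y. u y - v y) x = cexp1 n u x - cexp1 n v x"
  by (rule cexp_diff[OF assms(1) bm2_snd bm2_snd]) (use assms in auto)

lemma cexp1_add:
  assumes "n \<in> {1..k}" "bm1 (Suc n) u" "bm1 (Suc n) v" "x \<in> space (S n)"
  shows "cexp1 n (\<lambda>y. u y + v y) x = cexp1 n u x + cexp1 n v x"
  by (rule cexp_add[OF assms(1) bm2_snd bm2_snd]) (use assms in auto)

lemma cexp2_diff:
  assumes n: "n \<in> {1..<k}" and u: "bm1 (Suc (Suc n)) u" and v: "bm1 (Suc (Suc n)) v"
    and x: "x \<in> space (S n)"
  shows "cexp2 n (\<lambda>y. u y - v y) x = cexp2 n u x - cexp2 n v x"
proof -
  have n1: "n \<in> {1..k}" and n2: "Suc n \<in> {1..k}" using n by auto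
  have "cexp2 n (\<lambda>y. u y - v y) x = cexp1 n (\<lambda>y. cexp1 (Suc n) u y - cexp1 (Suc n) v y) x"
    by (rule cexp_cong[OF n1 x]) (simp add: cexp1_diff[OF n2 u v])
  also have "\<dots> = cexp2 n u x - cexp2 n v x"
    by (intro cexp1_diff n1 bm1_cexp1 n2 u v x)
  finally show ?thesis .
qed

lemma cexp2_const:
  assumes n: "n \<in> {1..<k}" and x: "x \<in> space (S n)"
  shows "cexp2 n (\<lambda>_. c) x = c"
proof -
  have n1: "n \<in> {1..k}" and n2: "Suc n \<in> {1..k}" using n by auto
  have "cexp2 n (\<lambda>_. c) x = cexp n (\<lambda>_. c) x"
    by (rule cexp_cong[OF n1 x]) (simp add: cexp_const[OF n2])
  then show ?thesis by (simp add: cexp_const[OF n1 x])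
qed

lemma reference_prob:
  assumes "n \<in> {1..k+1}"
  shows "prob_space (\<mu> n)" "sets (\<mu> n) = sets (S n)" "space (\<mu> n) = space (S n)"
  using reference[OF assms] by (auto simp: space_prob_algebra dest: sets_eq_imp_space_eq)

lemma bm_reference: "n \<in> {1..k+1} \<Longrightarrow> bounded_measurable (\<mu> n) u \<longleftrightarrow> bm1 n u"
  using reference_prob[of n] measurable_cong_sets[of "\<mu> n" "S n" borel borel]
  unfolding bounded_measurable_def by auto

lemma reference_integrable: "n \<in> {1..k+1} \<Longrightarrow> bm1 n u \<Longrightarrow> integrable (\<mu> n) u"
  using finite_measure.bounded_measurable_integrable[of "\<mu> n" u] reference_prob[of n] bm_reference[of n u]
    prob_space.finite_measure by blast

text \<open>Doeblin's argument: \<open>u - inf u\<close> and \<open>inf u + D - u\<close> are both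
  nonnegative, so the minorisation by \<epsilon> times the reference measure applies to the one at
  \<open>x'\<close> and to the other at \<open>x\<close>. The part of mass \<epsilon> common to both
  two-step laws cancels.\<close>

lemma cexp2_oscillation:
  assumes n: "n \<in> {1..<k}" and u: "bm1 (Suc (Suc n)) u"
    and osc: "\<And>z z'. z \<in> space (S (Suc (Suc n))) \<Longrightarrow> z' \<in> space (S (Suc (Suc n))) \<Longrightarrow> u z - u z' \<le> D"
    and x: "x \<in> space (S n)" and x': "x' \<in> space (S n)"
  shows "cexp2 n u x - cexp2 n u x' \<le> (1 - \<epsilon>) * D"
proof -
  let ?m = "Suc (Suc n)"
  have m: "?m \<in> {1..k+1}" using n by auto
  obtain z0 where z0: "z0 \<in> space (S ?m)" using S_not_empty[OF m] by blast
  define l where "l = (INF z\<in>space (S ?m). u z)"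
  obtain B where B: "\<And>z. z \<in> space (S ?m) \<Longrightarrow> \<bar>u z\<bar> \<le> B" using u by (metis bounded_measurableE)
  have bdd: "bdd_below (u ` space (S ?m))"
    by (rule bdd_belowI2[where m = "-B"]) (use B in \<open>auto simp: abs_le_iff\<close>, force)
  have lo: "l \<le> u z" if "z \<in> space (S ?m)" for z
    unfolding l_def by (rule cINF_lower[OF bdd that])
  have hi: "u z \<le> l + D" if "z \<in> space (S ?m)" for z
  proof -
    have "u z - D \<le> l" unfolding l_def
      by (rule cINF_greatest) (use S_not_empty[OF m] osc[OF that] in \<open>auto simp: algebra_simps\<close>)
    then show ?thesis by simp
  qed
  have bl: "bm1 ?m (\<lambda>z. u z - l)" and bh: "bm1 ?m (\<lambda>z. (l + D) - u z)"
    by (intro bounded_measurable_intros u)+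
  interpret R: prob_space "\<mu> ?m" by (rule reference_prob[OF m])
  have iu: "integrable (\<mu> ?m) u" by (rule reference_integrable[OF m u])
  have 1: "\<epsilon> * (\<integral>z. u z - l \<partial>\<mu> ?m) \<le> cexp2 n (\<lambda>z. u z - l) x'"
    by (rule cexp2_lower[OF n bl _ x']) (use lo in auto)
  have 2: "\<epsilon> * (\<integral>z. (l + D) - u z \<partial>\<mu> ?m) \<le> cexp2 n (\<lambda>z. (l + D) - u z) x"
    by (rule cexp2_lower[OF n bh _ x]) (use hi in auto)
  have 3: "cexp2 n (\<lambda>z. u z - l) x' = cexp2 n u x' - l"
    by (subst cexp2_diff[OF n u bounded_measurable_const x'], subst cexp2_const[OF n x']) simp
  have 4: "cexp2 n (\<lambda>z. (l + D) - u z) x = l + D - cexp2 n u x"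
    by (subst cexp2_diff[OF n bounded_measurable_const u x], subst cexp2_const[OF n x]) simp
  \<comment> \<open>The two integrals add up to \<open>D\<close> whatever \<open>u\<close> is, so
    the two lower bounds together give exactly \<open>\<epsilon> * D\<close>.\<close>
  have "(\<integral>z. u z - l \<partial>\<mu> ?m) + (\<integral>z. (l + D) - u z \<partial>\<mu> ?m) = D"
    using iu by (simp add: R.prob_space)
  then have "\<epsilon> * D = \<epsilon> * (\<integral>z. u z - l \<partial>\<mu> ?m) + \<epsilon> * (\<integral>z. (l + D) - u z \<partial>\<mu> ?m)"
    by (metis distrib_left)
  then show ?thesis using 1 2 3 4 by (simp add: algebra_simps)
qed

text \<open>The two-step lower bound is averaged over the law of \<open>X (n - 2)\<close>; this
  needs two predecessors, hence \<open>n \<in> {3..k+1}\<close>.\<close>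

lemma reference_le_expectation:
  assumes n: "n \<in> {3..k+1}" and u: "bm1 n u" and nn: "\<And>z. z \<in> space (S n) \<Longrightarrow> 0 \<le> u z"
  shows "\<epsilon> * (\<integral>z. u z \<partial>\<mu> n) \<le> (\<integral>\<omega>. u (X n \<omega>) \<partial>L)"
proof -
  obtain m where m: "n = Suc (Suc m)" "m \<in> {1..<k}"
    using n by (intro that[of "n - 2"]) auto
  have m1: "m \<in> {1..k}" "Suc m \<in> {1..k}" "m \<in> {1..k+1}" using m by auto
  have u': "bm1 (Suc (Suc m)) u" using u m by simp
  have "(\<integral>\<omega>. u (X n \<omega>) \<partial>L) = (\<integral>\<omega>. cexp1 (Suc m) u (X (Suc m) \<omega>) \<partial>L)"
    using markov'[OF m1(2) bm2_snd[OF u']] m by simp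
  also have "\<dots> = (\<integral>\<omega>. cexp2 m u (X m \<omega>) \<partial>L)"
    using markov'[OF m1(1) bm2_snd[OF bm1_cexp1[OF m1(2) u']]] by simp
  also have "\<dots> \<ge> \<epsilon> * (\<integral>z. u z \<partial>\<mu> n)"
    by (rule integral_ge_const)
      (auto intro!: bounded_measurable_integrable bm_X[OF m1(3)] bm1_cexp1 m1 u' AE_I2
        cexp2_lower[OF m(2) u', folded m(1)] nn X_space[OF m1(3)])
  finally show ?thesis .
qed

lemma expectation_le_reference:
  assumes n: "n \<in> {1..k}" and u: "bm1 (Suc n) u" and nn: "\<And>z. z \<in> space (S (Suc n)) \<Longrightarrow> 0 \<le> u z"
  shows "(\<integral>\<omega>. u (X (Suc n) \<omega>) \<partial>L) \<le> (\<integral>z. u z \<partial>\<mu> (Suc n)) / \<epsilon>"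
proof -
  have n': "n \<in> {1..k+1}" using n by auto
  have "(\<integral>\<omega>. u (X (Suc n) \<omega>) \<partial>L) = (\<integral>\<omega>. cexp1 n u (X n \<omega>) \<partial>L)"
    using markov'[OF n bm2_snd[OF u]] by simp
  also have "\<dots> \<le> (\<integral>z. u z \<partial>\<mu> (Suc n)) / \<epsilon>"
    by (rule integral_le_const)
      (auto intro!: bounded_measurable_integrable bm_X[OF n'] bm1_cexp1 n u AE_I2 X_space[OF n']
        cexp1_upper[OF n u nn])
  finally show ?thesis .
qed

end

section \<open>Moments of martingales with bounded increments\<close>

context elliptic_chain
begin

text \<open>Approximate independence of the next state from the past: given \<open>F n\<close>, its
  law is at most \<open>\<mu> (Suc n)\<close> divided by \<epsilon>, and
  \<open>\<mu> (Suc n)\<close> is at most the unconditional law divided by \<epsilon>. The second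
  comparison is where \<open>2 \<le> n\<close> enters.\<close>

lemma weighted_expectation_bound:
  assumes n: "n \<in> {2..k}" and G: "bounded_measurable (F n) G" "\<And>\<omega>. \<omega> \<in> space L \<Longrightarrow> 0 \<le> G \<omega>"
    and u: "bm1 (Suc n) u" "\<And>y. y \<in> space (S (Suc n)) \<Longrightarrow> 0 \<le> u y"
  shows "(\<integral>\<omega>. G \<omega> * u (X (Suc n) \<omega>) \<partial>L) \<le> (\<integral>\<omega>. G \<omega> \<partial>L) * (\<integral>\<omega>. u (X (Suc n) \<omega>) \<partial>L) / \<epsilon>\<^sup>2"
proof -
  have n1: "n \<in> {1..k}" "n \<in> {1..k+1}" "Suc n \<in> {3..k+1}" using n by auto
  have G': "bounded_measurable L G" by (rule bm_F[OF n1(2) G(1)])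
  let ?I = "\<integral>y. u y \<partial>\<mu> (Suc n)" and ?E = "\<integral>\<omega>. u (X (Suc n) \<omega>) \<partial>L"
  have "(\<integral>\<omega>. G \<omega> * u (X (Suc n) \<omega>) \<partial>L) = (\<integral>\<omega>. G \<omega> * cexp1 n u (X n \<omega>) \<partial>L)"
    using markov[OF n1(1) G(1) bm2_snd[OF u(1)]] by simp
  also have "\<dots> \<le> (\<integral>\<omega>. G \<omega> * (?I / \<epsilon>) \<partial>L)"
  proof (rule integral_mono)
    show "G \<omega> * cexp1 n u (X n \<omega>) \<le> G \<omega> * (?I / \<epsilon>)" if "\<omega> \<in> space L" for \<omega>
      by (rule mult_left_mono[OF cexp1_upper[OF n1(1) u X_space[OF n1(2) that]] G(2)[OF that]])
  qed (intro bounded_measurable_integrable bounded_measurable_mult bounded_measurable_const G'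
      bm_X[OF n1(2)] bm1_cexp1 n1(1) u(1))+
  also have "\<dots> = (\<integral>\<omega>. G \<omega> \<partial>L) * (?I / \<epsilon>)" by simp
  also have "\<dots> \<le> (\<integral>\<omega>. G \<omega> \<partial>L) * (?E / \<epsilon>\<^sup>2)"
  proof (rule mult_left_mono)
    have "?I \<le> ?E / \<epsilon>"
      using reference_le_expectation[OF n1(3) u] eps by (simp add: field_simps)
    then have "?I / \<epsilon> \<le> (?E / \<epsilon>) / \<epsilon>" using eps by (intro divide_right_mono) auto
    then show "?I / \<epsilon> \<le> ?E / \<epsilon>\<^sup>2" by (simp add: power2_eq_square)
    show "0 \<le> expectation G" using G(2) by (rule Bochner_Integration.integral_nonneg)
  qed
  finally show ?thesis by simp
qed

text \<open>The sum stops before \<open>n\<close>, so it involves only states up to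
  \<open>X n\<close> and is measurable for \<open>F n\<close>.\<close>

definition partial_sum :: "(nat \<Rightarrow> 'a \<times> 'a \<Rightarrow> real) \<Rightarrow> nat \<Rightarrow> 'w \<Rightarrow> real" where
  "partial_sum d n \<omega> = (\<Sum>j\<in>{1..<n}. d j (step j \<omega>))"

definition energy :: "(nat \<Rightarrow> 'a \<times> 'a \<Rightarrow> real) \<Rightarrow> nat \<Rightarrow> real" where
  "energy d n = (\<integral>\<omega>. (d n (step n \<omega>))\<^sup>2 \<partial>L)"

lemma energy_nonneg: "0 \<le> energy d n"
  unfolding energy_def by simp

lemma partial_sum_Suc: "1 \<le> n \<Longrightarrow> partial_sum d (Suc n) \<omega> = partial_sum d n \<omega> + d n (step n \<omega>)"
  unfolding partial_sum_def by (simp add: atLeastLessThanSuc)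

lemma bm_F_partial_sum:
  assumes "\<And>j. j \<in> {1..k} \<Longrightarrow> bm2 j (d j)" "n \<in> {1..k+1}"
  shows "bounded_measurable (F n) (partial_sum d n)"
proof -
  have "bounded_measurable (F n) (\<lambda>\<omega>. \<Sum>j\<in>{1..<n}. d j (step j \<omega>))"
    using assms by (intro bounded_measurable_sum bm_F_step) auto
  then show ?thesis by (simp add: partial_sum_def[abs_def])
qed

context
  fixes d :: "nat \<Rightarrow> 'a \<times> 'a \<Rightarrow> real"
  assumes d_bm: "\<And>n. n \<in> {1..k} \<Longrightarrow> bm2 n (d n)"
    and d_mart: "\<And>n x. n \<in> {1..k} \<Longrightarrow> x \<in> space (S n) \<Longrightarrow> cexp n (d n) x = 0"
begin

lemma martingale_orthogonal:
  assumes n: "n \<in> {1..k}" and G: "bounded_measurable (F n) G"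
  shows "(\<integral>\<omega>. G \<omega> * d n (step n \<omega>) \<partial>L) = 0"
proof -
  have n': "n \<in> {1..k+1}" using n by auto
  have "(\<integral>\<omega>. G \<omega> * d n (step n \<omega>) \<partial>L) = (\<integral>\<omega>. G \<omega> * cexp n (d n) (X n \<omega>) \<partial>L)"
    by (rule markov[OF n G d_bm[OF n]])
  also have "\<dots> = (\<integral>\<omega>. 0 \<partial>L)"
    by (rule Bochner_Integration.integral_cong) (auto simp: d_mart[OF n X_space[OF n']])
  finally show ?thesis by simp
qed

text \<open>Each cross term is a factor known at time \<open>n\<close> times
  \<open>d n (step n \<omega>)\<close> and vanishes by \<open>martingale_orthogonal\<close>.\<close>

lemma martingale_second_moment:
  assumes "n \<in> {1..k+1}"
  shows "(\<integral>\<omega>. (partial_sum d n \<omega>)\<^sup>2 \<partial>L) = (\<Sum>j\<in>{1..<n}. energy d j)"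
proof -
  have "1 \<le> n" using assms by auto
  then show ?thesis using assms
  proof (induction n rule: dec_induct)
    case base
    show ?case by (simp add: partial_sum_def)
  next
    case (step n)
    have n: "n \<in> {1..k}" "n \<in> {1..k+1}" using step by auto
    have M: "bounded_measurable (F n) (partial_sum d n)" by (rule bm_F_partial_sum[OF d_bm n(2)])
    have M': "bounded_measurable L (partial_sum d n)" by (rule bm_F[OF n(2) M])
    have D: "bounded_measurable L (\<lambda>\<omega>. d n (step n \<omega>))" by (rule bm_step[OF n(1) d_bm[OF n(1)]])
    note i = bounded_measurable_integrable[OF bounded_measurable_power[OF M', of 2]]
      bounded_measurable_integrable[OF bounded_measurable_power[OF D, of 2]]
      bounded_measurable_integrable[OF bounded_measurable_mult[OF M' D]]
    have "(\<integral>\<omega>. (partial_sum d (Suc n) \<omega>)\<^sup>2 \<partial>L)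
        = (\<integral>\<omega>. (partial_sum d n \<omega>)\<^sup>2 + 2 * (partial_sum d n \<omega> * d n (step n \<omega>)) + (d n (step n \<omega>))\<^sup>2 \<partial>L)"
      using step by (simp add: partial_sum_Suc power2_sum algebra_simps)
    also have "\<dots> = (\<integral>\<omega>. (partial_sum d n \<omega>)\<^sup>2 \<partial>L) + energy d n"
      using i martingale_orthogonal[OF n(1) M] by (simp add: energy_def)
    also have "\<dots> = (\<Sum>j\<in>{1..<Suc n}. energy d j)"
      using step n by (simp add: atLeastLessThanSuc)
    finally show ?case .
  qed
qed

context
  fixes K :: real
  assumes d_bound: "\<And>n z. n \<in> {1..k} \<Longrightarrow> z \<in> space (S n \<Otimes>\<^sub>M S (Suc n)) \<Longrightarrow> \<bar>d n z\<bar> \<le> K"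
begin

lemma step_space: "n \<in> {1..k} \<Longrightarrow> \<omega> \<in> space L \<Longrightarrow> step n \<omega> \<in> space (S n \<Otimes>\<^sub>M S (Suc n))"
  using X_space[of n \<omega>] X_space[of "Suc n" \<omega>] by (auto simp: space_pair_measure)

lemma increment_sq_le:
  assumes "n \<in> {1..k}" "\<omega> \<in> space L"
  shows "(d n (step n \<omega>))\<^sup>2 \<le> K\<^sup>2"
  using d_bound[OF assms(1) step_space[OF assms]] by (metis abs_ge_zero power2_abs power_mono)

text \<open>Conditioning replaces the squared increment by a function \<open>v\<close> of
  \<open>X n\<close>, but \<open>partial_sum d n\<close> already depends on \<open>X n\<close>.
  Splitting off its last increment costs at most \<open>2 * K\<^sup>2\<close> and leaves a sum known
  at time \<open>n - 1\<close>, from which \<open>weighted_expectation_bound\<close> decouples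
  \<open>v (X n)\<close>.\<close>

lemma martingale_cross_moment:
  assumes n: "n \<in> {1..k}"
  shows "(\<integral>\<omega>. (partial_sum d n \<omega>)\<^sup>2 * (d n (step n \<omega>))\<^sup>2 \<partial>L)
    \<le> (2 * (\<Sum>j\<in>{1..k}. energy d j) / \<epsilon>\<^sup>2 + 2 * K\<^sup>2) * energy d n" (is "?l \<le> (2 * ?V / _ + _) * _")
proof -
  have n': "n \<in> {1..k+1}" using n by auto
  define v where "v = cexp n (\<lambda>z. (d n z)\<^sup>2)"
  have d2: "bm2 n (\<lambda>z. (d n z)\<^sup>2)" by (rule bounded_measurable_power[OF d_bm[OF n]])
  have v_bm: "bm1 n v" unfolding v_def by (rule bm1_cexp[OF n d2])
  have v_nn: "0 \<le> v x" for x unfolding v_def cexp_def by simp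
  have Ev: "(\<integral>\<omega>. v (X n \<omega>) \<partial>L) = energy d n"
    using markov'[OF n d2] unfolding v_def energy_def by simp
  have M: "bounded_measurable (F n) (partial_sum d n)" by (rule bm_F_partial_sum[OF d_bm n'])
  have "?l = (\<integral>\<omega>. (partial_sum d n \<omega>)\<^sup>2 * v (X n \<omega>) \<partial>L)"
    unfolding v_def by (rule markov[OF n bounded_measurable_power[OF M] d2])
  also have "\<dots> \<le> (2 * ?V / \<epsilon>\<^sup>2 + 2 * K\<^sup>2) * energy d n"
  proof (cases "n \<le> 2")
    \<comment> \<open>Here the sum has at most one term, so its square is at most
      \<open>K\<^sup>2\<close>; decoupling would need \<open>n - 1\<close> to be at least 2.\<close>
    case True
    then consider "n = 1" | "n = 2" using n by force
    then have sq: "(partial_sum d n \<omega>)\<^sup>2 \<le> K\<^sup>2" if "\<omega> \<in> space L" for \<omega>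
    proof cases
      case 2
      then show ?thesis
        using increment_sq_le[OF _ that, of 1] n by (simp add: partial_sum_def numeral_2_eq_2)
    qed (simp add: partial_sum_def)
    have "(\<integral>\<omega>. (partial_sum d n \<omega>)\<^sup>2 * v (X n \<omega>) \<partial>L) \<le> (\<integral>\<omega>. K\<^sup>2 * v (X n \<omega>) \<partial>L)"
      by (intro integral_mono mult_right_mono sq v_nn bounded_measurable_integrable
          bounded_measurable_intros bm_X v_bm bm_F[OF n' M] n')
    also have "\<dots> = K\<^sup>2 * energy d n" by (simp add: Ev)
    also have "\<dots> \<le> (2 * ?V / \<epsilon>\<^sup>2 + 2 * K\<^sup>2) * energy d n"
    proof (rule mult_right_mono[OF _ energy_nonneg])
      have "0 \<le> 2 * ?V / \<epsilon>\<^sup>2" by (simp add: sum_nonneg energy_nonneg)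
      then show "K\<^sup>2 \<le> 2 * ?V / \<epsilon>\<^sup>2 + 2 * K\<^sup>2"
        using zero_le_power2[of K] by linarith
    qed
    finally show ?thesis .
  next
    case False
    then obtain m where m: "n = Suc m" "m \<in> {2..k}" using n by (cases n) auto
    have m': "m \<in> {1..k}" "m \<in> {1..k+1}" using m by auto
    have N: "bounded_measurable (F m) (partial_sum d m)" by (rule bm_F_partial_sum[OF d_bm m'(2)])
    have N': "bounded_measurable L (partial_sum d m)" by (rule bm_F[OF m'(2) N])
    have sq: "(partial_sum d n \<omega>)\<^sup>2 \<le> 2 * (partial_sum d m \<omega>)\<^sup>2 + 2 * K\<^sup>2" if "\<omega> \<in> space L" for \<omega>
    proof -
      have "(a + b)\<^sup>2 \<le> 2 * a\<^sup>2 + 2 * b\<^sup>2" for a b :: real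
        using zero_le_power2[of "a - b"] by (simp add: power2_sum power2_diff)
      from this[of "partial_sum d m \<omega>" "d m (step m \<omega>)"] show ?thesis
        using increment_sq_le[OF m'(1) that] m by (simp add: partial_sum_Suc)
    qed
    have "(\<integral>\<omega>. (partial_sum d n \<omega>)\<^sup>2 * v (X n \<omega>) \<partial>L)
        \<le> (\<integral>\<omega>. (2 * (partial_sum d m \<omega>)\<^sup>2 + 2 * K\<^sup>2) * v (X n \<omega>) \<partial>L)"
      by (intro integral_mono mult_right_mono sq v_nn bounded_measurable_integrable
          bounded_measurable_intros bm_X v_bm bm_F[OF n' M] n' N')
    also have "\<dots> = (\<integral>\<omega>. 2 * ((partial_sum d m \<omega>)\<^sup>2 * v (X n \<omega>)) + 2 * K\<^sup>2 * v (X n \<omega>) \<partial>L)"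
      by (simp add: algebra_simps)
    also have "\<dots> = 2 * (\<integral>\<omega>. (partial_sum d m \<omega>)\<^sup>2 * v (X n \<omega>) \<partial>L) + 2 * K\<^sup>2 * energy d n"
      using bounded_measurable_integrable[OF bounded_measurable_mult[OF bounded_measurable_power[OF N'] bm_X[OF n' v_bm]], of 2]
        bounded_measurable_integrable[OF bm_X[OF n' v_bm]] by (simp add: Ev)
    also have "\<dots> \<le> 2 * (?V * energy d n / \<epsilon>\<^sup>2) + 2 * K\<^sup>2 * energy d n"
    proof -
      have "(\<integral>\<omega>. (partial_sum d m \<omega>)\<^sup>2 * v (X (Suc m) \<omega>) \<partial>L)
          \<le> (\<integral>\<omega>. (partial_sum d m \<omega>)\<^sup>2 \<partial>L) * (\<integral>\<omega>. v (X (Suc m) \<omega>) \<partial>L) / \<epsilon>\<^sup>2"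
        using m v_bm by (intro weighted_expectation_bound bounded_measurable_power N v_nn) auto
      also have "\<dots> = (\<Sum>j\<in>{1..<m}. energy d j) * energy d n / \<epsilon>\<^sup>2"
        using martingale_second_moment[OF m'(2)] Ev m by simp
      also have "\<dots> \<le> ?V * energy d n / \<epsilon>\<^sup>2"
        using m' by (intro divide_right_mono mult_right_mono sum_mono2 energy_nonneg) auto
      finally show ?thesis using m by simp
    qed
    finally show ?thesis by (simp add: algebra_simps)
  qed
  finally show ?thesis .
qed

text \<open>In the expansion of \<open>(M + b)^4\<close> the term \<open>M^3 b\<close> has mean
  zero, the term \<open>M^2 b^2\<close> is bounded by \<open>martingale_cross_moment\<close>, and
  the remaining ones reduce to it and to the energy. Each step therefore adds at most
  \<open>c\<close> times the energy of its increment.\<close>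

lemma martingale_fourth_moment:
  "(\<integral>\<omega>. (partial_sum d (Suc k) \<omega>) ^ 4 \<partial>L)
    \<le> 16 / \<epsilon>\<^sup>2 * (\<Sum>j\<in>{1..k}. energy d j)\<^sup>2 + 19 * K\<^sup>2 * (\<Sum>j\<in>{1..k}. energy d j)"
proof -
  define V where "V = (\<Sum>j\<in>{1..k}. energy d j)"
  \<comment> \<open>With the coefficients 8 and 3 of \<open>pointwise\<close> below and the factors
    2 of \<open>martingale_cross_moment\<close>: \<open>16 = 8 * 2\<close> and
    \<open>19 = 8 * 2 + 3\<close>.\<close>
  define c where "c = 16 * V / \<epsilon>\<^sup>2 + 19 * K\<^sup>2"
  have "(\<integral>\<omega>. (partial_sum d n \<omega>) ^ 4 \<partial>L) \<le> (\<Sum>j\<in>{1..<n}. c * energy d j)"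
    if "n \<in> {1..k+1}" for n
  proof -
    have "1 \<le> n" using that by auto
    then show ?thesis using that
    proof (induction n rule: dec_induct)
      case base
      show ?case by (simp add: partial_sum_def)
    next
      case (step n)
      have n: "n \<in> {1..k}" "n \<in> {1..k+1}" using step by auto
      have M: "bounded_measurable (F n) (partial_sum d n)" by (rule bm_F_partial_sum[OF d_bm n(2)])
      have M': "bounded_measurable L (partial_sum d n)" by (rule bm_F[OF n(2) M])
      have D: "bounded_measurable L (\<lambda>\<omega>. d n (step n \<omega>))" by (rule bm_step[OF n(1) d_bm[OF n(1)]])
      note i = bounded_measurable_integrable[OF bounded_measurable_power[OF M', of 4]]
        bounded_measurable_integrable[OF bounded_measurable_power[OF D, of 2]]
        bounded_measurable_integrable[OF bounded_measurable_mult[OF bounded_measurable_power[OF M', of 3] D]]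
        bounded_measurable_integrable[OF bounded_measurable_mult[OF
            bounded_measurable_power[OF M', of 2] bounded_measurable_power[OF D, of 2]]]
      \<comment> \<open>The term \<open>4 a b^3\<close> is split by
        \<open>2 a b \<le> a^2 + b^2\<close>. This raises the coefficient of \<open>a^2 b^2\<close>
        from 6 to 8 and that of \<open>b^4\<close> from 1 to 3.\<close>
      have pointwise: "(a + b) ^ 4 \<le> a ^ 4 + 4 * (a ^ 3 * b) + 8 * (a\<^sup>2 * b\<^sup>2) + 3 * K\<^sup>2 * b\<^sup>2"
        if "b\<^sup>2 \<le> K\<^sup>2" for a b :: real
      proof -
        have "(a + b) ^ 4 = a ^ 4 + 4 * (a ^ 3 * b) + 6 * (a\<^sup>2 * b\<^sup>2) + (4 * (a * b)) * b\<^sup>2 + b\<^sup>2 * b\<^sup>2"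
          by (simp add: eval_nat_numeral algebra_simps)
        moreover have "(4 * (a * b)) * b\<^sup>2 \<le> (2 * a\<^sup>2 + 2 * b\<^sup>2) * b\<^sup>2"
          using zero_le_power2[of "a - b"] by (intro mult_right_mono) (auto simp: power2_diff)
        moreover have "b\<^sup>2 * b\<^sup>2 \<le> K\<^sup>2 * b\<^sup>2" using that by (intro mult_right_mono) auto
        ultimately show ?thesis by (simp add: algebra_simps)
      qed
      have "(\<integral>\<omega>. (partial_sum d (Suc n) \<omega>) ^ 4 \<partial>L)
          \<le> (\<integral>\<omega>. (partial_sum d n \<omega>) ^ 4 + 4 * ((partial_sum d n \<omega>) ^ 3 * d n (step n \<omega>))
              + 8 * ((partial_sum d n \<omega>)\<^sup>2 * (d n (step n \<omega>))\<^sup>2) + 3 * K\<^sup>2 * (d n (step n \<omega>))\<^sup>2 \<partial>L)"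
      proof (rule integral_mono)
        show "(partial_sum d (Suc n) \<omega>) ^ 4 \<le> (partial_sum d n \<omega>) ^ 4 + 4 * ((partial_sum d n \<omega>) ^ 3 * d n (step n \<omega>))
              + 8 * ((partial_sum d n \<omega>)\<^sup>2 * (d n (step n \<omega>))\<^sup>2) + 3 * K\<^sup>2 * (d n (step n \<omega>))\<^sup>2"
          if "\<omega> \<in> space L" for \<omega>
          using pointwise[OF increment_sq_le[OF n(1) that]] step by (simp add: partial_sum_Suc)
        show "integrable L (\<lambda>\<omega>. (partial_sum d (Suc n) \<omega>) ^ 4)"
          using step.prems
          by (intro bounded_measurable_integrable bounded_measurable_power
              bm_F[OF _ bm_F_partial_sum[OF d_bm]]) auto
      qed (use i in simp)
      also have "\<dots> = (\<integral>\<omega>. (partial_sum d n \<omega>) ^ 4 \<partial>L)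
          + 8 * (\<integral>\<omega>. (partial_sum d n \<omega>)\<^sup>2 * (d n (step n \<omega>))\<^sup>2 \<partial>L) + 3 * K\<^sup>2 * energy d n"
        using i martingale_orthogonal[OF n(1) bounded_measurable_power[OF M, of 3]]
        by (simp add: energy_def)
      also have "\<dots> \<le> (\<Sum>j\<in>{1..<n}. c * energy d j)
          + 8 * ((2 * V / \<epsilon>\<^sup>2 + 2 * K\<^sup>2) * energy d n) + 3 * K\<^sup>2 * energy d n"
        using martingale_cross_moment[OF n(1)] step n by (simp add: V_def)
      also have "\<dots> = (\<Sum>j\<in>{1..<Suc n}. c * energy d j)"
        using step by (simp add: atLeastLessThanSuc c_def algebra_simps add_divide_distrib)
      finally show ?case .
    qed
  qed
  from this[of "Suc k"] have "(\<integral>\<omega>. (partial_sum d (Suc k) \<omega>) ^ 4 \<partial>L) \<le> c * V"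
    by (simp add: V_def sum_distrib_left atLeastLessThanSuc_atLeastAtMost)
  also have "\<dots> = 16 / \<epsilon>\<^sup>2 * V\<^sup>2 + 19 * K\<^sup>2 * V"
    by (simp add: c_def algebra_simps power2_eq_square)
  finally show ?thesis by (simp add: V_def)
qed

end

end

end

section \<open>Martingale decomposition\<close>

lemma sq_add_le:
  fixes a b s :: real
  assumes "0 < s"
  shows "(a + b)\<^sup>2 \<le> (1 + 1 / s) * a\<^sup>2 + (1 + s) * b\<^sup>2"
proof -
  have "0 \<le> (a - s * b)\<^sup>2 / s" using assms by simp
  also have "\<dots> = a\<^sup>2 / s - 2 * (a * b) + s * b\<^sup>2"
    using assms by (simp add: power2_diff power_mult_distrib field_simps power2_eq_square)
  finally show ?thesis by (simp add: power2_sum algebra_simps)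
qed

text \<open>A Paley--Zygmund argument: a fourth-moment bound turns tightness into a bound on the
  second moment.\<close>

lemma (in prob_space) expectation_le_of_small_tail:
  fixes W :: "'a \<Rightarrow> real"
  assumes W: "bounded_measurable M W"
    and t: "0 \<le> t" and C: "0 < C" "expectation (\<lambda>x. (W x)\<^sup>2) \<le> C * (expectation W)\<^sup>2"
    and tail: "prob {x \<in> space M. t < W x} \<le> 1 / (4 * C)"
  shows "expectation W \<le> 2 * t"
proof (cases "expectation W \<le> 0")
  case True
  then show ?thesis using t by simp
next
  case False
  let ?E = "expectation W" and ?A = "{x \<in> space M. t < W x}"
  have A: "?A \<in> sets M" using bounded_measurableD[OF W(1)] by simp
  \<comment> \<open>On the tail event \<open>W\<close> is bounded by
    \<open>s * W^2 + 1 / (4 * s)\<close>, a linearised Cauchy--Schwarz inequality. This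
    \<open>s\<close> makes each of the two resulting terms at most \<open>?E / 4\<close>, so half of
    \<open>?E\<close> is absorbed.\<close>
  define s where "s = 1 / (4 * C * ?E)"
  have s: "0 < s" using C False by (simp add: s_def)
  have pointwise: "W x \<le> t + s * (W x)\<^sup>2 + indicator ?A x / (4 * s)" if "x \<in> space M" for x
  proof (cases "t < W x")
    case True
    have "0 \<le> s * (W x - 1 / (2 * s))\<^sup>2" using s by simp
    also have "\<dots> = s * (W x)\<^sup>2 - W x + 1 / (4 * s)"
      using s by (simp add: power2_diff field_simps power2_eq_square)
    finally show ?thesis using that True t by simp
  next
    case False
    moreover have "0 \<le> s * (W x)\<^sup>2" using s by simp
    ultimately show ?thesis by simp
  qed
  note iW = bounded_measurable_integrable[OF bounded_measurable_power[OF W(1), of 2]]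
    bounded_measurable_integrable[OF bounded_measurable_indicator[OF A]]
  have "?E \<le> (\<integral>x. t + s * (W x)\<^sup>2 + indicator ?A x / (4 * s) \<partial>M)"
    using iW by (intro integral_mono pointwise bounded_measurable_integrable[OF W(1)]) auto
  also have "\<dots> = t + s * expectation (\<lambda>x. (W x)\<^sup>2) + prob ?A / (4 * s)"
    using iW A by (simp add: prob_space)
  also have "\<dots> \<le> t + s * (C * ?E\<^sup>2) + (1 / (4 * C)) / (4 * s)"
    using s C tail by (intro add_mono mult_left_mono divide_right_mono) auto
  also have "\<dots> = t + ?E / 2"
    using C False by (simp add: s_def field_simps power2_eq_square)
  finally show ?thesis by simp
qed

text \<open>The factor left when \<open>backward_energy_recursion\<close> is summed over a row:
  \<open>\<epsilon> ^ 4\<close> is the contraction gap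
  \<open>1 - (1 + \<epsilon>\<^sup>2) * (1 - \<epsilon>\<^sup>2)\<close>, and
  \<open>1 + 1 / \<epsilon>\<^sup>2\<close> is the price of separating the contracted term from the
  others.\<close>

definition mixing_constant :: "real \<Rightarrow> real" where
  "mixing_constant \<epsilon> = 4 * (1 + 1 / \<epsilon>\<^sup>2) / \<epsilon> ^ 4"

text \<open>\<open>2 * K + 4 * K / \<epsilon>\<close> bounds the increments, 16 and 19 stem from
  \<open>martingale_fourth_moment\<close>, and the factor 8 from
  \<open>(x - c)^4 \<le> 8 x^4 + 8 c^4\<close>. The summand 1 ensures that the constant also
  dominates the 8 in front of \<open>c^4\<close>.\<close>

definition kurtosis_constant :: "real \<Rightarrow> real \<Rightarrow> real" where
  "kurtosis_constant \<epsilon> K = 8 * (16 / \<epsilon>\<^sup>2 + 19 * (2 * K + 4 * K / \<epsilon>)\<^sup>2 + 1)"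

lemma kurtosis_constant_pos: "0 < kurtosis_constant \<epsilon> K"
  unfolding kurtosis_constant_def by (simp add: add_nonneg_pos)

section \<open>The conditional expectation of the remaining sum and its oscillation\<close>

context elliptic_chain
begin

text \<open>The argument counts the remaining steps, which makes the backward recursion in time
  primitive: \<open>backward_aux g (Suc m)\<close> is a function of the state at time
  \<open>k - m\<close>.\<close>

primrec backward_aux :: "(nat \<Rightarrow> 'a \<times> 'a \<Rightarrow> real) \<Rightarrow> nat \<Rightarrow> 'a \<Rightarrow> real" where
  "backward_aux g 0 = (\<lambda>_. 0)"
| "backward_aux g (Suc m) = cexp (k - m) (\<lambda>z. g (k - m) z + backward_aux g m (snd z))"

text \<open>\<open>backward g n x\<close> is the conditional expectation of \<open>\<Sum>j=n..k. g j (X j, X (j+1))\<close>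
  given \<open>X n = x\<close>.\<close>

definition backward :: "(nat \<Rightarrow> 'a \<times> 'a \<Rightarrow> real) \<Rightarrow> nat \<Rightarrow> 'a \<Rightarrow> real" where
  "backward g n = backward_aux g (Suc k - n)"

lemma backward_end: "backward g (Suc k) x = 0"
  by (simp add: backward_def)

lemma backward_step:
  assumes "n \<in> {1..k}"
  shows "backward g n = cexp n (\<lambda>z. g n z + backward g (Suc n) (snd z))"
proof -
  have "Suc k - n = Suc (k - n)" "k - (k - n) = n" using assms by auto
  then show ?thesis by (simp add: backward_def)
qed

text \<open>By \<open>backward_step\<close> this is the deviation of
  \<open>g n z + backward g (Suc n) (snd z)\<close> from its conditional mean: the Doob martingale
  difference of the sum.\<close>

definition increment :: "(nat \<Rightarrow> 'a \<times> 'a \<Rightarrow> real) \<Rightarrow> nat \<Rightarrow> 'a \<times> 'a \<Rightarrow> real" where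
  "increment g n z = g n z + backward g (Suc n) (snd z) - backward g n (fst z)"

text \<open>The \<open>backward\<close> terms telescope, and the one at time \<open>Suc k\<close> is
  zero.\<close>

lemma sum_eq_partial_sum_increment:
  "(\<Sum>n\<in>{1..k}. g n (step n \<omega>)) = partial_sum (increment g) (Suc k) \<omega> + backward g 1 (X 1 \<omega>)"
proof -
  have "partial_sum (increment g) (Suc k) \<omega>
      = (\<Sum>n\<in>{1..k}. g n (step n \<omega>)
          + (backward g (Suc n) (X (Suc n) \<omega>) - backward g n (X n \<omega>)))"
    by (simp add: partial_sum_def increment_def atLeastLessThanSuc_atLeastAtMost add_diff_eq)
  also have "\<dots> = (\<Sum>n\<in>{1..k}. g n (step n \<omega>))
      + (\<Sum>n\<in>{1..k}. backward g (Suc n) (X (Suc n) \<omega>) - backward g n (X n \<omega>))"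
    by (rule sum.distrib)
  also have "(\<Sum>n\<in>{1..k}. backward g (Suc n) (X (Suc n) \<omega>) - backward g n (X n \<omega>))
      = - backward g 1 (X 1 \<omega>)"
    using k_pos by (subst sum_Suc_diff) (auto simp: backward_end)
  finally show ?thesis by simp
qed

context
  fixes g :: "nat \<Rightarrow> 'a \<times> 'a \<Rightarrow> real"
  assumes g_bm: "\<And>n. n \<in> {1..k} \<Longrightarrow> bm2 n (g n)"
begin

lemma bm1_backward:
  assumes "n \<in> {1..k+1}"
  shows "bm1 n (backward g n)"
proof -
  have "n \<le> Suc k" using assms by auto
  then show ?thesis using assms
  proof (induction n rule: inc_induct)
    case base
    then show ?case by (simp add: backward_end[abs_def] bounded_measurable_const)
  next
    case (step n)
    then have n: "n \<in> {1..k}" by auto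
    show ?case
      unfolding backward_step[OF n]
      using n step.IH by (intro bm1_cexp bounded_measurable_add g_bm bm2_snd) auto
  qed
qed

lemma bm2_integrand:
  assumes "n \<in> {1..k}"
  shows "bm2 n (\<lambda>z. g n z + backward g (Suc n) (snd z))"
  using assms by (intro bounded_measurable_add g_bm bm2_snd bm1_backward) auto

lemma bm2_increment:
  assumes "n \<in> {1..k}"
  shows "bm2 n (increment g n)"
proof -
  have "bm2 n (\<lambda>z. g n z + backward g (Suc n) (snd z) - backward g n (fst z))"
    using assms by (intro bounded_measurable_diff bm2_integrand bm2_fst bm1_backward) auto
  then show ?thesis by (simp add: increment_def[abs_def])
qed

lemma cexp_increment:
  assumes n: "n \<in> {1..k}" and x: "x \<in> space (S n)"
  shows "cexp n (increment g n) x = 0"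
proof -
  have n': "n \<in> {1..k+1}" using n by auto
  have "cexp n (\<lambda>z. g n z + backward g (Suc n) (snd z) - backward g n (fst z)) x
      = cexp n (\<lambda>z. g n z + backward g (Suc n) (snd z)) x - cexp n (\<lambda>z. backward g n (fst z)) x"
    by (rule cexp_diff[OF n bm2_integrand[OF n] bm2_fst[OF bm1_backward[OF n']] x])
  also have "\<dots> = 0" by (simp add: backward_step[OF n, symmetric] cexp_fst[OF n x])
  finally show ?thesis by (simp add: increment_def[abs_def])
qed

lemma backward_step_add:
  assumes n: "n \<in> {1..k}" and x: "x \<in> space (S n)"
  shows "backward g n x = cexp n (g n) x + cexp1 n (backward g (Suc n)) x"
  unfolding backward_step[OF n]
  using n by (intro cexp_add x g_bm bm2_snd bm1_backward) auto

lemma backward_two_steps: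
  assumes n: "n \<in> {1..<k}" and x: "x \<in> space (S n)"
  shows "backward g n x = cexp n (g n) x + cexp1 n (cexp (Suc n) (g (Suc n))) x
    + cexp2 n (backward g (Suc (Suc n))) x"
proof -
  have n1: "n \<in> {1..k}" "Suc n \<in> {1..k}" "Suc (Suc n) \<in> {1..k+1}" using n by auto
  have "cexp1 n (backward g (Suc n)) x
      = cexp1 n (\<lambda>y. cexp (Suc n) (g (Suc n)) y + cexp1 (Suc n) (backward g (Suc (Suc n))) y) x"
    by (rule cexp_cong[OF n1(1) x]) (simp add: backward_step_add[OF n1(2)])
  also have "\<dots> = cexp1 n (cexp (Suc n) (g (Suc n))) x + cexp2 n (backward g (Suc (Suc n))) x"
    by (intro cexp1_add n1 x bm1_cexp g_bm bm1_cexp1 bm1_backward)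
  finally show ?thesis using backward_step_add[OF n1(1) x] by simp
qed

text \<open>For the oscillation \<open>osc n\<close> of \<open>backward g n\<close>, two steps give
  \<open>osc n \<le> 4 * K + (1 - \<epsilon>) * osc (n + 2)\<close>. The fixed point of this
  recursion is \<open>4 * K / \<epsilon>\<close>, so the bound is independent of
  \<open>k\<close>.\<close>

lemma backward_oscillation:
  assumes bound: "\<And>n z. n \<in> {1..k} \<Longrightarrow> z \<in> space (S n \<Otimes>\<^sub>M S (Suc n)) \<Longrightarrow> \<bar>g n z\<bar> \<le> K"
    and "n \<in> {1..k+1}" "x \<in> space (S n)" "x' \<in> space (S n)"
  shows "backward g n x - backward g n x' \<le> 4 * K / \<epsilon>"
proof -
  have cexp_bound: "\<bar>cexp n (g n) x\<bar> \<le> K" if "n \<in> {1..k}" "x \<in> space (S n)" for n x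
  proof -
    have "- K \<le> g n (x, y) \<and> g n (x, y) \<le> K" if "y \<in> space (S (Suc n))" for y
      using bound[OF \<open>n \<in> {1..k}\<close>, of "(x, y)"] that \<open>x \<in> space (S n)\<close>
      by (auto simp: space_pair_measure abs_le_iff)
    then show ?thesis
      using cexp_bounds[OF that(1) g_bm[OF that(1)] that(2), of "-K" K] by (auto simp: abs_le_iff)
  qed
  have K: "0 \<le> K"
    using cexp_bound[of 1] S_not_empty[of 1] k_pos by (fastforce intro: order_trans[OF abs_ge_zero])
  show ?thesis using assms(2-4)
  proof (induction "Suc k - n" arbitrary: n x x' rule: less_induct)
    case less
    \<comment> \<open>The recursion moves by two, so both of the last two times are base
      cases.\<close>
    consider "n = Suc k" | "n = k" | "n \<in> {1..<k}" using less.prems(1) by force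
    then show ?case
    proof cases
      case 1
      then show ?thesis using K eps by (simp add: backward_end)
    next
      case 2
      then have n: "n \<in> {1..k}" using k_pos by auto
      have "backward g n = cexp n (g n)"
        unfolding backward_step[OF n] by (simp add: 2 backward_end)
      then have "backward g n x - backward g n x' \<le> 2 * K"
        using cexp_bound[OF n less.prems(2)] cexp_bound[OF n less.prems(3)] by simp
      also have "2 * K * \<epsilon> \<le> 4 * K * 1" using K eps by (intro mult_mono) auto
      then have "2 * K \<le> 4 * K / \<epsilon>" using eps by (simp add: field_simps)
      finally show ?thesis .
    next
      case 3
      have n: "n \<in> {1..k}" "Suc n \<in> {1..k}" "Suc (Suc n) \<in> {1..k+1}" using 3 by auto
      have two: "\<bar>cexp1 n (cexp (Suc n) (g (Suc n))) y\<bar> \<le> K" if "y \<in> space (S n)" for y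
      proof -
        have "- K \<le> cexp (Suc n) (g (Suc n)) w \<and> cexp (Suc n) (g (Suc n)) w \<le> K"
          if "w \<in> space (S (Suc n))" for w
          using cexp_bound[OF n(2) that] by (auto simp: abs_le_iff)
        then show ?thesis
          using cexp_bounds[OF n(1) bm2_snd[OF bm1_cexp[OF n(2) g_bm[OF n(2)]]] that, of "-K" K]
          by (auto simp: abs_le_iff)
      qed
      have "cexp2 n (backward g (Suc (Suc n))) x - cexp2 n (backward g (Suc (Suc n))) x'
          \<le> (1 - \<epsilon>) * (4 * K / \<epsilon>)"
        using n less.hyps[of "Suc (Suc n)"]
        by (intro cexp2_oscillation 3 bm1_backward less.prems) auto
      also have "\<dots> = 4 * K / \<epsilon> - 4 * K" using eps by (simp add: field_simps)
      finally show ?thesis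
        unfolding backward_two_steps[OF 3 less.prems(2)] backward_two_steps[OF 3 less.prems(3)]
        using cexp_bound[OF n(1) less.prems(2)] cexp_bound[OF n(1) less.prems(3)]
          two[OF less.prems(2)] two[OF less.prems(3)] by linarith
    qed
  qed
qed

text \<open>\<open>backward\<close> may grow with the number of remaining steps, but an increment
  only compares an integrand with its average over \<open>y\<close>. Thus the oscillation in
  \<open>y\<close> decides: \<open>2 * K\<close> from \<open>g\<close> and
  \<open>4 * K / \<epsilon>\<close> from \<open>backward\<close>.\<close>

lemma increment_bound:
  assumes bound: "\<And>n z. n \<in> {1..k} \<Longrightarrow> z \<in> space (S n \<Otimes>\<^sub>M S (Suc n)) \<Longrightarrow> \<bar>g n z\<bar> \<le> K"
    and n: "n \<in> {1..k}" and z: "z \<in> space (S n \<Otimes>\<^sub>M S (Suc n))"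
  shows "\<bar>increment g n z\<bar> \<le> 2 * K + 4 * K / \<epsilon>"
proof -
  obtain x y where xy: "z = (x, y)" "x \<in> space (S n)" "y \<in> space (S (Suc n))"
    using z by (auto simp: space_pair_measure)
  have n': "Suc n \<in> {1..k+1}" using n by auto
  let ?\<phi> = "\<lambda>z. g n z + backward g (Suc n) (snd z)"
  have *: "\<bar>?\<phi> (x, y) - ?\<phi> (x, y')\<bar> \<le> 2 * K + 4 * K / \<epsilon>" if "y' \<in> space (S (Suc n))" for y'
    using bound[OF n, of "(x, y)"] bound[OF n, of "(x, y')"] xy that
      backward_oscillation[OF bound n' xy(3) that] backward_oscillation[OF bound n' that xy(3)]
    by (auto simp: space_pair_measure abs_le_iff)
  have "?\<phi> (x, y) - (2 * K + 4 * K / \<epsilon>) \<le> ?\<phi> (x, y') \<and> ?\<phi> (x, y') \<le> ?\<phi> (x, y) + (2 * K + 4 * K / \<epsilon>)"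
    if "y' \<in> space (S (Suc n))" for y'
    using *[OF that] unfolding abs_le_iff by linarith
  from cexp_bounds[OF n bm2_integrand[OF n] xy(2) this]
  have "?\<phi> (x, y) - (2 * K + 4 * K / \<epsilon>) \<le> backward g n x"
       "backward g n x \<le> ?\<phi> (x, y) + (2 * K + 4 * K / \<epsilon>)"
    unfolding backward_step[OF n] by auto
  then show ?thesis unfolding increment_def xy(1) abs_le_iff by simp
qed

end

section \<open>Second moments of sums of centered functionals\<close>

lemma expectation_cexp_sq_le:
  assumes n: "n \<in> {1..k}" and \<phi>: "bm2 n \<phi>"
  shows "(\<integral>\<omega>. (cexp n \<phi> (X n \<omega>))\<^sup>2 \<partial>L) \<le> (\<integral>\<omega>. (\<phi> (step n \<omega>))\<^sup>2 \<partial>L)"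
proof -
  have n': "n \<in> {1..k+1}" using n by auto
  let ?p = "\<lambda>\<omega>. cexp n \<phi> (X n \<omega>)"
  have p: "bounded_measurable (F n) ?p" by (rule bm_F_X[OF n' bm1_cexp[OF n \<phi>]])
  note p' = bm_F[OF n' p] and \<phi>' = bm_step[OF n \<phi>]
  note i = bounded_measurable_integrable[OF bounded_measurable_power[OF \<phi>', of 2]]
    bounded_measurable_integrable[OF bounded_measurable_power[OF p', of 2]]
    bounded_measurable_integrable[OF bounded_measurable_mult[OF p' \<phi>']]
  \<comment> \<open>The mixed term equals the second moment of the conditional mean by
    \<open>markov\<close>, so the expansion leaves the difference of the two sides.\<close>
  have "0 \<le> (\<integral>\<omega>. (\<phi> (step n \<omega>) - ?p \<omega>)\<^sup>2 \<partial>L)" by simp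
  also have "\<dots> = (\<integral>\<omega>. (\<phi> (step n \<omega>))\<^sup>2 - 2 * (?p \<omega> * \<phi> (step n \<omega>)) + (?p \<omega>)\<^sup>2 \<partial>L)"
    by (simp add: power2_diff algebra_simps)
  also have "\<dots> = (\<integral>\<omega>. (\<phi> (step n \<omega>))\<^sup>2 \<partial>L) - (\<integral>\<omega>. (?p \<omega>)\<^sup>2 \<partial>L)"
    using i markov[OF n p \<phi>] by (simp add: power2_eq_square)
  finally show ?thesis by simp
qed

text \<open>The two-step operator contracts mean-zero functions in \<open>L\<^sup>2\<close>: the conditional variance of
  \<open>u (X (n+2))\<close> given \<open>X n\<close> is at least \<open>\<epsilon>\<^sup>2\<close> times its variance.\<close>

lemma cexp2_contraction:
  assumes n: "n \<in> {1..<k}" and u: "bm1 (Suc (Suc n)) u"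
    and mean: "(\<integral>\<omega>. u (X (Suc (Suc n)) \<omega>) \<partial>L) = 0"
  shows "(\<integral>\<omega>. (cexp2 n u (X n \<omega>))\<^sup>2 \<partial>L) \<le> (1 - \<epsilon>\<^sup>2) * (\<integral>\<omega>. (u (X (Suc (Suc n)) \<omega>))\<^sup>2 \<partial>L)"
proof -
  let ?m = "Suc (Suc n)"
  have n1: "n \<in> {1..k}" "Suc n \<in> {1..k}" "n \<in> {1..k+1}" "?m \<in> {1..k+1}" using n by auto
  let ?E = "\<integral>\<omega>. (u (X ?m \<omega>))\<^sup>2 \<partial>L"
  have u2: "bm1 ?m (\<lambda>z. (u z)\<^sup>2)" by (rule bounded_measurable_power[OF u])
  have w: "bm1 n (cexp2 n u)" and w2: "bm1 n (cexp2 n (\<lambda>z. (u z)\<^sup>2))"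
    using bm1_cexp1[OF n1(1) bm1_cexp1[OF n1(2) u]] bm1_cexp1[OF n1(1) bm1_cexp1[OF n1(2) u2]] by auto
  have lower: "\<epsilon>\<^sup>2 * ?E \<le> cexp2 n (\<lambda>z. (u z)\<^sup>2) x - (cexp2 n u x)\<^sup>2" if x: "x \<in> space (S n)" for x
  proof -
    \<comment> \<open>Since \<open>u\<close> has mean zero under the chain, shifting it by
      \<open>c\<close> only adds \<open>c\<^sup>2\<close> to its second moment. One \<epsilon> is
      spent on passing from the law of \<open>X ?m\<close> to \<open>\<mu> ?m\<close>, the other on
      passing from there to the two-step kernel at \<open>x\<close>.\<close>
    define c where "c = cexp2 n u x"
    have uc: "bm1 ?m (\<lambda>z. (u z - c)\<^sup>2)" by (intro bounded_measurable_intros u)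
    note iu = bounded_measurable_integrable[OF bm_X[OF n1(4) u]]
      bounded_measurable_integrable[OF bm_X[OF n1(4) u2]]
    have "\<epsilon>\<^sup>2 * ?E \<le> \<epsilon>\<^sup>2 * (?E + c\<^sup>2)" by (intro mult_left_mono) auto
    also have "?E + c\<^sup>2 = (\<integral>\<omega>. (u (X ?m \<omega>))\<^sup>2 - 2 * c * u (X ?m \<omega>) + c\<^sup>2 \<partial>L)"
      using iu mean by (simp add: prob_space)
    also have "\<dots> = (\<integral>\<omega>. (u (X ?m \<omega>) - c)\<^sup>2 \<partial>L)" by (simp add: power2_diff algebra_simps)
    also have "\<epsilon>\<^sup>2 * \<dots> \<le> \<epsilon>\<^sup>2 * ((\<integral>z. (u z - c)\<^sup>2 \<partial>\<mu> ?m) / \<epsilon>)"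
      by (intro mult_left_mono expectation_le_reference n1 uc) auto
    also have "\<dots> = \<epsilon> * (\<integral>z. (u z - c)\<^sup>2 \<partial>\<mu> ?m)" using eps by (simp add: power2_eq_square)
    also have "\<dots> \<le> cexp2 n (\<lambda>z. (u z - c)\<^sup>2) x" by (rule cexp2_lower[OF n uc _ x]) simp
    also have "cexp2 n (\<lambda>z. (u z - c)\<^sup>2) x = cexp2 n (\<lambda>z. (u z)\<^sup>2 - (2 * c * u z - c\<^sup>2)) x"
      by (simp add: power2_diff algebra_simps)
    also have "\<dots> = cexp2 n (\<lambda>z. (u z)\<^sup>2) x - cexp2 n (\<lambda>z. 2 * c * u z - c\<^sup>2) x"
      by (intro cexp2_diff n x u2 bounded_measurable_intros u)
    also have "cexp2 n (\<lambda>z. 2 * c * u z - c\<^sup>2) x = cexp2 n (\<lambda>z. 2 * c * u z) x - cexp2 n (\<lambda>z. c\<^sup>2) x"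
      by (intro cexp2_diff n x bounded_measurable_intros u)
    also have "\<dots> = 2 * c * c - c\<^sup>2" by (simp only: cexp2_const[OF n x] cexp_cmult c_def)
    finally show ?thesis by (simp add: c_def power2_eq_square)
  qed
  have "\<epsilon>\<^sup>2 * ?E \<le> (\<integral>\<omega>. cexp2 n (\<lambda>z. (u z)\<^sup>2) (X n \<omega>) - (cexp2 n u (X n \<omega>))\<^sup>2 \<partial>L)"
    by (intro integral_ge_const AE_I2 lower X_space n1 bounded_measurable_integrable
        bounded_measurable_intros bm_X[OF n1(3)] w w2)
  also have "\<dots> = (\<integral>\<omega>. cexp2 n (\<lambda>z. (u z)\<^sup>2) (X n \<omega>) \<partial>L) - (\<integral>\<omega>. (cexp2 n u (X n \<omega>))\<^sup>2 \<partial>L)"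
    by (intro Bochner_Integration.integral_diff bounded_measurable_integrable
        bounded_measurable_power bm_X[OF n1(3)] w w2)
  also have "(\<integral>\<omega>. cexp2 n (\<lambda>z. (u z)\<^sup>2) (X n \<omega>) \<partial>L) = ?E"
    using markov'[OF n1(1) bm2_snd[OF bm1_cexp1[OF n1(2) u2]]] markov'[OF n1(2) bm2_snd[OF u2]] by simp
  finally show ?thesis by (simp add: algebra_simps)
qed

context
  fixes g :: "nat \<Rightarrow> 'a \<times> 'a \<Rightarrow> real"
  assumes g_bm: "\<And>n. n \<in> {1..k} \<Longrightarrow> bm2 n (g n)"
    and g_mean: "\<And>n. n \<in> {1..k} \<Longrightarrow> (\<integral>\<omega>. g n (step n \<omega>) \<partial>L) = 0"
begin

text \<open>Supplies the mean-zero hypothesis of \<open>cexp2_contraction\<close>; it passes from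
  the entries \<open>g n\<close> to \<open>backward\<close> by backward induction.\<close>

lemma expectation_backward:
  assumes "n \<in> {1..k+1}"
  shows "(\<integral>\<omega>. backward g n (X n \<omega>) \<partial>L) = 0"
proof -
  have "n \<le> Suc k" using assms by auto
  then show ?thesis using assms
  proof (induction n rule: inc_induct)
    case base
    then show ?case by (simp add: backward_end)
  next
    case (step n)
    then have n: "n \<in> {1..k}" "Suc n \<in> {1..k+1}" by auto
    have "(\<integral>\<omega>. backward g n (X n \<omega>) \<partial>L) = (\<integral>\<omega>. g n (step n \<omega>) + backward g (Suc n) (X (Suc n) \<omega>) \<partial>L)"
      using markov'[OF n(1) bm2_integrand[OF g_bm n(1)]] by (simp add: backward_step[OF n(1)])
    also have "\<dots> = 0"
      using step.IH n g_mean[OF n(1)]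
        bounded_measurable_integrable[OF bm_step[OF n(1) g_bm[OF n(1)]]]
        bounded_measurable_integrable[OF bm_X[OF n(2) bm1_backward[OF g_bm n(2)]]] by simp
    finally show ?case .
  qed
qed

definition backward_energy :: "nat \<Rightarrow> real" where
  "backward_energy n = (\<integral>\<omega>. (backward g n (X n \<omega>))\<^sup>2 \<partial>L)"

lemma backward_energy_nonneg: "0 \<le> backward_energy n"
  unfolding backward_energy_def by simp

text \<open>\<open>sq_add_le\<close> is used with weight \<open>\<epsilon>\<^sup>2\<close>: small
  enough that the contracted term keeps the factor
  \<open>(1 + \<epsilon>\<^sup>2) * (1 - \<epsilon>\<^sup>2) < 1\<close>, at the price
  \<open>1 + 1 / \<epsilon>\<^sup>2\<close> on the energies.\<close>

lemma backward_energy_recursion: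
  assumes n: "n \<in> {1..<k}"
  shows "backward_energy n \<le> (1 + 1 / \<epsilon>\<^sup>2) * (2 * energy g n + 2 * energy g (Suc n))
    + (1 - \<epsilon> ^ 4) * backward_energy (Suc (Suc n))"
proof -
  have n1: "n \<in> {1..k}" "Suc n \<in> {1..k}" "Suc (Suc n) \<in> {1..k+1}" "n \<in> {1..k+1}" "Suc n \<in> {1..k+1}"
    using n by auto
  let ?a = "\<lambda>\<omega>. cexp n (g n) (X n \<omega>)"
  let ?b = "\<lambda>\<omega>. cexp1 n (cexp (Suc n) (g (Suc n))) (X n \<omega>)"
  let ?c = "\<lambda>\<omega>. cexp2 n (backward g (Suc (Suc n))) (X n \<omega>)"
  have a: "bounded_measurable L ?a" by (rule bm_X[OF n1(4) bm1_cexp[OF n1(1) g_bm[OF n1(1)]]])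
  have b: "bounded_measurable L ?b"
    by (rule bm_X[OF n1(4) bm1_cexp1[OF n1(1) bm1_cexp[OF n1(2) g_bm[OF n1(2)]]]])
  have c: "bounded_measurable L ?c"
    by (rule bm_X[OF n1(4) bm1_cexp1[OF n1(1) bm1_cexp1[OF n1(2) bm1_backward[OF g_bm n1(3)]]]])
  note i = bounded_measurable_integrable[OF bounded_measurable_power[OF a, of 2]]
    bounded_measurable_integrable[OF bounded_measurable_power[OF b, of 2]]
    bounded_measurable_integrable[OF bounded_measurable_power[OF c, of 2]]
  have e2: "0 < \<epsilon>\<^sup>2" using eps by simp
  have pointwise: "(backward g n (X n \<omega>))\<^sup>2
      \<le> (1 + 1 / \<epsilon>\<^sup>2) * (2 * (?a \<omega>)\<^sup>2 + 2 * (?b \<omega>)\<^sup>2) + (1 + \<epsilon>\<^sup>2) * (?c \<omega>)\<^sup>2" if "\<omega> \<in> space L" for \<omega>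
  proof -
    have "(?a \<omega> + ?b \<omega>)\<^sup>2 \<le> 2 * (?a \<omega>)\<^sup>2 + 2 * (?b \<omega>)\<^sup>2"
      using sq_add_le[of 1 "?a \<omega>" "?b \<omega>"] by simp
    then have "(1 + 1 / \<epsilon>\<^sup>2) * (?a \<omega> + ?b \<omega>)\<^sup>2 \<le> (1 + 1 / \<epsilon>\<^sup>2) * (2 * (?a \<omega>)\<^sup>2 + 2 * (?b \<omega>)\<^sup>2)"
      by (intro mult_left_mono) auto
    moreover have "backward g n (X n \<omega>) = ?a \<omega> + ?b \<omega> + ?c \<omega>"
      by (rule backward_two_steps[OF g_bm n X_space[OF n1(4) that]])
    ultimately show ?thesis
      using sq_add_le[OF e2, of "?a \<omega> + ?b \<omega>" "?c \<omega>"] by simp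
  qed
  have "backward_energy n
      \<le> (\<integral>\<omega>. (1 + 1 / \<epsilon>\<^sup>2) * (2 * (?a \<omega>)\<^sup>2 + 2 * (?b \<omega>)\<^sup>2) + (1 + \<epsilon>\<^sup>2) * (?c \<omega>)\<^sup>2 \<partial>L)"
    unfolding backward_energy_def
    by (intro integral_mono pointwise bounded_measurable_integrable bounded_measurable_intros
        a b c bm_X[OF n1(4) bm1_backward[OF g_bm n1(4)]])
  also have "\<dots> = (1 + 1 / \<epsilon>\<^sup>2) * (2 * (\<integral>\<omega>. (?a \<omega>)\<^sup>2 \<partial>L) + 2 * (\<integral>\<omega>. (?b \<omega>)\<^sup>2 \<partial>L))
      + (1 + \<epsilon>\<^sup>2) * (\<integral>\<omega>. (?c \<omega>)\<^sup>2 \<partial>L)"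
    using i by simp
  also have "\<dots> \<le> (1 + 1 / \<epsilon>\<^sup>2) * (2 * energy g n + 2 * energy g (Suc n))
      + (1 + \<epsilon>\<^sup>2) * ((1 - \<epsilon>\<^sup>2) * backward_energy (Suc (Suc n)))"
  proof (intro add_mono mult_left_mono)
    show "(\<integral>\<omega>. (?a \<omega>)\<^sup>2 \<partial>L) \<le> energy g n"
      unfolding energy_def by (rule expectation_cexp_sq_le[OF n1(1) g_bm[OF n1(1)]])
    have "(\<integral>\<omega>. (?b \<omega>)\<^sup>2 \<partial>L) \<le> (\<integral>\<omega>. (cexp (Suc n) (g (Suc n)) (X (Suc n) \<omega>))\<^sup>2 \<partial>L)"
      using expectation_cexp_sq_le[OF n1(1) bm2_snd[OF bm1_cexp[OF n1(2) g_bm[OF n1(2)]]]] by simp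
    also have "\<dots> \<le> energy g (Suc n)"
      unfolding energy_def by (rule expectation_cexp_sq_le[OF n1(2) g_bm[OF n1(2)]])
    finally show "(\<integral>\<omega>. (?b \<omega>)\<^sup>2 \<partial>L) \<le> energy g (Suc n)" .
    show "(\<integral>\<omega>. (?c \<omega>)\<^sup>2 \<partial>L) \<le> (1 - \<epsilon>\<^sup>2) * backward_energy (Suc (Suc n))"
      unfolding backward_energy_def
      by (rule cexp2_contraction[OF n bm1_backward[OF g_bm n1(3)] expectation_backward[OF n1(3)]])
  qed auto
  also have "(1 + \<epsilon>\<^sup>2) * ((1 - \<epsilon>\<^sup>2) * backward_energy (Suc (Suc n)))
      = (1 - \<epsilon> ^ 4) * backward_energy (Suc (Suc n))"
    by (simp add: algebra_simps eval_nat_numeral)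
  finally show ?thesis .
qed

text \<open>After summation the recursion has the same total on both sides, because the shift by two
  meets only the vanishing term at \<open>Suc k\<close>. The factor
  \<open>1 - \<epsilon> ^ 4\<close> on the right lets that total be absorbed.\<close>

lemma sum_backward_energy:
  "(\<Sum>n\<in>{1..k}. backward_energy n) \<le> mixing_constant \<epsilon> * (\<Sum>n\<in>{1..k}. energy g n)"
proof -
  let ?B = "\<Sum>n\<in>{1..k}. backward_energy n" and ?G = "\<Sum>n\<in>{1..k}. energy g n"
  let ?q = "1 + 1 / \<epsilon>\<^sup>2"
  have kk: "{1..k} = insert k {1..<k}" using k_pos by auto
  have split: "(\<Sum>n\<in>{1..k}. c n) = (\<Sum>n\<in>{1..<k}. c n) + c k" for c :: "nat \<Rightarrow> real"
    unfolding kk by simp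
  have q: "1 \<le> ?q" by simp
  have e4: "0 < \<epsilon> ^ 4" "\<epsilon> ^ 4 \<le> 1" using eps by (auto intro: power_le_one)
  have kin: "k \<in> {1..k}" using k_pos by auto
  \<comment> \<open>Time \<open>k\<close> lies outside the two-step recursion. The bound is weakened
    to this form so that it completes the sum over \<open>{1..<k}\<close>.\<close>
  have last: "backward_energy k \<le> ?q * (2 * energy g k)"
  proof -
    have "backward g k = cexp k (g k)"
      unfolding backward_step[OF kin] by (simp add: backward_end)
    then have "backward_energy k \<le> energy g k"
      unfolding backward_energy_def energy_def
      using expectation_cexp_sq_le[OF kin g_bm[OF kin]] by simp
    also have "\<dots> \<le> ?q * (2 * energy g k)"
      using mult_mono[OF q, of "energy g k" "2 * energy g k"] energy_nonneg[of g k] by simp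
    finally show ?thesis .
  qed
  have shift1: "(\<Sum>n\<in>{1..<k}. energy g (Suc n)) \<le> ?G"
  proof -
    have "(\<Sum>n\<in>{1..<k}. energy g (Suc n)) = (\<Sum>n\<in>{2..k}. energy g n)"
      by (rule sum.reindex_bij_witness[of _ "\<lambda>n. n - 1" Suc]) auto
    also have "\<dots> \<le> ?G" by (rule sum_mono2) (auto intro: energy_nonneg)
    finally show ?thesis .
  qed
  have shift2: "(\<Sum>n\<in>{1..<k}. backward_energy (Suc (Suc n))) \<le> ?B"
  proof -
    have "(\<Sum>n\<in>{1..<k}. backward_energy (Suc (Suc n))) = (\<Sum>n\<in>{3..Suc k}. backward_energy n)"
      by (rule sum.reindex_bij_witness[of _ "\<lambda>n. n - 2" "\<lambda>n. n + 2"]) auto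
    also have "\<dots> \<le> (\<Sum>n\<in>{1..Suc k}. backward_energy n)"
      by (rule sum_mono2) (auto intro: backward_energy_nonneg)
    also have "\<dots> = ?B" by (simp add: backward_energy_def backward_end)
    finally show ?thesis .
  qed
  have "?B = (\<Sum>n\<in>{1..<k}. backward_energy n) + backward_energy k" by (rule split)
  also have "\<dots> \<le> (\<Sum>n\<in>{1..<k}. ?q * (2 * energy g n + 2 * energy g (Suc n))
      + (1 - \<epsilon> ^ 4) * backward_energy (Suc (Suc n))) + ?q * (2 * energy g k)"
    by (intro add_mono sum_mono backward_energy_recursion last)
  also have "\<dots> = ?q * (2 * ?G + 2 * (\<Sum>n\<in>{1..<k}. energy g (Suc n)))
      + (1 - \<epsilon> ^ 4) * (\<Sum>n\<in>{1..<k}. backward_energy (Suc (Suc n)))"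
    unfolding split[of "energy g"] by (simp only: sum.distrib sum_distrib_left[symmetric] distrib_left)
  also have "\<dots> \<le> ?q * (2 * ?G + 2 * ?G) + (1 - \<epsilon> ^ 4) * ?B"
    using shift1 shift2 q e4 by (intro add_mono mult_left_mono) auto
  finally have "\<epsilon> ^ 4 * ?B \<le> 4 * ?q * ?G" by (simp add: algebra_simps)
  then have "?B \<le> 4 * ?q * ?G / \<epsilon> ^ 4" using e4 by (simp add: field_simps)
  then show ?thesis by (simp add: mixing_constant_def)
qed

text \<open>The sum is a martingale plus \<open>backward g 1\<close>, which gives two squares with
  factor 2. Each martingale increment has three parts, squared with factor 3. The energies are thus
  counted \<open>2 * 3 = 6\<close> times and the backward energies
  \<open>2 * (3 + 3) + 2 = 14\<close> times.\<close>

theorem second_moment_le_sum_energy: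
  "(\<integral>\<omega>. (\<Sum>n\<in>{1..k}. g n (step n \<omega>))\<^sup>2 \<partial>L) \<le> (6 + 14 * mixing_constant \<epsilon>) * (\<Sum>n\<in>{1..k}. energy g n)"
proof -
  let ?B = "\<Sum>n\<in>{1..k}. backward_energy n" and ?G = "\<Sum>n\<in>{1..k}. energy g n"
  let ?D = "increment g" and ?P = "partial_sum (increment g) (Suc k)"
  have one: "1 \<in> {1..k+1}" "1 \<in> {1..k}" "Suc k \<in> {1..k+1}" using k_pos by auto
  have P: "bounded_measurable L ?P"
    by (rule bm_F[OF one(3) bm_F_partial_sum[OF bm2_increment[OF g_bm] one(3)]])
  have b: "bounded_measurable L (\<lambda>\<omega>. backward g 1 (X 1 \<omega>))"
    by (rule bm_X[OF one(1) bm1_backward[OF g_bm one(1)]])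
  have sq2: "(x + y)\<^sup>2 \<le> 2 * x\<^sup>2 + 2 * y\<^sup>2" for x y :: real
    using sq_add_le[of 1 x y] by simp
  have "(\<integral>\<omega>. (\<Sum>n\<in>{1..k}. g n (step n \<omega>))\<^sup>2 \<partial>L)
      \<le> (\<integral>\<omega>. 2 * (?P \<omega>)\<^sup>2 + 2 * (backward g 1 (X 1 \<omega>))\<^sup>2 \<partial>L)"
    unfolding sum_eq_partial_sum_increment
    by (intro integral_mono sq2 bounded_measurable_integrable bounded_measurable_intros P b)
  also have "\<dots> = 2 * (\<Sum>n\<in>{1..k}. energy ?D n) + 2 * backward_energy 1"
    using martingale_second_moment[of ?D "Suc k", OF bm2_increment[OF g_bm] cexp_increment[OF g_bm] one(3)]
      bounded_measurable_integrable[OF bounded_measurable_power[OF P, of 2]]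
      bounded_measurable_integrable[OF bounded_measurable_power[OF b, of 2]]
    by (simp add: backward_energy_def atLeastLessThanSuc_atLeastAtMost)
  also have "(\<Sum>n\<in>{1..k}. energy ?D n)
      \<le> (\<Sum>n\<in>{1..k}. 3 * energy g n + 3 * backward_energy (Suc n) + 3 * backward_energy n)"
  proof (rule sum_mono)
    fix n assume n: "n \<in> {1..k}"
    then have n': "Suc n \<in> {1..k+1}" "n \<in> {1..k+1}" by auto
    have sq3: "(x + y - z)\<^sup>2 \<le> 3 * x\<^sup>2 + 3 * y\<^sup>2 + 3 * z\<^sup>2" for x y z :: real
    proof -
      have "0 \<le> (x - y)\<^sup>2 + (x + z)\<^sup>2 + (y + z)\<^sup>2" by simp
      then show ?thesis by (simp add: power2_eq_square algebra_simps)
    qed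
    note bms = bm_step[OF n g_bm[OF n]] bm_X[OF n'(1) bm1_backward[OF g_bm n'(1)]]
      bm_X[OF n'(2) bm1_backward[OF g_bm n'(2)]]
    have "energy ?D n \<le> (\<integral>\<omega>. 3 * (g n (step n \<omega>))\<^sup>2 + 3 * (backward g (Suc n) (X (Suc n) \<omega>))\<^sup>2
        + 3 * (backward g n (X n \<omega>))\<^sup>2 \<partial>L)"
      unfolding energy_def increment_def fst_conv snd_conv
      by (intro integral_mono sq3 bounded_measurable_integrable bounded_measurable_intros bms)
    also have "\<dots> = 3 * energy g n + 3 * backward_energy (Suc n) + 3 * backward_energy n"
      using bms[THEN bounded_measurable_power, THEN bounded_measurable_integrable, of 2]
      by (simp add: energy_def backward_energy_def)
    finally show "energy ?D n \<le> 3 * energy g n + 3 * backward_energy (Suc n) + 3 * backward_energy n" .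
  qed
  also have "\<dots> = 3 * ?G + 3 * (\<Sum>n\<in>{1..k}. backward_energy (Suc n)) + 3 * ?B"
    by (simp only: sum.distrib sum_distrib_left[symmetric])
  also have "(\<Sum>n\<in>{1..k}. backward_energy (Suc n)) \<le> ?B"
  proof -
    have "(\<Sum>n\<in>{1..k}. backward_energy (Suc n)) = (\<Sum>n\<in>{2..Suc k}. backward_energy n)"
      by (rule sum.reindex_bij_witness[of _ "\<lambda>n. n - 1" Suc]) auto
    also have "\<dots> \<le> (\<Sum>n\<in>{1..Suc k}. backward_energy n)"
      by (rule sum_mono2) (auto intro: backward_energy_nonneg)
    also have "\<dots> = ?B" by (simp add: backward_energy_def backward_end)
    finally show ?thesis .
  qed
  also have "backward_energy 1 \<le> ?B"
    using one by (intro member_le_sum backward_energy_nonneg) auto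
  finally have "(\<integral>\<omega>. (\<Sum>n\<in>{1..k}. g n (step n \<omega>))\<^sup>2 \<partial>L) \<le> 6 * ?G + 14 * ?B" by simp
  also have "\<dots> \<le> (6 + 14 * mixing_constant \<epsilon>) * ?G"
    using sum_backward_energy by (simp add: algebra_simps)
  finally show ?thesis .
qed

end

end

section \<open>From tightness to a gradient decomposition of one row\<close>

context elliptic_chain
begin

context
  fixes g :: "nat \<Rightarrow> 'a \<times> 'a \<Rightarrow> real" and K :: real
  assumes g_bm: "\<And>n. n \<in> {1..k} \<Longrightarrow> bm2 n (g n)"
    and g_bound: "\<And>n z. n \<in> {1..k} \<Longrightarrow> z \<in> space (S n \<Otimes>\<^sub>M S (Suc n)) \<Longrightarrow> \<bar>g n z\<bar> \<le> K"
begin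

lemma expectation_increment:
  assumes n: "n \<in> {1..k}"
  shows "(\<integral>\<omega>. increment g n (step n \<omega>) \<partial>L) = 0"
  using martingale_orthogonal[of "increment g" n "\<lambda>_. 1", OF bm2_increment[OF g_bm]
      cexp_increment[OF g_bm] n bounded_measurable_const] by simp

text \<open>Provides the input of \<open>expectation_le_of_small_tail\<close> for
  \<open>(M - c)^2\<close>, whose mean is \<open>V + c^2\<close> and whose second moment is of order
  \<open>V^2 + c^4\<close>. The shift \<open>c\<close> is free because the centering in the
  tightness hypothesis is.\<close>

lemma fourth_moment_increments:
  defines "V \<equiv> \<Sum>n\<in>{1..k}. energy (increment g) n"
  assumes V: "1 \<le> V"
  shows "(\<integral>\<omega>. ((partial_sum (increment g) (Suc k) \<omega> - c)\<^sup>2)\<^sup>2 \<partial>L)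
    \<le> kurtosis_constant \<epsilon> K * (\<integral>\<omega>. (partial_sum (increment g) (Suc k) \<omega> - c)\<^sup>2 \<partial>L)\<^sup>2"
    and "V \<le> (\<integral>\<omega>. (partial_sum (increment g) (Suc k) \<omega> - c)\<^sup>2 \<partial>L)"
proof -
  let ?P = "partial_sum (increment g) (Suc k)" and ?K = "2 * K + 4 * K / \<epsilon>"
  have k1: "Suc k \<in> {1..k+1}" by simp
  have P: "bounded_measurable L ?P"
    by (rule bm_F[OF k1 bm_F_partial_sum[OF bm2_increment[OF g_bm] k1]])
  note iP = bounded_measurable_integrable[OF P]
    bounded_measurable_integrable[OF bounded_measurable_power[OF P, of 2]]
    bounded_measurable_integrable[OF bounded_measurable_power[OF P, of 4]]
  have mean: "(\<integral>\<omega>. ?P \<omega> \<partial>L) = 0"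
  proof -
    have "(\<integral>\<omega>. ?P \<omega> \<partial>L) = (\<Sum>n\<in>{1..k}. \<integral>\<omega>. increment g n (step n \<omega>) \<partial>L)"
      unfolding partial_sum_def atLeastLessThanSuc_atLeastAtMost
      by (intro Bochner_Integration.integral_sum bounded_measurable_integrable bm_step bm2_increment g_bm)
    also have "\<dots> = 0" by (rule sum.neutral) (auto intro: expectation_increment)
    finally show ?thesis .
  qed
  have "(\<integral>\<omega>. (?P \<omega>)\<^sup>2 \<partial>L) = V"
    using martingale_second_moment[of "increment g" "Suc k", OF bm2_increment[OF g_bm]
        cexp_increment[OF g_bm] k1]
    by (simp add: V_def atLeastLessThanSuc_atLeastAtMost)
  then have E2: "(\<integral>\<omega>. (?P \<omega> - c)\<^sup>2 \<partial>L) = V + c\<^sup>2"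
    using iP mean by (simp add: power2_diff prob_space)
  then show "V \<le> (\<integral>\<omega>. (?P \<omega> - c)\<^sup>2 \<partial>L)" by simp
  have E4: "(\<integral>\<omega>. (?P \<omega>) ^ 4 \<partial>L) \<le> 16 / \<epsilon>\<^sup>2 * V\<^sup>2 + 19 * ?K\<^sup>2 * V"
    unfolding V_def
    by (rule martingale_fourth_moment[OF bm2_increment[OF g_bm] cexp_increment[OF g_bm]
          increment_bound[OF g_bm g_bound]])
  have pointwise: "((x - c)\<^sup>2)\<^sup>2 \<le> 8 * x ^ 4 + 8 * c ^ 4" for x :: real
  proof -
    have "(x - c)\<^sup>2 \<le> 2 * x\<^sup>2 + 2 * c\<^sup>2"
      using sq_add_le[of 1 x "-c"] by simp
    then have "((x - c)\<^sup>2)\<^sup>2 \<le> (2 * x\<^sup>2 + 2 * c\<^sup>2)\<^sup>2" by (intro power_mono) auto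
    also have "\<dots> \<le> 2 * (2 * x\<^sup>2)\<^sup>2 + 2 * (2 * c\<^sup>2)\<^sup>2"
      using sq_add_le[of 1 "2 * x\<^sup>2" "2 * c\<^sup>2"] by simp
    also have "\<dots> = 8 * x ^ 4 + 8 * c ^ 4" by (simp add: eval_nat_numeral)
    finally show ?thesis .
  qed
  have "(\<integral>\<omega>. ((?P \<omega> - c)\<^sup>2)\<^sup>2 \<partial>L) \<le> (\<integral>\<omega>. 8 * (?P \<omega>) ^ 4 + 8 * c ^ 4 \<partial>L)"
    by (intro integral_mono pointwise bounded_measurable_integrable bounded_measurable_intros P)
  also have "\<dots> = 8 * (\<integral>\<omega>. (?P \<omega>) ^ 4 \<partial>L) + 8 * c ^ 4"
    using iP by (simp add: prob_space)
  also have "\<dots> \<le> 8 * (16 / \<epsilon>\<^sup>2 * V\<^sup>2 + 19 * ?K\<^sup>2 * V\<^sup>2) + 8 * c ^ 4"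
  proof -
    have "V \<le> V\<^sup>2" using V by (simp add: power2_eq_square)
    then have "19 * ?K\<^sup>2 * V \<le> 19 * ?K\<^sup>2 * V\<^sup>2" by (intro mult_left_mono) auto
    then show ?thesis using E4 by simp
  qed
  also have "\<dots> \<le> kurtosis_constant \<epsilon> K * V\<^sup>2 + kurtosis_constant \<epsilon> K * c ^ 4"
  proof (rule add_mono)
    show "8 * (16 / \<epsilon>\<^sup>2 * V\<^sup>2 + 19 * ?K\<^sup>2 * V\<^sup>2) \<le> kurtosis_constant \<epsilon> K * V\<^sup>2"
      by (simp add: kurtosis_constant_def algebra_simps)
    show "8 * c ^ 4 \<le> kurtosis_constant \<epsilon> K * c ^ 4"
      by (rule mult_right_mono) (auto simp: kurtosis_constant_def)
  qed
  also have "\<dots> = kurtosis_constant \<epsilon> K * (V\<^sup>2 + (c\<^sup>2)\<^sup>2)" by (simp add: algebra_simps)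
  also have "\<dots> \<le> kurtosis_constant \<epsilon> K * (V + c\<^sup>2)\<^sup>2"
    using V kurtosis_constant_pos[of \<epsilon> K] by (intro mult_left_mono) (auto simp: power2_sum)
  finally show "(\<integral>\<omega>. ((?P \<omega> - c)\<^sup>2)\<^sup>2 \<partial>L)
      \<le> kurtosis_constant \<epsilon> K * (\<integral>\<omega>. (?P \<omega> - c)\<^sup>2 \<partial>L)\<^sup>2"
    by (simp add: E2)
qed

text \<open>The variances in question sum to \<open>V\<close>, the sum of the energies of the
  increments. The 1 in the maximum covers \<open>V < 1\<close>; otherwise the tail bound applies
  with threshold \<open>(R + 4 * K / \<epsilon>)\<^sup>2\<close>, where
  \<open>4 * K / \<epsilon>\<close> accounts for the initial value of the potential.\<close>

theorem tight_imp_gradient_decomposition: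
  assumes R: "0 \<le> R"
    and tail: "prob {\<omega> \<in> space L. R < \<bar>(\<Sum>n\<in>{1..k}. g n (step n \<omega>)) - m\<bar>}
      \<le> 1 / (4 * kurtosis_constant \<epsilon> K)"
  shows "\<exists>a. (\<forall>n\<in>{1..k+1}. bm1 n (a n) \<and> (\<forall>x\<in>space (S n). \<bar>a n x\<bar> \<le> 4 * K / \<epsilon>)) \<and>
    (\<Sum>n\<in>{1..k}. variance (\<lambda>\<omega>. g n (step n \<omega>) - (a (Suc n) (X (Suc n) \<omega>) - a n (X n \<omega>))))
      \<le> max 1 (2 * (R + 4 * K / \<epsilon>)\<^sup>2)"
proof -
  define pt where "pt n = (SOME x. x \<in> space (S n))" for n
  have pt: "pt n \<in> space (S n)" if "n \<in> {1..k+1}" for n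
    using S_not_empty[OF that] unfolding pt_def by (simp add: some_in_eq)
  \<comment> \<open>Subtraction at a reference point turns the oscillation bound into a supremum
    bound. The sign is reversed because \<open>increment\<close> adds the gradient of
    \<open>backward\<close> to \<open>g\<close>, while here it is moved to the other side.\<close>
  define a where "a n x = backward g n (pt n) - backward g n x" for n x
  define V where "V = (\<Sum>n\<in>{1..k}. energy (increment g) n)"
  have osc: "\<bar>a n x\<bar> \<le> 4 * K / \<epsilon>" if "n \<in> {1..k+1}" "x \<in> space (S n)" for n x
    using backward_oscillation[OF g_bm g_bound that(1) that(2) pt[OF that(1)]]
      backward_oscillation[OF g_bm g_bound that(1) pt[OF that(1)] that(2)]
    unfolding a_def abs_le_iff by simp
  have a_bm: "bm1 n (a n)" if "n \<in> {1..k+1}" for n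
    unfolding a_def[abs_def] by (intro bounded_measurable_intros bm1_backward g_bm that)
  have var: "variance (\<lambda>\<omega>. g n (step n \<omega>) - (a (Suc n) (X (Suc n) \<omega>) - a n (X n \<omega>)))
      = energy (increment g) n" if n: "n \<in> {1..k}" for n
  proof -
    define c where "c = backward g n (pt n) - backward g (Suc n) (pt (Suc n))"
    have eq: "g n (step n \<omega>) - (a (Suc n) (X (Suc n) \<omega>) - a n (X n \<omega>)) = increment g n (step n \<omega>) + c"
      for \<omega> by (simp add: a_def c_def increment_def)
    have "integrable L (\<lambda>\<omega>. increment g n (step n \<omega>))"
      by (intro bounded_measurable_integrable bm_step n bm2_increment g_bm)
    then show ?thesis
      unfolding eq using expectation_increment[OF n] by (simp add: energy_def prob_space)
  qed
  have "V \<le> max 1 (2 * (R + 4 * K / \<epsilon>)\<^sup>2)"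
  proof (cases "1 \<le> V")
    case True
    let ?P = "partial_sum (increment g) (Suc k)"
    \<comment> \<open>With this shift \<open>?P \<omega> - c\<close> differs from the sum centered
      at \<open>m\<close> only by \<open>a 1 (X 1 \<omega>)\<close>.\<close>
    define c where "c = m - backward g 1 (pt 1)"
    define W where "W \<omega> = (?P \<omega> - c)\<^sup>2" for \<omega>
    have one: "1 \<in> {1..k+1}" "Suc k \<in> {1..k+1}" using k_pos by auto
    have W: "bounded_measurable L W"
      unfolding W_def[abs_def]
      by (intro bounded_measurable_intros bm_F[OF one(2) bm_F_partial_sum] bm2_increment g_bm one)
    have K: "0 \<le> 4 * K / \<epsilon>" using osc[OF one(1) pt[OF one(1)]] by linarith
    have "W \<omega> \<le> (R + 4 * K / \<epsilon>)\<^sup>2"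
      if \<omega>: "\<omega> \<in> space L" "\<bar>(\<Sum>n\<in>{1..k}. g n (step n \<omega>)) - m\<bar> \<le> R" for \<omega>
    proof -
      have "?P \<omega> - c = ((\<Sum>n\<in>{1..k}. g n (step n \<omega>)) - m) + a 1 (X 1 \<omega>)"
        unfolding sum_eq_partial_sum_increment c_def a_def by simp
      then have "\<bar>?P \<omega> - c\<bar> \<le> R + 4 * K / \<epsilon>"
        using \<omega>(2) osc[OF one(1) X_space[OF one(1) \<omega>(1)]] by linarith
      then show ?thesis unfolding W_def by (metis abs_ge_zero power2_abs power_mono)
    qed
    then have sub: "{\<omega> \<in> space L. (R + 4 * K / \<epsilon>)\<^sup>2 < W \<omega>}
        \<subseteq> {\<omega> \<in> space L. R < \<bar>(\<Sum>n\<in>{1..k}. g n (step n \<omega>)) - m\<bar>}"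
      by (auto simp: not_le[symmetric])
    have "bounded_measurable L (\<lambda>\<omega>. \<Sum>n\<in>{1..k}. g n (step n \<omega>))"
      by (intro bounded_measurable_sum bm_step g_bm)
    then have [measurable]: "(\<lambda>\<omega>. \<Sum>n\<in>{1..k}. g n (step n \<omega>)) \<in> borel_measurable L"
      by (rule bounded_measurableD)
    have "prob {\<omega> \<in> space L. (R + 4 * K / \<epsilon>)\<^sup>2 < W \<omega>}
        \<le> prob {\<omega> \<in> space L. R < \<bar>(\<Sum>n\<in>{1..k}. g n (step n \<omega>)) - m\<bar>}"
      by (rule finite_measure_mono[OF sub]) measurable
    then have "expectation W \<le> 2 * (R + 4 * K / \<epsilon>)\<^sup>2"
      using tail fourth_moment_increments(1)[OF True[unfolded V_def], of c]
      by (intro expectation_le_of_small_tail[OF W _ kurtosis_constant_pos[of \<epsilon> K]])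
        (auto simp: W_def[abs_def])
    moreover have "V \<le> expectation W"
      using fourth_moment_increments(2)[OF True[unfolded V_def], of c] by (simp add: W_def[abs_def] V_def)
    ultimately show ?thesis by simp
  qed simp
  then show ?thesis
    using osc a_bm var by (intro exI[of _ a]) (auto simp: V_def)
qed

end

end

section \<open>The law of a row\<close>

lemma space_borel_of_metric: "space (borel_of_metric m) = mspace m"
  by (simp add: borel_of_metric_def space_measure_of_conv)

abbreviation path_space :: "'a array_data \<Rightarrow> nat \<Rightarrow> nat \<Rightarrow> (nat \<Rightarrow> 'a) measure" where
  "path_space X N n \<equiv> PiM {1..n} (borel_state X N)"

text \<open>The first \<open>n\<close> coordinates are pulled back to the full path space, since a
  subalgebra of \<open>row_law X N\<close> must live on the same space.\<close>

definition past :: "'a array_data \<Rightarrow> nat \<Rightarrow> nat \<Rightarrow> (nat \<Rightarrow> 'a) measure" where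
  "past X N n = vimage_algebra (space (path_space X N (len X N + 1)))
    (\<lambda>\<omega>. restrict \<omega> {1..n}) (path_space X N n)"

context
  fixes X :: "'a array_data" and N :: nat
  assumes X: "markov_array X"
begin

lemma kernel_in_prob_algebra:
  "n \<in> {1..len X N} \<Longrightarrow> kernel X N n \<in> borel_state X N n \<rightarrow>\<^sub>M prob_algebra (borel_state X N (Suc n))"
  using X unfolding markov_array_def by simp

lemma coordinate_measurable: "j \<in> {1..n} \<Longrightarrow> (\<lambda>\<omega>. \<omega> j) \<in> path_space X N n \<rightarrow>\<^sub>M borel_state X N j"
  by (rule measurable_component_singleton)

lemma extend_measurable:
  "(\<lambda>z. fun_upd (fst z) (Suc n) (snd z)) \<in> path_space X N n \<Otimes>\<^sub>M borel_state X N (Suc n) \<rightarrow>\<^sub>M path_space X N (Suc n)"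
  by (rule measurable_fun_upd[where J = "{1..n}"]) auto

lemma extension_kernel_measurable:
  assumes n: "n \<in> {1..len X N}"
  shows "(\<lambda>\<omega>. distr (kernel X N n (\<omega> n)) (path_space X N (Suc n)) (\<lambda>y. (fun_upd \<omega> (Suc n) y)))
    \<in> path_space X N n \<rightarrow>\<^sub>M prob_algebra (path_space X N (Suc n))"
proof (rule measurable_distr_prob_space2)
  show "(\<lambda>\<omega>. kernel X N n (\<omega> n)) \<in> path_space X N n \<rightarrow>\<^sub>M prob_algebra (borel_state X N (Suc n))"
    using n by (intro measurable_compose[OF coordinate_measurable kernel_in_prob_algebra]) auto
  show "(\<lambda>(\<omega>, y). (fun_upd \<omega> (Suc n) y)) \<in> path_space X N n \<Otimes>\<^sub>M borel_state X N (Suc n) \<rightarrow>\<^sub>M path_space X N (Suc n)"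
    using extend_measurable[of n] by (simp add: case_prod_unfold)
qed

lemma path_law_Suc: "path_law X N (Suc n) = path_law X N n \<bind>
    (\<lambda>\<omega>. distr (kernel X N (Suc n) (\<omega> (Suc n))) (path_space X N (Suc (Suc n))) (\<lambda>y. (fun_upd \<omega> (Suc (Suc n)) y)))"
  by simp

lemma path_law_in_prob_algebra:
  "n \<le> len X N \<Longrightarrow> path_law X N n \<in> space (prob_algebra (path_space X N (Suc n)))"
proof (induction n)
  case 0
  have "init X N \<in> space (prob_algebra (borel_state X N 1))"
    using X unfolding markov_array_def by simp
  moreover have "(\<lambda>x. \<lambda>i\<in>{1..1}. x) \<in> borel_state X N 1 \<rightarrow>\<^sub>M PiM {1..1} (borel_state X N)"
    by (rule measurable_restrict) simp
  ultimately show ?case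
    by (auto simp: space_prob_algebra intro!: prob_space.prob_space_distr cong: measurable_cong_sets)
next
  case (Suc n)
  then have "Suc n \<in> {1..len X N}" by simp
  note K = extension_kernel_measurable[OF this]
  show ?case
    unfolding space_prob_algebra path_law_Suc
    using prob_space_bind'[OF _ K] sets_bind'[OF _ K] Suc by simp
qed

lemma path_law_prob:
  assumes "n \<le> len X N"
  shows "prob_space (path_law X N n)" "sets (path_law X N n) = sets (path_space X N (Suc n))"
    "space (path_law X N n) = space (path_space X N (Suc n))"
  using path_law_in_prob_algebra[OF assms] by (auto simp: space_prob_algebra dest: sets_eq_imp_space_eq)

lemma extend_section_measurable:
  assumes "\<omega> \<in> space (path_space X N n)"
  shows "(\<lambda>y. (fun_upd \<omega> (Suc n) y)) \<in> borel_state X N (Suc n) \<rightarrow>\<^sub>M path_space X N (Suc n)"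
  using measurable_compose[OF measurable_Pair1'[OF assms] extend_measurable] by simp

text \<open>Unfolds one bind into an iterated integral. The index of a path law is one less than its
  number of states, so the newly attached coordinate is \<open>Suc (Suc n)\<close>.\<close>

lemma integral_path_law_Suc:
  assumes n: "Suc n \<le> len X N" and G: "bounded_measurable (path_space X N (Suc (Suc n))) G"
  shows "(\<integral>\<omega>. G \<omega> \<partial>path_law X N (Suc n))
    = (\<integral>\<omega>. (\<integral>y. G ((fun_upd \<omega> (Suc (Suc n)) y)) \<partial>kernel X N (Suc n) (\<omega> (Suc n))) \<partial>path_law X N n)"
proof -
  have n': "Suc n \<in> {1..len X N}" "n \<le> len X N" using n by auto
  interpret P: prob_space "path_law X N n" by (rule path_law_prob[OF n'(2)])
  let ?K = "\<lambda>\<omega>. distr (kernel X N (Suc n) (\<omega> (Suc n))) (path_space X N (Suc (Suc n)))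
    (\<lambda>y. (fun_upd \<omega> (Suc (Suc n)) y))"
  have K: "?K \<in> path_law X N n \<rightarrow>\<^sub>M prob_algebra (path_space X N (Suc (Suc n)))"
    using extension_kernel_measurable[OF n'(1)] path_law_prob(2)[OF n'(2)]
    by (simp cong: measurable_cong_sets)
  obtain B where B: "\<And>\<omega>. \<omega> \<in> space (path_space X N (Suc (Suc n))) \<Longrightarrow> \<bar>G \<omega>\<bar> \<le> B"
    using G by (metis bounded_measurableE)
  have "(\<integral>\<omega>. G \<omega> \<partial>path_law X N (Suc n)) = (\<integral>\<omega>. (\<integral>\<xi>. G \<xi> \<partial>?K \<omega>) \<partial>path_law X N n)"
    unfolding path_law_Suc
  proof (rule integral_bind[OF bounded_measurableD[OF G] B measurable_prob_algebraD[OF K]])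
    show "AE \<omega> in path_law X N n. emeasure (?K \<omega>) (space (?K \<omega>)) \<le> ennreal 1"
    proof (rule AE_I2)
      fix \<omega> assume "\<omega> \<in> space (path_law X N n)"
      from measurable_space[OF K this] interpret K: prob_space "?K \<omega>"
        by (simp add: space_prob_algebra)
      show "emeasure (?K \<omega>) (space (?K \<omega>)) \<le> ennreal 1"
        using K.emeasure_space_1 by simp
    qed
  qed (auto intro: P.finite_measure_axioms)
  also have "\<dots> = (\<integral>\<omega>. (\<integral>y. G ((fun_upd \<omega> (Suc (Suc n)) y)) \<partial>kernel X N (Suc n) (\<omega> (Suc n))) \<partial>path_law X N n)"
  proof (rule Bochner_Integration.integral_cong[OF refl])
    fix \<omega> assume "\<omega> \<in> space (path_law X N n)"
    then have \<omega>: "\<omega> \<in> space (path_space X N (Suc n))" using path_law_prob(3)[OF n'(2)] by simp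
    have "\<omega> (Suc n) \<in> space (borel_state X N (Suc n))"
      by (rule measurable_space[OF coordinate_measurable \<omega>]) simp
    from measurable_space[OF kernel_in_prob_algebra[OF n'(1)] this]
    have "sets (kernel X N (Suc n) (\<omega> (Suc n))) = sets (borel_state X N (Suc (Suc n)))"
      by (simp add: space_prob_algebra)
    then show "(\<integral>\<xi>. G \<xi> \<partial>?K \<omega>) = (\<integral>y. G ((fun_upd \<omega> (Suc (Suc n)) y)) \<partial>kernel X N (Suc n) (\<omega> (Suc n)))"
      using extend_section_measurable[OF \<omega>] bounded_measurableD[OF G]
      by (intro integral_distr) (auto cong: measurable_cong_sets)
  qed
  finally show ?thesis .
qed

lemma restrict_path_measurable:
  "m \<le> n \<Longrightarrow> (\<lambda>\<omega>. restrict \<omega> {1..m}) \<in> path_space X N n \<rightarrow>\<^sub>M path_space X N m"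
  by (rule measurable_restrict_subset) auto

text \<open>The kernels are probability measures, so integrating out later states changes nothing:
  the path laws form a projective family.\<close>

lemma integral_path_law_restrict:
  assumes "n \<le> m" "m \<le> len X N" and G: "bounded_measurable (path_space X N (Suc n)) G"
  shows "(\<integral>\<omega>. G (restrict \<omega> {1..Suc n}) \<partial>path_law X N m) = (\<integral>\<omega>. G \<omega> \<partial>path_law X N n)"
  using assms(1,2)
proof (induction m rule: dec_induct)
  case base
  then show ?case
    using path_law_prob(3)[OF base]
    by (intro Bochner_Integration.integral_cong) (auto simp: space_PiM PiE_restrict)
next
  case (step m)
  then have m: "Suc m \<in> {1..len X N}" "m \<le> len X N" by auto
  have G': "bounded_measurable (path_space X N (Suc (Suc m))) (\<lambda>\<omega>. G (restrict \<omega> {1..Suc n}))"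
    using step.hyps by (intro bounded_measurable_compose[OF restrict_path_measurable G]) auto
  have "(\<integral>\<omega>. G (restrict \<omega> {1..Suc n}) \<partial>path_law X N (Suc m))
     = (\<integral>\<omega>. (\<integral>y. G (restrict ((fun_upd \<omega> (Suc (Suc m)) y)) {1..Suc n}) \<partial>kernel X N (Suc m) (\<omega> (Suc m))) \<partial>path_law X N m)"
    by (rule integral_path_law_Suc[OF step.prems G'])
  also have "\<dots> = (\<integral>\<omega>. G (restrict \<omega> {1..Suc n}) \<partial>path_law X N m)"
  proof (rule Bochner_Integration.integral_cong[OF refl])
    fix \<omega> assume "\<omega> \<in> space (path_law X N m)"
    then have \<omega>: "\<omega> \<in> space (path_space X N (Suc m))" using path_law_prob(3)[OF m(2)] by simp
    have "\<omega> (Suc m) \<in> space (borel_state X N (Suc m))"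
      by (rule measurable_space[OF coordinate_measurable \<omega>]) simp
    from measurable_space[OF kernel_in_prob_algebra[OF m(1)] this]
    interpret K: prob_space "kernel X N (Suc m) (\<omega> (Suc m))" by (simp add: space_prob_algebra)
    have "restrict ((fun_upd \<omega> (Suc (Suc m)) y)) {1..Suc n} = restrict \<omega> {1..Suc n}" for y
      using step.hyps by (auto simp: restrict_def fun_eq_iff)
    then show "(\<integral>y. G (restrict ((fun_upd \<omega> (Suc (Suc m)) y)) {1..Suc n}) \<partial>kernel X N (Suc m) (\<omega> (Suc m)))
        = G (restrict \<omega> {1..Suc n})"
      by (simp add: K.prob_space)
  qed
  also have "\<dots> = (\<integral>\<omega>. G \<omega> \<partial>path_law X N n)" by (rule step.IH[OF m(2)])
  finally show ?case .
qed

lemma row_law_prob: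
  "prob_space (row_law X N)" "sets (row_law X N) = sets (path_space X N (len X N + 1))"
  "space (row_law X N) = space (path_space X N (len X N + 1))"
  unfolding row_law_def using path_law_prob[of "len X N"] by auto

lemma past_subalgebra:
  assumes n: "n \<in> {1..len X N + 1}"
  shows "subalgebra (row_law X N) (past X N n)"
proof -
  have "sets (past X N n) \<subseteq> sets (path_space X N (len X N + 1))"
    using n measurable_sets[OF restrict_path_measurable[of n "len X N + 1"]]
      measurable_space[OF restrict_path_measurable[of n "len X N + 1"]]
    unfolding past_def by (subst sets_vimage_algebra2) auto
  then show ?thesis
    unfolding subalgebra_def row_law_prob by (simp add: past_def)
qed

lemma coordinate_past_measurable:
  assumes "1 \<le> j" "j \<le> n" "n \<le> len X N + 1"
  shows "(\<lambda>\<omega>. \<omega> j) \<in> past X N n \<rightarrow>\<^sub>M borel_state X N j"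
proof -
  have "(\<lambda>\<omega>. restrict \<omega> {1..n}) \<in> past X N n \<rightarrow>\<^sub>M path_space X N n"
    unfolding past_def using measurable_space[OF restrict_path_measurable[OF assms(3)]]
    by (intro measurable_vimage_algebra1) auto
  from measurable_compose[OF this coordinate_measurable, of j] show ?thesis
    using assms by simp
qed

text \<open>A past event is a cylinder over a set \<open>C\<close> of initial paths, so both sides
  integrate functions of the first \<open>Suc n\<close> coordinates. By projectivity the left side
  moves to the law of the first \<open>Suc n\<close> states, where the state \<open>Suc n\<close> is
  the one attached last and can be integrated out explicitly.\<close>

lemma row_law_markov:
  assumes n: "n \<in> {1..len X N}" and A: "A \<in> sets (past X N n)"
    and \<phi>: "bounded_measurable (borel_state X N n \<Otimes>\<^sub>M borel_state X N (Suc n)) \<phi>"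
  shows "(\<integral>\<omega>. indicator A \<omega> * \<phi> (\<omega> n, \<omega> (Suc n)) \<partial>row_law X N)
    = (\<integral>\<omega>. indicator A \<omega> * (\<integral>y. \<phi> (\<omega> n, y) \<partial>kernel X N n (\<omega> n)) \<partial>row_law X N)"
proof -
  \<comment> \<open>\<open>path_law X N m\<close> is the law of the first \<open>n\<close> states,
    the one on which the transition out of \<open>n\<close> acts.\<close>
  obtain m where m: "n = Suc m" "Suc m \<le> len X N" "m \<le> len X N" using n by (cases n) auto
  obtain C where C: "C \<in> sets (path_space X N n)"
    "A = (\<lambda>\<omega>. restrict \<omega> {1..n}) -` C \<inter> space (path_space X N (len X N + 1))"
    using A measurable_space[OF restrict_path_measurable[of n "len X N + 1"]] n
    unfolding past_def by (subst (asm) sets_vimage_algebra2) auto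
  have ind: "(indicator A \<omega> :: real) = indicator C (restrict \<omega> {1..n})"
    if "\<omega> \<in> space (row_law X N)" for \<omega>
    using that C(2) row_law_prob(3) by (simp add: indicator_def)
  define G where "G \<omega> = indicator C (restrict \<omega> {1..n}) * \<phi> (\<omega> n, \<omega> (Suc n))" for \<omega>
  define H where "H \<omega> = indicator C \<omega> * (\<integral>y. \<phi> (\<omega> n, y) \<partial>kernel X N n (\<omega> n))" for \<omega>
  have pair: "(\<lambda>\<omega>. (\<omega> n, \<omega> (Suc n))) \<in> path_space X N (Suc n) \<rightarrow>\<^sub>M borel_state X N n \<Otimes>\<^sub>M borel_state X N (Suc n)"
    using n by (intro measurable_Pair coordinate_measurable) auto
  have G: "bounded_measurable (path_space X N (Suc n)) G"
    unfolding G_def[abs_def]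
    by (intro bounded_measurable_mult bounded_measurable_compose[OF restrict_path_measurable]
        bounded_measurable_indicator C bounded_measurable_compose[OF pair \<phi>]) simp
  have H: "bounded_measurable (path_space X N n) H"
  proof -
    obtain B where B: "\<And>z. z \<in> space (borel_state X N n \<Otimes>\<^sub>M borel_state X N (Suc n)) \<Longrightarrow> \<bar>\<phi> z\<bar> \<le> B"
      using \<phi> by (metis bounded_measurableE)
    have "bounded_measurable (borel_state X N n) (\<lambda>x. \<integral>y. \<phi> (x, y) \<partial>kernel X N n x)"
    proof (rule bounded_measurableI[where B = B])
      show "(\<lambda>x. \<integral>y. \<phi> (x, y) \<partial>kernel X N n x) \<in> borel_measurable (borel_state X N n)"
        by (rule integral_measurable_kernel[OF bounded_measurableD[OF \<phi>]
              measurable_prob_algebraD[OF kernel_in_prob_algebra[OF n]]])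
      fix x assume x: "x \<in> space (borel_state X N n)"
      from measurable_space[OF kernel_in_prob_algebra[OF n] x]
      have K: "prob_space (kernel X N n x)" "sets (kernel X N n x) = sets (borel_state X N (Suc n))"
        by (auto simp: space_prob_algebra)
      interpret K: prob_space "kernel X N n x" by (rule K)
      have b: "bounded_measurable (kernel X N n x) (\<lambda>y. \<phi> (x, y))"
        by (rule bounded_measurable_compose[OF _ \<phi>])
          (use K(2) x in \<open>simp cong: measurable_cong_sets\<close>)
      have "- B \<le> \<phi> (x, y) \<and> \<phi> (x, y) \<le> B" if "y \<in> space (kernel X N n x)" for y
        using B[of "(x, y)"] that x sets_eq_imp_space_eq[OF K(2)]
        by (auto simp: space_pair_measure abs_le_iff)
      from K.bounded_measurable_integral_bounds[OF b this]
      show "\<bar>\<integral>y. \<phi> (x, y) \<partial>kernel X N n x\<bar> \<le> B" by (simp add: abs_le_iff)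
    qed
    then show ?thesis
      unfolding H_def[abs_def] using n
      by (intro bounded_measurable_mult bounded_measurable_indicator C
          bounded_measurable_compose[OF coordinate_measurable]) auto
  qed
  have "(\<integral>\<omega>. indicator A \<omega> * \<phi> (\<omega> n, \<omega> (Suc n)) \<partial>row_law X N)
      = (\<integral>\<omega>. G (restrict \<omega> {1..Suc n}) \<partial>row_law X N)"
    using n by (intro Bochner_Integration.integral_cong) (auto simp: G_def ind restrict_restrict Int_absorb1)
  also have "\<dots> = (\<integral>\<omega>. G \<omega> \<partial>path_law X N n)"
    unfolding row_law_def using n by (intro integral_path_law_restrict G) auto
  also have "\<dots> = (\<integral>\<omega>. (\<integral>y. G ((fun_upd \<omega> (Suc n) y)) \<partial>kernel X N n (\<omega> n)) \<partial>path_law X N m)"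
    using integral_path_law_Suc[OF m(2) G[unfolded m(1)]] m(1) by simp
  also have "\<dots> = (\<integral>\<omega>. H \<omega> \<partial>path_law X N m)"
  proof (rule Bochner_Integration.integral_cong[OF refl])
    fix \<omega> assume "\<omega> \<in> space (path_law X N m)"
    then have \<omega>: "\<omega> \<in> space (path_space X N n)" using path_law_prob(3)[OF m(3)] m(1) by simp
    have "restrict ((fun_upd \<omega> (Suc n) y)) {1..n} = \<omega>" for y
      using \<omega> by (auto simp: space_PiM PiE_def extensional_def restrict_def fun_eq_iff)
    then show "(\<integral>y. G ((fun_upd \<omega> (Suc n) y)) \<partial>kernel X N n (\<omega> n)) = H \<omega>"
      using n by (simp add: G_def H_def)
  qed
  also have "\<dots> = (\<integral>\<omega>. H (restrict \<omega> {1..n}) \<partial>row_law X N)"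
    unfolding row_law_def using integral_path_law_restrict[OF m(3) order_refl H[unfolded m(1)]] m(1) by simp
  also have "\<dots> = (\<integral>\<omega>. indicator A \<omega> * (\<integral>y. \<phi> (\<omega> n, y) \<partial>kernel X N n (\<omega> n)) \<partial>row_law X N)"
    using n by (intro Bochner_Integration.integral_cong) (auto simp: H_def ind)
  finally show ?thesis .
qed

end

section \<open>From transition densities to integral inequalities\<close>

lemma density_integral_bounds:
  fixes q u :: "'b \<Rightarrow> real"
  assumes "prob_space \<nu>" and q: "q \<in> borel_measurable \<nu>" "\<And>y. y \<in> space \<nu> \<Longrightarrow> 0 \<le> q y \<and> q y \<le> c"
    and u: "bounded_measurable \<nu> u"
  shows "(\<integral>y. u y \<partial>density \<nu> (\<lambda>y. ennreal (q y))) = (\<integral>y. q y * u y \<partial>\<nu>)"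
    and "(\<And>y. y \<in> space \<nu> \<Longrightarrow> 0 \<le> u y) \<Longrightarrow> (\<integral>y. q y * u y \<partial>\<nu>) \<le> c * (\<integral>y. u y \<partial>\<nu>)"
proof -
  interpret prob_space \<nu> by fact
  have qb: "bounded_measurable \<nu> q"
    using q by (intro bounded_measurableI[where B = c]) auto
  show "(\<integral>y. u y \<partial>density \<nu> (\<lambda>y. ennreal (q y))) = (\<integral>y. q y * u y \<partial>\<nu>)"
    using integral_density[of u \<nu> q] q bounded_measurableD[OF u] by (auto intro!: AE_I2)
  assume nn: "\<And>y. y \<in> space \<nu> \<Longrightarrow> 0 \<le> u y"
  have "(\<integral>y. q y * u y \<partial>\<nu>) \<le> (\<integral>y. c * u y \<partial>\<nu>)"
    using q nn
    by (intro integral_mono bounded_measurable_integrable bounded_measurable_intros qb u mult_right_mono) auto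
  then show "(\<integral>y. q y * u y \<partial>\<nu>) \<le> c * (\<integral>y. u y \<partial>\<nu>)" by simp
qed

text \<open>A single \<epsilon> serves every row; this is what makes the constants derived in
  \<open>elliptic_chain\<close> uniform over the array.\<close>

lemma uniformly_elliptic_chain:
  assumes X: "markov_array X" and "uniformly_elliptic X"
  obtains \<epsilon> :: real and \<mu> where
    "\<And>N. elliptic_chain (row_law X N) (len X N) (past X N) (borel_state X N) (\<lambda>n \<omega>. \<omega> n) (kernel X N) (\<mu> N) \<epsilon>"
proof -
  from assms(2) obtain \<epsilon> :: real and \<mu> and p :: "nat \<Rightarrow> nat \<Rightarrow> 'a \<Rightarrow> 'a \<Rightarrow> real" where
    eps: "0 < \<epsilon>" "\<epsilon> < 1"
    and \<mu>: "\<And>N n. n \<in> {1..len X N + 1} \<Longrightarrow> \<mu> N n \<in> space (prob_algebra (borel_state X N n))"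
    and p_meas: "\<And>N n. n \<in> {1..len X N} \<Longrightarrow>
      case_prod (p N n) \<in> borel_measurable (borel_state X N n \<Otimes>\<^sub>M borel_state X N (Suc n))"
    and p_kernel: "\<And>N n x. n \<in> {1..len X N} \<Longrightarrow> x \<in> points X N n \<Longrightarrow>
      kernel X N n x = density (\<mu> N (Suc n)) (\<lambda>y. ennreal (p N n x y))"
    and p_bound: "\<And>N n x y. n \<in> {1..len X N} \<Longrightarrow> x \<in> points X N n \<Longrightarrow> y \<in> points X N (Suc n) \<Longrightarrow>
      0 \<le> p N n x y \<and> p N n x y \<le> 1 / \<epsilon>"
    and p_lower: "\<And>N n x z. 1 \<le> n \<Longrightarrow> n + 1 \<le> len X N \<Longrightarrow> x \<in> points X N n \<Longrightarrow> z \<in> points X N (Suc (Suc n)) \<Longrightarrow>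
      \<epsilon> < (\<integral>y. p N n x y * p N (Suc n) y z \<partial>\<mu> N (Suc n))"
    unfolding uniformly_elliptic_def Suc_eq_plus1[symmetric] add_2_eq_Suc'
  proof (elim exE conjE, goal_cases)
    case (1 \<epsilon> \<mu> p)
    show ?case by (rule 1(1)[of \<epsilon> \<mu> p]) (use 1(2-) in auto)
  qed
  have \<mu>_prob: "prob_space (\<mu> N n)" "sets (\<mu> N n) = sets (borel_state X N n)" "space (\<mu> N n) = points X N n"
    if "n \<in> {1..len X N + 1}" for N n
    using \<mu>[OF that] by (auto simp: space_prob_algebra space_borel_of_metric dest: sets_eq_imp_space_eq)
  have \<mu>_bm: "bounded_measurable (\<mu> N n) u" if "n \<in> {1..len X N + 1}" "bounded_measurable (borel_state X N n) u" for N n u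
    using that(2) \<mu>_prob[OF that(1)]
    by (auto simp: bounded_measurable_def space_borel_of_metric cong: measurable_cong_sets)
  have p_section: "p N n x \<in> borel_measurable (\<mu> N (Suc n))"
    if "n \<in> {1..len X N}" "x \<in> points X N n" for N n x
  proof -
    have "Suc n \<in> {1..len X N + 1}" using that by auto
    from \<mu>_prob(2)[OF this] show ?thesis
      using measurable_compose[OF measurable_Pair1' p_meas[OF that(1)], of x] that
      by (simp add: space_borel_of_metric cong: measurable_cong_sets)
  qed
  have kernel_integral: "(\<integral>y. u y \<partial>kernel X N n x) = (\<integral>y. p N n x y * u y \<partial>\<mu> N (Suc n))"
      "(\<And>y. y \<in> points X N (Suc n) \<Longrightarrow> 0 \<le> u y) \<Longrightarrow>
        (\<integral>y. p N n x y * u y \<partial>\<mu> N (Suc n)) \<le> 1 / \<epsilon> * (\<integral>y. u y \<partial>\<mu> N (Suc n))"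
    if n: "n \<in> {1..len X N}" and u: "bounded_measurable (borel_state X N (Suc n)) u" and x: "x \<in> points X N n"
    for N n u x
  proof -
    have n': "Suc n \<in> {1..len X N + 1}" using n by auto
    note d = density_integral_bounds[OF \<mu>_prob(1)[OF n'] p_section[OF n x] _ \<mu>_bm[OF n' u], of "1 / \<epsilon>"]
    show "(\<integral>y. u y \<partial>kernel X N n x) = (\<integral>y. p N n x y * u y \<partial>\<mu> N (Suc n))"
      unfolding p_kernel[OF n x] using d(1) p_bound[OF n x] \<mu>_prob(3)[OF n'] by simp
    show "(\<integral>y. p N n x y * u y \<partial>\<mu> N (Suc n)) \<le> 1 / \<epsilon> * (\<integral>y. u y \<partial>\<mu> N (Suc n))"
      if "\<And>y. y \<in> points X N (Suc n) \<Longrightarrow> 0 \<le> u y"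
      using d(2) p_bound[OF n x] \<mu>_prob(3)[OF n'] that by simp
  qed
  have "elliptic_chain (row_law X N) (len X N) (past X N) (borel_state X N) (\<lambda>n \<omega>. \<omega> n) (kernel X N) (\<mu> N) \<epsilon>" for N
  proof (intro elliptic_chain.intro elliptic_chain_axioms.intro)
    show "prob_space (row_law X N)" by (rule row_law_prob[OF X])
    show "1 \<le> len X N" using X by (simp add: markov_array_def)
    show "subalgebra (row_law X N) (past X N n)" if "n \<in> {1..len X N + 1}" for n
      by (rule past_subalgebra[OF X that])
    show "(\<lambda>\<omega>. \<omega> j) \<in> past X N n \<rightarrow>\<^sub>M borel_state X N j" if "1 \<le> j" "j \<le> n" "n \<le> len X N + 1" for j n
      by (rule coordinate_past_measurable[OF X that])
    show "kernel X N n \<in> borel_state X N n \<rightarrow>\<^sub>M prob_algebra (borel_state X N (Suc n))" if "n \<in> {1..len X N}" for n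
      by (rule kernel_in_prob_algebra[OF X that])
    show "(\<integral>\<omega>. indicator A \<omega> * \<phi> (\<omega> n, \<omega> (Suc n)) \<partial>row_law X N)
        = (\<integral>\<omega>. indicator A \<omega> * (\<integral>y. \<phi> (\<omega> n, y) \<partial>kernel X N n (\<omega> n)) \<partial>row_law X N)"
      if "n \<in> {1..len X N}" "A \<in> sets (past X N n)"
        "bounded_measurable (borel_state X N n \<Otimes>\<^sub>M borel_state X N (Suc n)) \<phi>" for n A \<phi>
      by (rule row_law_markov[OF X that])
    show "0 < \<epsilon>" "\<epsilon> < 1" by fact+
    show "\<mu> N n \<in> space (prob_algebra (borel_state X N n))" if "n \<in> {1..len X N + 1}" for n
      by (rule \<mu>[OF that])
    show "(\<integral>y. u y \<partial>kernel X N n x) \<le> (\<integral>y. u y \<partial>\<mu> N (Suc n)) / \<epsilon>"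
      if "n \<in> {1..len X N}" "bounded_measurable (borel_state X N (Suc n)) u"
        "\<And>y. y \<in> space (borel_state X N (Suc n)) \<Longrightarrow> 0 \<le> u y" "x \<in> space (borel_state X N n)" for n u x
      using kernel_integral[OF that(1,2), of x] that(3,4) by (simp add: space_borel_of_metric)
    show "\<epsilon> * (\<integral>z. u z \<partial>\<mu> N (Suc (Suc n))) \<le> (\<integral>y. (\<integral>z. u z \<partial>kernel X N (Suc n) y) \<partial>kernel X N n x)"
      if n: "n \<in> {1..<len X N}" and u: "bounded_measurable (borel_state X N (Suc (Suc n))) u"
        and nn: "\<And>z. z \<in> space (borel_state X N (Suc (Suc n))) \<Longrightarrow> 0 \<le> u z"
        and x: "x \<in> space (borel_state X N n)" for n u x
    proof -
      have n1: "n \<in> {1..len X N}" "Suc n \<in> {1..len X N}" "Suc n \<in> {1..len X N + 1}"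
        "Suc (Suc n) \<in> {1..len X N + 1}" using n by auto
      have x': "x \<in> points X N n" using x by (simp add: space_borel_of_metric)
      let ?\<mu>1 = "\<mu> N (Suc n)" and ?\<mu>2 = "\<mu> N (Suc (Suc n))"
      interpret M1: prob_space ?\<mu>1 by (rule \<mu>_prob[OF n1(3)])
      interpret M2: prob_space ?\<mu>2 by (rule \<mu>_prob[OF n1(4)])
      interpret M12: pair_prob_space ?\<mu>1 ?\<mu>2 ..
      note sp = \<mu>_prob(3)[OF n1(3)] \<mu>_prob(3)[OF n1(4)]
      have q: "bounded_measurable (?\<mu>1 \<Otimes>\<^sub>M ?\<mu>2) (\<lambda>z. p N n x (fst z))"
        using p_bound[OF n1(1) x'] p_section[OF n1(1) x'] sp
        by (intro bounded_measurable_compose[OF measurable_fst] bounded_measurableI[where B = "1 / \<epsilon>"])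
          auto
      have r: "bounded_measurable (?\<mu>1 \<Otimes>\<^sub>M ?\<mu>2) (\<lambda>z. p N (Suc n) (fst z) (snd z))"
      proof (rule bounded_measurableI[where B = "1 / \<epsilon>"])
        have "sets (?\<mu>1 \<Otimes>\<^sub>M ?\<mu>2) = sets (borel_state X N (Suc n) \<Otimes>\<^sub>M borel_state X N (Suc (Suc n)))"
          by (intro sets_pair_measure_cong \<mu>_prob n1)
        then show "(\<lambda>z. p N (Suc n) (fst z) (snd z)) \<in> borel_measurable (?\<mu>1 \<Otimes>\<^sub>M ?\<mu>2)"
          using p_meas[OF n1(2)] by (simp add: case_prod_unfold cong: measurable_cong_sets)
        show "\<bar>p N (Suc n) (fst z) (snd z)\<bar> \<le> 1 / \<epsilon>" if "z \<in> space (?\<mu>1 \<Otimes>\<^sub>M ?\<mu>2)" for z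
          using p_bound[OF n1(2), of "fst z" "snd z"] that sp by (auto simp: space_pair_measure)
      qed
      have w: "bounded_measurable (?\<mu>1 \<Otimes>\<^sub>M ?\<mu>2) (\<lambda>z. u (snd z))"
        by (rule bounded_measurable_compose[OF measurable_snd \<mu>_bm[OF n1(4) u]])
      \<comment> \<open>Fubini is applied to \<open>h\<close>: integrating the middle state
        \<open>y\<close> first produces the two-step density, which exceeds \<epsilon>, while
        integrating \<open>z\<close> first produces the iterated kernels.\<close>
      define h where "h = (\<lambda>y z. p N n x y * p N (Suc n) y z * u z)"
      have h_int: "integrable (?\<mu>1 \<Otimes>\<^sub>M ?\<mu>2) (case_prod h)"
        unfolding h_def case_prod_unfold
        by (intro M12.bounded_measurable_integrable bounded_measurable_mult q r w)
      have inner: "bounded_measurable (borel_state X N (Suc n)) (\<lambda>y. \<integral>z. u z \<partial>kernel X N (Suc n) y)"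
      proof -
        obtain B where B: "0 \<le> B" "\<And>z. z \<in> space (borel_state X N (Suc (Suc n))) \<Longrightarrow> \<bar>u z\<bar> \<le> B"
          using u by (metis bounded_measurableE)
        show ?thesis
        proof (rule bounded_measurableI[where B = B])
          show "(\<lambda>y. \<integral>z. u z \<partial>kernel X N (Suc n) y) \<in> borel_measurable (borel_state X N (Suc n))"
            by (rule measurable_compose[OF measurable_prob_algebraD[OF kernel_in_prob_algebra[OF X n1(2)]]
                  integral_measurable_subprob_algebra[OF bounded_measurableD[OF u]]])
          fix y assume y: "y \<in> space (borel_state X N (Suc n))"
          from measurable_space[OF kernel_in_prob_algebra[OF X n1(2)] y]
          have K: "prob_space (kernel X N (Suc n) y)"
            "sets (kernel X N (Suc n) y) = sets (borel_state X N (Suc (Suc n)))"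
            by (auto simp: space_prob_algebra)
          interpret K: prob_space "kernel X N (Suc n) y" by (rule K)
          have b: "bounded_measurable (kernel X N (Suc n) y) u"
            using u K(2) sets_eq_imp_space_eq[OF K(2)]
            by (simp add: bounded_measurable_def cong: measurable_cong_sets)
          have "- B \<le> u z \<and> u z \<le> B" if "z \<in> space (kernel X N (Suc n) y)" for z
            using B(2)[of z] that sets_eq_imp_space_eq[OF K(2)] by (auto simp: abs_le_iff)
          from K.bounded_measurable_integral_bounds[OF b this]
          show "\<bar>\<integral>z. u z \<partial>kernel X N (Suc n) y\<bar> \<le> B" by (simp add: abs_le_iff)
        qed
      qed
      have "\<epsilon> * (\<integral>z. u z \<partial>?\<mu>2) = (\<integral>z. \<epsilon> * u z \<partial>?\<mu>2)" by simp
      also have "\<dots> \<le> (\<integral>z. (\<integral>y. h y z \<partial>?\<mu>1) \<partial>?\<mu>2)"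
      proof (rule integral_mono)
        show "integrable ?\<mu>2 (\<lambda>z. \<epsilon> * u z)"
          by (intro M2.bounded_measurable_integrable bounded_measurable_intros \<mu>_bm[OF n1(4) u])
        show "integrable ?\<mu>2 (\<lambda>z. \<integral>y. h y z \<partial>?\<mu>1)"
          by (rule M12.integrable_snd[OF h_int])
        show "\<epsilon> * u z \<le> (\<integral>y. h y z \<partial>?\<mu>1)" if "z \<in> space ?\<mu>2" for z
        proof -
          have "\<epsilon> * u z \<le> (\<integral>y. p N n x y * p N (Suc n) y z \<partial>?\<mu>1) * u z"
            using p_lower[of n N x z] n x' that sp nn[of z]
            by (intro mult_right_mono) (auto simp: space_borel_of_metric)
          then show ?thesis by (simp add: h_def)
        qed
      qed
      also have "\<dots> = (\<integral>y. (\<integral>z. h y z \<partial>?\<mu>2) \<partial>?\<mu>1)"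
        by (rule M12.Fubini_integral[OF h_int])
      also have "\<dots> = (\<integral>y. p N n x y * (\<integral>z. u z \<partial>kernel X N (Suc n) y) \<partial>?\<mu>1)"
        using kernel_integral(1)[OF n1(2) u] sp
        by (intro Bochner_Integration.integral_cong) (auto simp: h_def mult.assoc)
      also have "\<dots> = (\<integral>y. (\<integral>z. u z \<partial>kernel X N (Suc n) y) \<partial>kernel X N n x)"
        by (rule kernel_integral(1)[OF n1(1) inner x', symmetric])
      finally show ?thesis .
    qed
  qed
  then show ?thesis by (rule that)
qed

section \<open>Additive functionals on Markov arrays\<close>

definition truncate :: "real \<Rightarrow> real \<Rightarrow> real" where
  "truncate K v = max (- K) (min K v)"

lemma truncate_bound: "0 \<le> K \<Longrightarrow> \<bar>truncate K v\<bar> \<le> K"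
  unfolding truncate_def by auto

lemma truncate_eq: "\<bar>v\<bar> \<le> K \<Longrightarrow> truncate K v = v"
  unfolding truncate_def by auto

lemma bounded_measurable_truncate:
  assumes "0 \<le> K" "u \<in> borel_measurable M"
  shows "bounded_measurable M (\<lambda>z. truncate K (u z))"
  using assms truncate_bound by (intro bounded_measurableI[where B = K]) (auto simp: truncate_def)

lemma (in prob_space) variance_cong_AE:
  fixes Y Z :: "'a \<Rightarrow> real"
  assumes "Y \<in> borel_measurable M" "Z \<in> borel_measurable M" "AE x in M. Y x = Z x"
  shows "variance Y = variance Z"
proof -
  have e: "expectation Y = expectation Z" by (rule integral_cong_AE[OF assms])
  show ?thesis unfolding e using assms by (intro integral_cong_AE) auto
qed

lemma (in prob_space) variance_le_second_moment:
  fixes Y :: "'a \<Rightarrow> real"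
  assumes "bounded_measurable M Y"
  shows "variance Y \<le> expectation (\<lambda>x. (Y x - c)\<^sup>2)"
proof -
  note i = bounded_measurable_integrable[OF assms]
    bounded_measurable_integrable[OF bounded_measurable_power[OF assms, of 2]]
  have "expectation (\<lambda>x. (Y x - c)\<^sup>2) = expectation (\<lambda>x. (Y x)\<^sup>2) - 2 * c * expectation Y + c\<^sup>2"
    using i by (simp add: power2_diff prob_space)
  also have "\<dots> = variance Y + (expectation Y - c)\<^sup>2"
    unfolding variance_eq[OF i] by (simp add: power2_eq_square algebra_simps)
  finally show ?thesis by simp
qed

definition truncation :: "real \<Rightarrow> 'a functional \<Rightarrow> nat \<Rightarrow> nat \<Rightarrow> 'a \<times> 'a \<Rightarrow> real" where
  "truncation K f N n z = truncate K (f N n (fst z) (snd z))"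

text \<open>The additive functional is only bounded almost surely, while the estimates for
  \<open>elliptic_chain\<close> need a bound at every point.\<close>

lemma truncated_functional:
  assumes X: "markov_array X" and f: "additive_functional X f"
    and K: "0 \<le> K" "\<forall>N. \<forall>n\<in>{1..len X N}. AE \<omega> in row_law X N. \<bar>f N n (\<omega> n) (\<omega> (n + 1))\<bar> \<le> K"
  defines "g \<equiv> truncation K f"
  shows "n \<in> {1..len X N} \<Longrightarrow>
      bounded_measurable (borel_state X N n \<Otimes>\<^sub>M borel_state X N (Suc n)) (g N n)"
    and "\<bar>g N n z\<bar> \<le> K"
    and "n \<in> {1..len X N} \<Longrightarrow> AE \<omega> in row_law X N. f N n (\<omega> n) (\<omega> (Suc n)) = g N n (\<omega> n, \<omega> (Suc n))"
    and "AE \<omega> in row_law X N. row_sum X f N \<omega> = (\<Sum>n\<in>{1..len X N}. g N n (\<omega> n, \<omega> (Suc n)))"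
    and "n \<in> {1..len X N} \<Longrightarrow> (\<lambda>\<omega>. f N n (\<omega> n) (\<omega> (Suc n))) \<in> borel_measurable (row_law X N)"
    and "row_sum X f N \<in> borel_measurable (row_law X N)"
proof -
  have meas: "(\<lambda>z. f N n (fst z) (snd z)) \<in> borel_measurable (borel_state X N n \<Otimes>\<^sub>M borel_state X N (Suc n))"
    if "n \<in> {1..len X N}" for n
    using f that by (simp add: additive_functional_def case_prod_unfold)
  show "bounded_measurable (borel_state X N n \<Otimes>\<^sub>M borel_state X N (Suc n)) (g N n)"
    if "n \<in> {1..len X N}" for n
    unfolding g_def truncation_def[abs_def] by (rule bounded_measurable_truncate[OF K(1) meas[OF that]])
  show "\<bar>g N n z\<bar> \<le> K" unfolding g_def truncation_def by (rule truncate_bound[OF K(1)])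
  show ae: "AE \<omega> in row_law X N. f N n (\<omega> n) (\<omega> (Suc n)) = g N n (\<omega> n, \<omega> (Suc n))"
    if "n \<in> {1..len X N}" for n
    using bspec[OF spec[OF K(2)] that] by eventually_elim (simp add: g_def truncation_def truncate_eq)
  have "AE \<omega> in row_law X N. \<forall>n\<in>{1..len X N}. f N n (\<omega> n) (\<omega> (Suc n)) = g N n (\<omega> n, \<omega> (Suc n))"
    by (rule AE_finite_allI) (auto intro: ae)
  then show "AE \<omega> in row_law X N. row_sum X f N \<omega> = (\<Sum>n\<in>{1..len X N}. g N n (\<omega> n, \<omega> (Suc n)))"
    by eventually_elim (simp add: row_sum_def)
  show m: "(\<lambda>\<omega>. f N n (\<omega> n) (\<omega> (Suc n))) \<in> borel_measurable (row_law X N)"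
    if "n \<in> {1..len X N}" for n
  proof -
    have "(\<lambda>\<omega>. (\<omega> n, \<omega> (Suc n))) \<in> row_law X N \<rightarrow>\<^sub>M borel_state X N n \<Otimes>\<^sub>M borel_state X N (Suc n)"
      using that row_law_prob(2)[OF X, of N]
      by (intro measurable_Pair) (auto intro: coordinate_measurable[OF X] cong: measurable_cong_sets)
    from measurable_compose[OF this meas[OF that]] show ?thesis by simp
  qed
  show "row_sum X f N \<in> borel_measurable (row_law X N)"
    unfolding row_sum_def[abs_def] using m by (intro borel_measurable_sum) simp
qed

lemma as_uniformly_boundedE:
  assumes "as_uniformly_bounded X f"
  obtains K where "0 \<le> K"
    "\<forall>N. \<forall>n\<in>{1..len X N}. AE \<omega> in row_law X N. \<bar>f N n (\<omega> n) (\<omega> (n + 1))\<bar> \<le> K"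
proof -
  obtain K where K: "\<forall>N. \<forall>n\<in>{1..len X N}. AE \<omega> in row_law X N. \<bar>f N n (\<omega> n) (\<omega> (n + 1))\<bar> \<le> K"
    using assms unfolding as_uniformly_bounded_def by blast
  show ?thesis
  proof (rule that[of "\<bar>K\<bar>"])
    show "\<forall>N. \<forall>n\<in>{1..len X N}. AE \<omega> in row_law X N. \<bar>f N n (\<omega> n) (\<omega> (n + 1))\<bar> \<le> \<bar>K\<bar>"
    proof (intro allI ballI)
      fix N n assume "n \<in> {1..len X N}"
      with K have "AE \<omega> in row_law X N. \<bar>f N n (\<omega> n) (\<omega> (n + 1))\<bar> \<le> K" by blast
      then show "AE \<omega> in row_law X N. \<bar>f N n (\<omega> n) (\<omega> (n + 1))\<bar> \<le> \<bar>K\<bar>"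
        by eventually_elim simp
    qed
  qed simp
qed

section \<open>The implications between bounded variance, center-tightness and gradient form\<close>

theorem bounded_variance_imp_center_tight:
  assumes X: "markov_array X" and f: "additive_functional X f" "as_uniformly_bounded X f"
    and bounded: "bounded (range (\<lambda>N. prob_space.variance (row_law X N) (row_sum X f N)))"
  shows "center_tight X f"
proof -
  obtain V where V: "\<And>N. prob_space.variance (row_law X N) (row_sum X f N) \<le> V"
    using bounded unfolding bounded_iff by (auto simp: abs_le_iff)
  obtain K where K: "0 \<le> K"
    "\<forall>N. \<forall>n\<in>{1..len X N}. AE \<omega> in row_law X N. \<bar>f N n (\<omega> n) (\<omega> (n + 1))\<bar> \<le> K"
    using f(2) by (rule as_uniformly_boundedE)
  note tr = truncated_functional[OF X f(1) K]
  show ?thesis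
    unfolding center_tight_def
  proof (intro exI allI impI)
    fix \<delta> :: real and N assume \<delta>: "0 < \<delta>"
    interpret prob_space "row_law X N" by (rule row_law_prob[OF X])
    \<comment> \<open>The summand 1 makes \<open>M\<close> positive and the Chebyshev bound strictly
      smaller than \<open>\<delta>\<close>.\<close>
    define M where "M = sqrt ((\<bar>V\<bar> + 1) / \<delta>)"
    have M: "0 < M" "M\<^sup>2 = (\<bar>V\<bar> + 1) / \<delta>" using \<delta> by (auto simp: M_def)
    let ?Y = "row_sum X f N"
    \<comment> \<open>The bound used here grows with the row length, but it only serves
      integrability and does not enter the estimate.\<close>
    have "integrable (row_law X N) (\<lambda>\<omega>. (?Y \<omega>)\<^sup>2)"
    proof (rule integrable_const_bound[where B = "(real (len X N) * K)\<^sup>2"])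
      show "AE \<omega> in row_law X N. norm ((?Y \<omega>)\<^sup>2) \<le> (real (len X N) * K)\<^sup>2"
        using tr(4)[of N]
      proof eventually_elim
        case (elim \<omega>)
        have "\<bar>?Y \<omega>\<bar> \<le> (\<Sum>n\<in>{1..len X N}. K)"
          unfolding elim by (rule order_trans[OF sum_abs sum_mono]) (rule tr(2))
        then have "\<bar>?Y \<omega>\<bar> \<le> real (len X N) * K" by simp
        then show ?case by (metis abs_ge_zero power2_abs power_mono real_norm_def abs_power2)
      qed
    qed (use tr(6)[of N] in simp)
    then have "prob {\<omega> \<in> space (row_law X N). M \<le> \<bar>?Y \<omega> - expectation ?Y\<bar>} \<le> variance ?Y / M\<^sup>2"
      by (rule Chebyshev_inequality[OF tr(6) _ M(1)])
    also have "\<dots> \<le> \<bar>V\<bar> / M\<^sup>2"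
      using V[of N] by (intro divide_right_mono) auto
    also have "\<dots> < \<delta>"
      unfolding M(2) using \<delta> by (simp add: field_simps)
    finally have "prob {\<omega> \<in> space (row_law X N). M \<le> \<bar>?Y \<omega> - expectation ?Y\<bar>} < \<delta>" .
    moreover have "prob {\<omega> \<in> space (row_law X N). M < \<bar>?Y \<omega> - expectation ?Y\<bar>}
        \<le> prob {\<omega> \<in> space (row_law X N). M \<le> \<bar>?Y \<omega> - expectation ?Y\<bar>}"
      using tr(6)[of N] by (intro finite_measure_mono) auto
    ultimately show "\<P>(\<omega> in row_law X N. sqrt ((\<bar>V\<bar> + 1) / \<delta>) <
        \<bar>row_sum X f N \<omega> - prob_space.expectation (row_law X N) (row_sum X f N)\<bar>) < \<delta>"
      by (simp add: M_def)
  qed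
qed

theorem center_tight_imp_gradient:
  assumes X: "markov_array X" "uniformly_elliptic X"
    and f: "additive_functional X f" "as_uniformly_bounded X f" and tight: "center_tight X f"
  shows "\<exists>a h. potential X a \<and> uniformly_bounded X a \<and> additive_functional X h \<and> summable_variance X h \<and>
    functional_eq X f (\<lambda>N n x y. gradient a N n x y + h N n x y)"
proof -
  obtain \<epsilon> :: real and \<mu> where chain:
    "\<And>N. elliptic_chain (row_law X N) (len X N) (past X N) (borel_state X N) (\<lambda>n \<omega>. \<omega> n) (kernel X N) (\<mu> N) \<epsilon>"
    using uniformly_elliptic_chain[OF X] by blast
  obtain K where K: "0 \<le> K"
    "\<forall>N. \<forall>n\<in>{1..len X N}. AE \<omega> in row_law X N. \<bar>f N n (\<omega> n) (\<omega> (n + 1))\<bar> \<le> K"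
    using f(2) by (rule as_uniformly_boundedE)
  define g where "g = truncation K f"
  note tr = truncated_functional[OF X(1) f(1) K, folded g_def]
  \<comment> \<open>The tail level demanded by \<open>tight_imp_gradient_decomposition\<close>. It
    does not depend on the row, so tightness yields one \<open>M\<close> for all rows.\<close>
  define \<delta> where "\<delta> = 1 / (4 * kurtosis_constant \<epsilon> K)"
  have \<delta>: "0 < \<delta>" using kurtosis_constant_pos[of \<epsilon> K] by (simp add: \<delta>_def)
  obtain m M where mM: "\<And>N. \<P>(\<omega> in row_law X N. M < \<bar>row_sum X f N \<omega> - m N\<bar>) < \<delta>"
    using tight \<delta> unfolding center_tight_def by meson
  define R where "R = max 0 M"
  define B where "B = max 1 (2 * (R + 4 * K / \<epsilon>)\<^sup>2)"
  \<comment> \<open>Collects the requirements on the potential of one row, so that a single choice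
    over \<open>N\<close> assembles the array.\<close>
  define good where "good N a \<longleftrightarrow> (\<forall>n\<in>{1..len X N+1}. bounded_measurable (borel_state X N n) (a n)
      \<and> (\<forall>x\<in>space (borel_state X N n). \<bar>a n x\<bar> \<le> 4 * K / \<epsilon>)) \<and>
    (\<Sum>n\<in>{1..len X N}. prob_space.variance (row_law X N)
      (\<lambda>\<omega>. g N n (\<omega> n, \<omega> (Suc n)) - (a (Suc n) (\<omega> (Suc n)) - a n (\<omega> n)))) \<le> B" for N a
  have "\<exists>a. good N a" for N
  proof -
    interpret elliptic_chain "row_law X N" "len X N" "past X N" "borel_state X N" "\<lambda>n \<omega>. \<omega> n"
      "kernel X N" "\<mu> N" \<epsilon> by (rule chain)
    let ?Z = "\<lambda>\<omega>. \<Sum>n\<in>{1..len X N}. g N n (\<omega> n, \<omega> (Suc n))"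
    have Z: "?Z \<in> borel_measurable (row_law X N)"
      by (intro borel_measurable_sum bounded_measurableD bm_step tr(1))
    note [measurable] = tr(6)[of N]
    have "\<P>(\<omega> in row_law X N. R < \<bar>?Z \<omega> - m N\<bar>) = \<P>(\<omega> in row_law X N. R < \<bar>row_sum X f N \<omega> - m N\<bar>)"
    proof (rule finite_measure_eq_AE)
      show "AE \<omega> in row_law X N. \<omega> \<in> {\<omega> \<in> space (row_law X N). R < \<bar>?Z \<omega> - m N\<bar>}
          \<longleftrightarrow> \<omega> \<in> {\<omega> \<in> space (row_law X N). R < \<bar>row_sum X f N \<omega> - m N\<bar>}"
        using tr(4)[of N] by eventually_elim simp
      show "{\<omega> \<in> space (row_law X N). R < \<bar>?Z \<omega> - m N\<bar>} \<in> events"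
        by (intro borel_measurable_less borel_measurable_const borel_measurable_abs borel_measurable_diff Z)
      show "{\<omega> \<in> space (row_law X N). R < \<bar>row_sum X f N \<omega> - m N\<bar>} \<in> events"
        by (intro borel_measurable_less borel_measurable_const borel_measurable_abs borel_measurable_diff tr(6))
    qed
    also have "\<dots> \<le> \<P>(\<omega> in row_law X N. M < \<bar>row_sum X f N \<omega> - m N\<bar>)"
      by (intro finite_measure_mono) (auto simp: R_def)
    also have "\<dots> \<le> \<delta>" using mM[of N] by simp
    finally show ?thesis
      unfolding good_def B_def \<delta>_def
      by (intro tight_imp_gradient_decomposition[where m = "m N"] tr) (auto simp: R_def)
  qed
  then obtain a where "\<And>N. good N (a N)" by metis
  then have a: "\<And>N n. n \<in> {1..len X N+1} \<Longrightarrow> bounded_measurable (borel_state X N n) (a N n)"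
      "\<And>N n x. n \<in> {1..len X N+1} \<Longrightarrow> x \<in> space (borel_state X N n) \<Longrightarrow> \<bar>a N n x\<bar> \<le> 4 * K / \<epsilon>"
      "\<And>N. (\<Sum>n\<in>{1..len X N}. prob_space.variance (row_law X N)
      (\<lambda>\<omega>. g N n (\<omega> n, \<omega> (Suc n)) - (a N (Suc n) (\<omega> (Suc n)) - a N n (\<omega> n)))) \<le> B"
    unfolding good_def by blast+
  \<comment> \<open>Defined from \<open>f\<close> and not from the truncation \<open>g\<close>, so
    that the decomposition holds at every pair of points. Replacing \<open>f\<close> by
    \<open>g\<close> changes \<open>h\<close> along the chain only on a null set, which suffices for
    bounds and variances.\<close>
  define h where "h N n x y = f N n x y - gradient a N n x y" for N n x y
  have ae: "AE \<omega> in row_law X N. h N n (\<omega> n) (\<omega> (Suc n))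
      = g N n (\<omega> n, \<omega> (Suc n)) - (a N (Suc n) (\<omega> (Suc n)) - a N n (\<omega> n))"
    if "n \<in> {1..len X N}" for N n
    using tr(3)[OF that] by eventually_elim (simp add: h_def gradient_def)
  have h: "additive_functional X h"
    unfolding additive_functional_def
  proof (intro allI ballI)
    fix N n assume n: "n \<in> {1..len X N}"
    then have n': "n \<in> {1..len X N+1}" "Suc n \<in> {1..len X N+1}" by auto
    have "(\<lambda>z. f N n (fst z) (snd z)) \<in> borel_measurable (borel_state X N n \<Otimes>\<^sub>M borel_state X N (Suc n))"
      using f(1) n by (simp add: additive_functional_def case_prod_unfold)
    moreover note [measurable] = bounded_measurableD[OF a(1)[OF n'(1)]] bounded_measurableD[OF a(1)[OF n'(2)]]
    have "(\<lambda>z. a N (Suc n) (snd z) - a N n (fst z)) \<in> borel_measurable (borel_state X N n \<Otimes>\<^sub>M borel_state X N (Suc n))"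
      by measurable
    ultimately show "case_prod (h N n) \<in> borel_measurable (borel_state X N n \<Otimes>\<^sub>M borel_state X N (n + 1))"
      by (simp add: h_def gradient_def case_prod_unfold)
  qed
  have h_bound: "AE \<omega> in row_law X N. \<bar>h N n (\<omega> n) (\<omega> (n + 1))\<bar> \<le> K + 8 * K / \<epsilon>"
    if n: "n \<in> {1..len X N}" for N n
  proof -
    interpret elliptic_chain "row_law X N" "len X N" "past X N" "borel_state X N" "\<lambda>n \<omega>. \<omega> n"
      "kernel X N" "\<mu> N" \<epsilon> by (rule chain)
    have n': "n \<in> {1..len X N+1}" "Suc n \<in> {1..len X N+1}" using n by auto
    show ?thesis
      using ae[OF n] AE_space
    proof eventually_elim
      case (elim \<omega>)
      show ?case
        using elim(1) tr(2)[of N n "(\<omega> n, \<omega> (Suc n))"]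
          a(2)[OF n'(1) X_space[OF n'(1) elim(2)]] a(2)[OF n'(2) X_space[OF n'(2) elim(2)]]
        by simp
    qed
  qed
  have h_var: "prob_space.variance (row_law X N) (\<lambda>\<omega>. h N n (\<omega> n) (\<omega> (n + 1)))
      = prob_space.variance (row_law X N)
          (\<lambda>\<omega>. g N n (\<omega> n, \<omega> (Suc n)) - (a N (Suc n) (\<omega> (Suc n)) - a N n (\<omega> n)))"
    if n: "n \<in> {1..len X N}" for N n
  proof -
    interpret elliptic_chain "row_law X N" "len X N" "past X N" "borel_state X N" "\<lambda>n \<omega>. \<omega> n"
      "kernel X N" "\<mu> N" \<epsilon> by (rule chain)
    have n': "n \<in> {1..len X N+1}" "Suc n \<in> {1..len X N+1}" using n by auto
    show ?thesis
    proof (rule variance_cong_AE)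
      show "(\<lambda>\<omega>. h N n (\<omega> n) (\<omega> (n + 1))) \<in> borel_measurable (row_law X N)"
        using truncated_functional(5)[OF X(1) h, of "K + 8 * K / \<epsilon>"] h_bound K(1) eps n by simp
      show "(\<lambda>\<omega>. g N n (\<omega> n, \<omega> (Suc n)) - (a N (Suc n) (\<omega> (Suc n)) - a N n (\<omega> n)))
          \<in> borel_measurable (row_law X N)"
        by (intro bounded_measurableD bounded_measurable_diff bm_step[OF n] tr(1) n bm_X n' a(1))
    qed (use ae[OF n] in simp)
  qed
  have "summable_variance X h"
    unfolding summable_variance_def as_uniformly_bounded_def
  proof (intro conjI bdd_aboveI2[where M = B])
    show "\<exists>K. \<forall>N. \<forall>n\<in>{1..len X N}. AE \<omega> in row_law X N. \<bar>h N n (\<omega> n) (\<omega> (n + 1))\<bar> \<le> K"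
      using h_bound by blast
    show "(\<Sum>n = 1..len X N. prob_space.variance (row_law X N) (\<lambda>\<omega>. h N n (\<omega> n) (\<omega> (n + 1)))) \<le> B" for N
      by (rule order_trans[OF eq_refl[OF sum.cong[OF refl h_var]] a(3)])
  qed
  moreover have "potential X a"
    unfolding potential_def using a(1) by (blast intro: bounded_measurableD)
  moreover have "uniformly_bounded X a"
    unfolding uniformly_bounded_def using a(2) by (metis space_borel_of_metric)
  moreover have "functional_eq X f (\<lambda>N n x y. gradient a N n x y + h N n x y)"
    unfolding functional_eq_def h_def by simp
  ultimately show ?thesis using h by blast
qed

text \<open>The gradient telescopes to a boundary term of size at most \<open>2 * A\<close>,
  contributing \<open>2 * (2 * A)\<^sup>2 = 8 * A\<^sup>2\<close>. The centered remainder is handled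
  by \<open>second_moment_le_sum_energy\<close>.\<close>

theorem gradient_imp_bounded_variance:
  assumes X: "markov_array X" "uniformly_elliptic X"
    and a: "potential X a" "uniformly_bounded X a"
    and h: "additive_functional X h" "summable_variance X h"
    and eq: "functional_eq X f (\<lambda>N n x y. gradient a N n x y + h N n x y)"
  shows "bounded (range (\<lambda>N. prob_space.variance (row_law X N) (row_sum X f N)))"
proof -
  obtain \<epsilon> :: real and \<mu> where chain:
    "\<And>N. elliptic_chain (row_law X N) (len X N) (past X N) (borel_state X N) (\<lambda>n \<omega>. \<omega> n) (kernel X N) (\<mu> N) \<epsilon>"
    using uniformly_elliptic_chain[OF X] by blast
  have "as_uniformly_bounded X h" using h(2) by (simp add: summable_variance_def)
  then obtain K where K: "0 \<le> K"
    "\<forall>N. \<forall>n\<in>{1..len X N}. AE \<omega> in row_law X N. \<bar>h N n (\<omega> n) (\<omega> (n + 1))\<bar> \<le> K"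
    by (rule as_uniformly_boundedE)
  define g where "g = truncation K h"
  note tr = truncated_functional[OF X(1) h(1) K, folded g_def]
  obtain A where A: "\<And>N n x. n \<in> {1..len X N + 1} \<Longrightarrow> x \<in> points X N n \<Longrightarrow> \<bar>a N n x\<bar> \<le> A"
    using a(2) unfolding uniformly_bounded_def by blast
  obtain B where B: "\<And>N. (\<Sum>n = 1..len X N. prob_space.variance (row_law X N) (\<lambda>\<omega>. h N n (\<omega> n) (\<omega> (n + 1)))) \<le> B"
    using h(2) unfolding summable_variance_def bdd_above_def by auto
  have e4: "0 \<le> mixing_constant \<epsilon>" by (simp add: mixing_constant_def)
  have "\<bar>prob_space.variance (row_law X N) (row_sum X f N)\<bar> \<le> 8 * A\<^sup>2 + 2 * ((6 + 14 * mixing_constant \<epsilon>) * B)" for N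
  proof -
    interpret elliptic_chain "row_law X N" "len X N" "past X N" "borel_state X N" "\<lambda>n \<omega>. \<omega> n"
      "kernel X N" "\<mu> N" \<epsilon> by (rule chain)
    let ?k = "len X N"
    define c where "c n = expectation (\<lambda>\<omega>. g N n (\<omega> n, \<omega> (Suc n)))" for n
    \<comment> \<open>Centering each entry provides the mean-zero hypothesis of
      \<open>second_moment_le_sum_energy\<close> and turns the energies into the variances whose sum
      is bounded by \<open>B\<close>.\<close>
    define g0 where "g0 n z = g N n z - c n" for n z
    define b where "b \<omega> = a N (Suc ?k) (\<omega> (Suc ?k)) - a N 1 (\<omega> 1)" for \<omega>
    define Y where "Y \<omega> = b \<omega> + (\<Sum>n\<in>{1..?k}. g N n (\<omega> n, \<omega> (Suc n)))" for \<omega>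
    have ends: "1 \<in> {1..?k+1}" "Suc ?k \<in> {1..?k+1}" using k_pos by auto
    have a_bm: "bm1 n (a N n)" if "n \<in> {1..?k+1}" for n
      using a(1) A that by (intro bounded_measurableI[where B = A]) (auto simp: potential_def space_borel_of_metric)
    have b_bm: "bounded_measurable (row_law X N) b"
      unfolding b_def[abs_def] by (intro bounded_measurable_diff bm_X a_bm ends)
    have Y_bm: "bounded_measurable (row_law X N) Y"
      unfolding Y_def[abs_def] by (intro bounded_measurable_add bounded_measurable_sum b_bm bm_step tr(1))
    have f_eq: "row_sum X f N \<omega> = b \<omega> + row_sum X h N \<omega>" if \<omega>: "\<omega> \<in> space (row_law X N)" for \<omega>
    proof -
      have "row_sum X f N \<omega> = (\<Sum>n = 1..?k. (a N (Suc n) (\<omega> (Suc n)) - a N n (\<omega> n)) + h N n (\<omega> n) (\<omega> (Suc n)))"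
        unfolding row_sum_def
      proof (rule sum.cong[OF refl])
        fix n assume n: "n \<in> {1..?k}"
        then have "\<omega> n \<in> points X N n" "\<omega> (n + 1) \<in> points X N (n + 1)"
          using X_space[of n \<omega>] X_space[of "Suc n" \<omega>] \<omega> by (auto simp: space_borel_of_metric)
        then show "f N n (\<omega> n) (\<omega> (n + 1)) = (a N (Suc n) (\<omega> (Suc n)) - a N n (\<omega> n)) + h N n (\<omega> n) (\<omega> (Suc n))"
          using eq n unfolding functional_eq_def gradient_def by simp
      qed
      also have "\<dots> = b \<omega> + row_sum X h N \<omega>"
        unfolding b_def row_sum_def sum.distrib using k_pos
        by (subst sum_Suc_diff) auto
      finally show ?thesis .
    qed
    have ae: "AE \<omega> in row_law X N. row_sum X f N \<omega> = Y \<omega>"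
      using tr(4)[of N] AE_space by eventually_elim (simp add: f_eq Y_def)
    have f_meas: "row_sum X f N \<in> borel_measurable (row_law X N)"
    proof (rule measurable_cong[THEN iffD2])
      show "(\<lambda>\<omega>. b \<omega> + row_sum X h N \<omega>) \<in> borel_measurable (row_law X N)"
        by (intro borel_measurable_add bounded_measurableD[OF b_bm] tr(6))
    qed (rule f_eq)
    have g0_bm: "bm2 n (g0 n)" if "n \<in> {1..?k}" for n
      unfolding g0_def[abs_def] by (intro bounded_measurable_intros tr(1) that)
    have g0_mean: "expectation (\<lambda>\<omega>. g0 n (\<omega> n, \<omega> (Suc n))) = 0" if "n \<in> {1..?k}" for n
      using bounded_measurable_integrable[OF bm_step[OF that tr(1)[OF that]]]
      by (simp add: g0_def c_def prob_space)
    have g0_energy: "energy g0 n = variance (\<lambda>\<omega>. h N n (\<omega> n) (\<omega> (n + 1)))" if n: "n \<in> {1..?k}" for n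
    proof -
      have "energy g0 n = variance (\<lambda>\<omega>. g N n (\<omega> n, \<omega> (Suc n)))"
        by (simp add: energy_def g0_def c_def)
      also have "\<dots> = variance (\<lambda>\<omega>. h N n (\<omega> n) (\<omega> (Suc n)))"
      proof (rule variance_cong_AE)
        show "AE \<omega> in row_law X N. g N n (\<omega> n, \<omega> (Suc n)) = h N n (\<omega> n) (\<omega> (Suc n))"
          using tr(3)[OF n] by eventually_elim simp
      qed (intro tr(5) n bounded_measurableD[OF bm_step[OF n tr(1)[OF n]]])+
      finally show ?thesis by simp
    qed
    have T_bm: "bounded_measurable (row_law X N) (\<lambda>\<omega>. \<Sum>n\<in>{1..?k}. g0 n (\<omega> n, \<omega> (Suc n)))"
      by (intro bounded_measurable_sum bm_step g0_bm)
    have pointwise: "(Y \<omega> - (\<Sum>n\<in>{1..?k}. c n))\<^sup>2 \<le> 8 * A\<^sup>2 + 2 * (\<Sum>n\<in>{1..?k}. g0 n (\<omega> n, \<omega> (Suc n)))\<^sup>2"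
      if \<omega>: "\<omega> \<in> space (row_law X N)" for \<omega>
    proof -
      have "\<bar>b \<omega>\<bar> \<le> 2 * A"
        using A[OF ends(1), of "\<omega> 1"] A[OF ends(2), of "\<omega> (Suc ?k)"] X_space[OF ends(1) \<omega>] X_space[OF ends(2) \<omega>]
        unfolding b_def by (simp add: space_borel_of_metric)
      then have "(b \<omega>)\<^sup>2 \<le> (2 * A)\<^sup>2" by (metis abs_ge_zero power2_abs power_mono)
      then have b2: "2 * (b \<omega>)\<^sup>2 \<le> 8 * A\<^sup>2" by simp
      have "Y \<omega> - (\<Sum>n\<in>{1..?k}. c n) = b \<omega> + (\<Sum>n\<in>{1..?k}. g0 n (\<omega> n, \<omega> (Suc n)))"
        by (simp add: Y_def g0_def sum_subtractf)
      then show ?thesis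
        using sq_add_le[of 1 "b \<omega>" "\<Sum>n\<in>{1..?k}. g0 n (\<omega> n, \<omega> (Suc n))"] b2 by simp
    qed
    have "variance (row_sum X f N) = variance Y"
      by (rule variance_cong_AE[OF f_meas bounded_measurableD[OF Y_bm] ae])
    also have "\<dots> \<le> expectation (\<lambda>\<omega>. (Y \<omega> - (\<Sum>n\<in>{1..?k}. c n))\<^sup>2)"
      by (rule variance_le_second_moment[OF Y_bm])
    also have "\<dots> \<le> expectation (\<lambda>\<omega>. 8 * A\<^sup>2 + 2 * (\<Sum>n\<in>{1..?k}. g0 n (\<omega> n, \<omega> (Suc n)))\<^sup>2)"
      by (intro integral_mono pointwise bounded_measurable_integrable bounded_measurable_add
          bounded_measurable_mult bounded_measurable_const bounded_measurable_power
          bounded_measurable_diff Y_bm T_bm)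
    also have "\<dots> = 8 * A\<^sup>2 + 2 * expectation (\<lambda>\<omega>. (\<Sum>n\<in>{1..?k}. g0 n (\<omega> n, \<omega> (Suc n)))\<^sup>2)"
      using bounded_measurable_integrable[OF bounded_measurable_power[OF T_bm, of 2]]
      by (simp add: prob_space)
    also have "\<dots> \<le> 8 * A\<^sup>2 + 2 * ((6 + 14 * mixing_constant \<epsilon>) * (\<Sum>n\<in>{1..?k}. energy g0 n))"
      using second_moment_le_sum_energy[OF g0_bm g0_mean] by simp
    also have "\<dots> \<le> 8 * A\<^sup>2 + 2 * ((6 + 14 * mixing_constant \<epsilon>) * B)"
      using B[of N] e4 by (simp add: g0_energy mult_left_mono)
    finally show ?thesis using variance_positive by simp
  qed
  note bound = this
  show ?thesis
    by (rule boundedI, erule rangeE) (simp only: real_norm_def, rule bound)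
qed

theorem theorem2p2:
  fixes X :: "'a array_data" and f :: "'a functional"
  assumes "markov_array X"
    and "uniformly_elliptic X"
    and "additive_functional X f"
    and "as_uniformly_bounded X f"
  shows "(bounded (range (\<lambda>N. prob_space.variance (row_law X N) (row_sum X f N)))
            \<longleftrightarrow> center_tight X f) \<and>
         (center_tight X f \<longleftrightarrow>
            (\<exists>a h. potential X a \<and> uniformly_bounded X a \<and>
                   additive_functional X h \<and> summable_variance X h \<and>
                   functional_eq X f (\<lambda>N n x y. gradient a N n x y + h N n x y)))"
proof -
  have "center_tight X f"
    if "bounded (range (\<lambda>N. prob_space.variance (row_law X N) (row_sum X f N)))"
    using assms that by (intro bounded_variance_imp_center_tight)
  moreover have "\<exists>a h. potential X a \<and> uniformly_bounded X a \<and>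
      additive_functional X h \<and> summable_variance X h \<and>
      functional_eq X f (\<lambda>N n x y. gradient a N n x y + h N n x y)" if "center_tight X f"
    using assms that by (intro center_tight_imp_gradient)
  moreover have "bounded (range (\<lambda>N. prob_space.variance (row_law X N) (row_sum X f N)))"
    if "\<exists>a h. potential X a \<and> uniformly_bounded X a \<and>
      additive_functional X h \<and> summable_variance X h \<and>
      functional_eq X f (\<lambda>N n x y. gradient a N n x y + h N n x y)"
    using assms that by (elim exE conjE) (rule gradient_imp_bounded_variance)
  ultimately show ?thesis by blast
qed

end
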